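(* Let $\mathcal E^\hbar$ be a big abstract quantum $D$-module (AQDM) on $B$ endowed with a frame $\Phi\colon\mathcal E_{\boldsymbol b,0}\otimes_K\mathcal O_B^\hbar\to\mathcal E^\hbar$ at an $\mathcal O$-valued point $\boldsymbol b$, and let $t^0,\dots,t^s$ be co-ordinates centered at $\boldsymbol b$. Assume that the connection operators $A_a(Q,t,\hbar),\Omega_i(Q,t,\hbar)\in\mathrm{End}(\mathcal E_{\boldsymbol b,0})\otimes\mathcal O_B^\hbar$ associated with $\Phi$ satisfy $$A_a(0,t,\hbar)=p_a,\qquad\Omega_i(0,t,\hbar)=\wp_i .$$ Let $\boldsymbol b'$ be an $\mathcal O$-valued point and $\Phi'\colon\mathcal E_{\boldsymbol b',0}\otimes_K\mathcal O_B^\hbar\to\mathcal E^\hbar$ a frame such that, for $G:=\Phi^{-1}\circ\Phi'\in\mathrm{Hom}(\mathcal E_{\boldsymbol b',0},\mathcal E_{\boldsymbol b,0})\otimes\mathcal O_B^\hbar$, the restriction $G_0=G_0(\hbar):=G|_{Q=0}$ is independent of $t$. Then the cone $\mathcal L'$ associated with $\boldsymbol b'$ and $\Phi'$ is related to the cone $\mathcal L$ associated with $\boldsymbol b$ and $\Phi$ by $$\mathcal L'=G_0(-\hbar)^{-1}\exp\Big(-\frac1\hbar\sum_{i=0}^sc^i\wp_i\Big)\mathcal L,\qquad c^i=t^i(\boldsymbol b')|_{Q=0}.$$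
   Context: **Ground ring.** $K$ is an integral domain containing $\mathbb Q$ with a valuation $v_K:K\to\mathbb R\cup\{\infty\}$ which is $0$ on nonzero rationals; $K$ is complete. $\mathfrak m_K=\{x: v_K(x)>0\}$ if $v_K(K)\subset\mathbb R_{\ge0}\cup\{\infty\}$, and $\mathfrak m_K=\{0\}$ otherwise. $K\{\hbar,\hbar^{-1}\}\!\}$ is the ring of series $\sum_{n\in\mathbb Z}a_n\hbar^n$, $a_n\in K$, with $\lim_{n\to+\infty}v_K(a_n)=\infty$ and $\inf_nv_K(a_n)>-\infty$; $K\{\hbar\}$ (resp. $K\{\!\{\hbar^{-1}\}\!\}$) is the subring with only non-negative (resp. non-positive) powers of $\hbar$. **Base.** $\mathcal O=K[\![Q^1,\dots,Q^r]\!]$, $\mathcal O^\hbar=K\{\hbar\}[\![Q^1,\dots,Q^r]\!]$, $\mathcal O_B=\mathcal O[\![t^0,\dots,t^s]\!]$, $\mathcal O_B^\hbar=\mathcal O^\hbar[\![t^0,\dots,t^s]\!]$. A formal power series ring $K[\![x_1,\dots,x_k]\!]$ has the topology with basic neighbourhoods of zero $U_n=\{\sum a_{i}x^{i}: v_K(a_i)\ge n\text{ if }|i|\le n\}$. A co-ordinate system on $B$ is a set $\hat t^0,\dots,\hat t^s\in\mathcal O_B$ with $\hat t^i|_{Q=t=0}\in\mathfrak m_K$ and $\mathcal O_B=\mathcal O[\![\hat t^0,\dots,\hat t^s]\!]$. An $\mathcal O$-valued point of $B$ is a continuous $\mathcal O$-algebra homomorphism $\mathcal O_B\to\mathcal O$;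 $t^i(\boldsymbol b')\in\mathcal O$ denotes the image of $t^i$ under $\boldsymbol b'$. Every $\mathcal O$-valued point is $\hat t^0=\dots=\hat t^s=0$ for some co-ordinate system ("centered" at it). **Heisenberg algebra and fibers.** $\mathcal D_B$ is generated over $\mathcal O_B^\hbar$ by mutually commuting $\boldsymbol P_1,\dots,\boldsymbol P_r,\boldsymbol\wp_0,\dots,\boldsymbol\wp_s$ with $[\boldsymbol P_a,g]=\hbar Q^a\partial g/\partial Q^a$, $[\boldsymbol\wp_i,g]=\hbar\,\partial g/\partial t^i$ for $g\in\mathcal O_B^\hbar$. For a $\mathcal D_B$-module $\mathcal E^\hbar$ and a point $\boldsymbol b$ with centered co-ordinates $t^i$: $\mathcal E^\hbar_{\boldsymbol b}=\mathcal E^\hbar/\sum_it^i\mathcal E^\hbar$, $\mathcal E^\hbar_{\boldsymbol b,0}=\mathcal E^\hbar_{\boldsymbol b}/\sum_aQ^a\mathcal E^\hbar_{\boldsymbol b}$, $\mathcal E_{\boldsymbol b,0}=\mathcal E^\hbar_{\boldsymbol b,0}/\hbar\mathcal E^\hbar_{\boldsymbol b,0}$; $p_a$ and $\wp_i$ are the operators induced by $\boldsymbol P_a$ (on $\mathcal E^\hbar_{\boldsymbol b,0}$, $\mathcal E_{\boldsymbol b,0}$) and $\boldsymbol\wp_i$ (on $\mathcal E_{\boldsymbol b,0}$). **Big AQDM.** A $\mathcal D_B$-module $\mathcal E^\hbar$ such that at an $\mathcal O$-valued point $\boldsymbol b$ (equivalently, any): (1) $\mathcal E^\hbar$ is a finitely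 generated free $\mathcal O_B^\hbar$-module; (2) there is a splitting $\Phi_0:\mathcal E_{\boldsymbol b,0}\to\mathcal E^\hbar_{\boldsymbol b,0}$ inducing an isomorphism $\mathcal E_{\boldsymbol b,0}\otimes_KK\{\hbar\}\cong\mathcal E^\hbar_{\boldsymbol b,0}$ of $K\{\hbar\}[p_1,\dots,p_r]$-modules; (3) matrix elements of $p_a^n$ on $\mathcal E_{\boldsymbol b,0}$ in some $K$-basis have valuations bounded below uniformly in $n\ge0$; (4) there is $e_0\in\mathcal E_{\boldsymbol b,0}$ with $\{\wp_ie_0\}_{i=0}^s$ a $K$-basis of $\mathcal E_{\boldsymbol b,0}$. **Frames and connection operators.** A frame at $\boldsymbol b$ is a splitting $\Phi:\mathcal E_{\boldsymbol b,0}\to\mathcal E^\hbar$ inducing an $\mathcal O_B^\hbar$-module isomorphism $\Phi:\mathcal E_{\boldsymbol b,0}\otimes_K\mathcal O_B^\hbar\to\mathcal E^\hbar$ such that the induced $\Phi_0:\mathcal E_{\boldsymbol b,0}\otimes_KK\{\hbar\}\to\mathcal E^\hbar_{\boldsymbol b,0}$ is an isomorphism of $K\{\hbar\}[p_1,\dots,p_r]$-modules. Via $\Phi$, $\boldsymbol P_a$ and $\boldsymbol\wp_i$ act as $\hbar Q^a\partial/\partial Q^a+A_a(Q,t,\hbar)$ and $\hbar\,\partial/\partial t^i+\Omega_i(Q,t,\hbar)$; $A_a,\Omega_i$ are the connection operators. **Fundamental solution and cone.** The fundamental solution $L=L(Q,t,\hbar)$ associated with $\boldsymbol b,\Phi$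 is the unique element of $\mathrm{End}(\mathcal E_{\boldsymbol b,0})\otimes K\{\hbar,\hbar^{-1}\}\!\}[\![Q,t]\!]$ with $\hbar\frac{\partial}{\partial t^i}L+\Omega_iL=0$, $\hbar Q^a\frac{\partial}{\partial Q^a}L+A_aL-Lp_a=0$, and $L=\mathrm{id}$ at $Q=0$, $t=0$ ($t$ centered at $\boldsymbol b$). With $\mathcal H=\mathcal E_{\boldsymbol b,0}\otimes K\{\hbar,\hbar^{-1}\}\!\}[\![Q]\!]$, the cone associated with $\boldsymbol b$ and $\Phi$ is $$\mathcal L=\bigcup_{\boldsymbol b''}\hbar\,L(Q,t(\boldsymbol b''),-\hbar)^{-1}\big(\mathcal E_{\boldsymbol b,0}\otimes K\{\hbar\}[\![Q]\!]\big)\subset\mathcal H,$$ where $\boldsymbol b''$ ranges over all $\mathcal O$-valued points of $B$. $\mathcal L'$ is defined in the same way from $\boldsymbol b'$, $\Phi'$ inside $\mathcal E_{\boldsymbol b',0}\otimes K\{\hbar,\hbar^{-1}\}\!\}[\![Q]\!]$.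
   Formalization: The exponent's sign is corrected: the cone relation proved is L' = G_0(-ħ)^{-1} exp(+(1/ħ) Σ c^i ℘_i) L; with the stated definitions the printed minus sign fails, e.g. for the quantum D-module of P^1 over C[[λ]] with c^1 = λ. *)

theory Defs
  imports "HOL-Analysis.Analysis"
begin

text \<open>The ground ring \<open>K\<close>. The metric is \<open>e\<^sup>-\<^sup>v\<close>, so \<open>complete_space\<close> is completeness with respect
  to \<open>v\<^sub>K\<close>.\<close>
class complete_valuation_domain = idom + complete_space +
  fixes vK :: "'a \<Rightarrow> ereal"
  assumes vK_eq_PInf: "vK x = \<infinity> \<longleftrightarrow> x = 0"
    and vK_ne_MInf: "vK x \<noteq> - \<infinity>"
    and vK_mult: "vK (x * y) = vK x + vK y"
    and vK_add: "min (vK x) (vK y) \<le> vK (x + y)"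
    and Rats_subset: "n \<noteq> 0 \<Longrightarrow> \<exists>x. of_int n * x = 1"
    and vK_Rats: "m \<noteq> 0 \<Longrightarrow> n \<noteq> 0 \<Longrightarrow> of_int n * x = of_int m \<Longrightarrow> vK x = 0"
    and dist_vK: "dist x y = (if x = y then 0 else exp (- real_of_ereal (vK (x - y))))"

definition absK :: "'k::complete_valuation_domain \<Rightarrow> real" where
  "absK x = dist x 0"

lemma absK_vK: "absK x = (if x = 0 then 0 else exp (- real_of_ereal (vK x)))"
  by (simp add: absK_def dist_vK)

lemma dist_absK: "dist x y = absK (x - y)"
  by (auto simp: absK_def dist_vK)

lemma absK_0 [simp]: "absK 0 = 0" and absK_nonneg [simp]: "0 \<le> absK x"
  and absK_eq_0 [simp]: "absK x = 0 \<longleftrightarrow> x = 0"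
  by (simp_all add: absK_def)

lemma vK_finite: "x \<noteq> 0 \<Longrightarrow> \<bar>vK x\<bar> \<noteq> \<infinity>"
  using vK_eq_PInf[of x] vK_ne_MInf[of x] by (cases "vK x") auto

lemma vK_realE:
  assumes "x \<noteq> 0" obtains c where "vK x = ereal c"
proof (cases "vK x")
  case (real c)
  then show thesis by (rule that)
qed (use assms vK_eq_PInf[of x] vK_ne_MInf[of x] in simp_all)

lemma absK_mult: "absK (x * y) = absK x * absK y"
proof (cases "x = 0 \<or> y = 0")
  case False
  then have "real_of_ereal (vK x + vK y) = real_of_ereal (vK x) + real_of_ereal (vK y)"
    by (intro real_of_ereal_add[THEN trans]) (auto dest!: vK_finite)
  with False show ?thesis
    by (simp add: absK_vK vK_mult exp_add[symmetric])
qed auto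

lemma absK_add: "absK (x + y) \<le> max (absK x) (absK y)"
proof (cases "x = 0 \<or> y = 0 \<or> x + y = 0")
  case False
  then obtain a b c where abc: "vK x = ereal a" "vK y = ereal b" "vK (x + y) = ereal c"
    using vK_realE[of x] vK_realE[of y] vK_realE[of "x + y"] by metis
  have "min a b \<le> c"
    using vK_add[of x y] abc by (simp add: min_def split: if_splits)
  then have "a \<le> c \<or> b \<le> c" by auto
  with False abc show ?thesis
    by (auto simp: absK_vK le_max_iff_disj)
qed (auto simp: le_max_iff_disj)

lemma absK_1 [simp]: "absK 1 = 1"
  by (metis absK_eq_0 absK_mult mult_1 mult_cancel_right1 zero_neq_one)

lemma absK_minus [simp]: "absK (- x) = absK x"
proof -
  have "absK (-1::'a) ^ 2 = 1"
    by (metis absK_1 absK_mult minus_mult_minus mult_1 power2_eq_square)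
  then have "absK (-1::'a) = 1"
    by (metis absK_nonneg abs_of_nonneg one_power2 power2_eq_iff_nonneg zero_le_one)
  then show ?thesis
    by (metis absK_mult mult_1 mult_minus1)
qed

lemma absK_diff: "absK (x - y) \<le> max (absK x) (absK y)"
  using absK_add[of x "-y"] by simp

lemma absK_sum:
  "finite F \<Longrightarrow> 0 \<le> B \<Longrightarrow> (\<And>i. i \<in> F \<Longrightarrow> absK (f i) \<le> B) \<Longrightarrow> absK (sum f F) \<le> B"
proof (induction F rule: finite_induct)
  case (insert i F)
  then have "absK (f i) \<le> B" "absK (sum f F) \<le> B" by auto
  with insert.hyps show ?case using absK_add[of "f i" "sum f F"] by simp
qed simp

lemma absK_le_vK: "absK x \<le> exp (- C) \<longleftrightarrow> ereal C \<le> vK x"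
proof (cases "x = 0")
  case True
  then show ?thesis using vK_eq_PInf[of x] by (simp add: absK_vK)
next
  case False
  then obtain a where "vK x = ereal a" by (rule vK_realE)
  with False show ?thesis by (simp add: absK_vK)
qed

instance complete_valuation_domain \<subseteq> topological_ab_group_add
proof
  fix a b :: 'a
  show "((\<lambda>x. fst x + snd x) \<longlongrightarrow> a + b) (nhds a \<times>\<^sub>F nhds b)"
    unfolding tendsto_iff
  proof safe
    fix e :: real assume "e > 0"
    have "eventually (\<lambda>x. dist x a < e) (nhds a)" "eventually (\<lambda>x. dist x b < e) (nhds b)"
      using \<open>e > 0\<close> by (auto simp: eventually_nhds_metric)
    then have "eventually (\<lambda>p. dist (fst p) a < e \<and> dist (snd p) b < e) (nhds a \<times>\<^sub>F nhds b)"
      by (auto simp: eventually_prod_filter)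
    then show "\<forall>\<^sub>F x in nhds a \<times>\<^sub>F nhds b. dist (fst x + snd x) (a + b) < e"
    proof eventually_elim
      case (elim p)
      have "absK (fst p + snd p - (a + b)) \<le> max (absK (fst p - a)) (absK (snd p - b))"
        using absK_add[of "fst p - a" "snd p - b"] by (simp add: algebra_simps)
      also have "\<dots> < e" using elim by (simp add: dist_absK)
      finally show ?case by (simp add: dist_absK)
    qed
  qed
  show "(uminus \<longlongrightarrow> - a) (nhds a)"
    unfolding tendsto_iff
  proof safe
    fix e :: real assume "e > 0"
    then have "eventually (\<lambda>x. dist x a < e) (nhds a)"
      by (auto simp: eventually_nhds_metric)
    then show "eventually (\<lambda>x. dist (- x) (- a) < e) (nhds a)"
      by eventually_elim (metis absK_minus dist_absK minus_diff_minus)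
  qed
qed

lemma tendsto_absK: "((f :: _ \<Rightarrow> 'k::complete_valuation_domain) \<longlongrightarrow> l) F \<longleftrightarrow> ((\<lambda>x. absK (f x - l)) \<longlongrightarrow> 0) F"
  by (simp add: tendsto_dist_iff[of f] dist_absK)

instance complete_valuation_domain \<subseteq> topological_semigroup_mult
proof
  fix a b :: 'a
  let ?F = "nhds a \<times>\<^sub>F nhds b"
  have 1: "(fst \<longlongrightarrow> a) ?F" "(snd \<longlongrightarrow> b) ?F"
    by (rule filterlim_fst, rule filterlim_snd)
  then have 2: "((\<lambda>x. absK (fst x - a)) \<longlongrightarrow> 0) ?F" "((\<lambda>x. absK (snd x - b)) \<longlongrightarrow> 0) ?F"
    using tendsto_absK[of fst a] tendsto_absK[of snd b] by blast+
  have "((\<lambda>x. max (absK (fst x - a) * absK (snd x - b)) (max (absK a * absK (snd x - b)) (absK (fst x - a) * absK b)))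
     \<longlongrightarrow> max (0 * 0) (max (absK a * 0) (0 * absK b))) ?F"
    by (intro tendsto_max tendsto_mult tendsto_const 2)
  then have 3: "((\<lambda>x. max (absK (fst x - a) * absK (snd x - b)) (max (absK a * absK (snd x - b)) (absK (fst x - a) * absK b)))
     \<longlongrightarrow> 0) ?F" by simp
  show "((\<lambda>x. fst x * snd x) \<longlongrightarrow> a * b) ?F"
    unfolding tendsto_absK
  proof (rule Lim_null_comparison[OF _ 3], rule always_eventually, rule allI)
    fix x :: "'a \<times> 'a"
    have "fst x * snd x - a * b = (fst x - a) * (snd x - b) + (a * (snd x - b) + (fst x - a) * b)"
      by (simp add: algebra_simps)
    then have "absK (fst x * snd x - a * b) \<le>
        max (absK ((fst x - a) * (snd x - b))) (absK (a * (snd x - b) + (fst x - a) * b))"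
      using absK_add by metis
    also have "\<dots> \<le> max (absK ((fst x - a) * (snd x - b))) (max (absK (a * (snd x - b))) (absK ((fst x - a) * b)))"
      by (rule max.mono[OF order.refl absK_add])
    finally show "norm (absK (fst x * snd x - a * b))
          \<le> max (absK (fst x - a) * absK (snd x - b)) (max (absK a * absK (snd x - b)) (absK (fst x - a) * absK b))"
      by (simp add: absK_mult)
  qed
qed

lemma uniformly_continuous_plus_vK:
  "uniformly_continuous_on UNIV (\<lambda>(x::'k::complete_valuation_domain, y). x + y)"
  unfolding uniformly_continuous_on_def
proof (intro allI impI)
  fix e :: real assume "e > 0"
  have "dist (fst p + snd p) (fst q + snd q) < e" if "dist p q < e" for p q :: "'k \<times> 'k"
  proof -
    have "absK (fst p + snd p - (fst q + snd q)) \<le> max (absK (fst p - fst q)) (absK (snd p - snd q))"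
      using absK_add[of "fst p - fst q" "snd p - snd q"] by (simp add: algebra_simps)
    also have "\<dots> < e"
      using that dist_fst_le[of p q] dist_snd_le[of p q] by (simp add: dist_absK)
    finally show ?thesis by (simp add: dist_absK)
  qed
  then show "\<exists>d>0. \<forall>x\<in>UNIV. \<forall>x'\<in>UNIV. dist x' x < d \<longrightarrow>
      dist (case x' of (x::'k, y) \<Rightarrow> x + y) (case x of (x, y) \<Rightarrow> x + y) < e"
    using \<open>e > 0\<close> by (auto simp: case_prod_beta)
qed

lemma summable_on_vK:
  fixes f :: "'i \<Rightarrow> 'k::complete_valuation_domain"
  assumes "\<And>e. e > 0 \<Longrightarrow> finite {i \<in> A. absK (f i) > e}"
  shows "f summable_on A"
proof -
  define X where "X n = {i \<in> A. absK (f i) > inverse (real (Suc n))}" for n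
  have fX: "finite (X n)" for n unfolding X_def by (rule assms) simp
  have sub: "absK (sum f F - sum f (X n)) \<le> inverse (real (Suc n))"
    if "X n \<subseteq> F" "finite F" "F \<subseteq> A" for F n
  proof -
    have "sum f F - sum f (X n) = sum f (F - X n)"
      using that fX by (metis add_diff_cancel_right' sum.subset_diff)
    also have "absK \<dots> \<le> inverse (real (Suc n))"
      by (rule absK_sum) (use that in \<open>auto simp: X_def not_less\<close>)
    finally show ?thesis .
  qed
  have XA: "X n \<subseteq> A" for n by (auto simp: X_def)
  have inv_mono: "inverse (real (Suc n)) \<le> inverse (real (Suc m))" if "m \<le> n" for m n
    using that by (intro le_imp_inverse_le) auto
  have mono: "X m \<subseteq> X n" if "m \<le> n" for m n
    using inv_mono[OF that] unfolding X_def by (blast intro: le_less_trans)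
  have "Cauchy (\<lambda>n. sum f (X n))"
  proof (rule metric_CauchyI)
    fix e :: real assume "e > 0"
    then obtain M where M: "inverse (real (Suc M)) < e" using reals_Archimedean by blast
    have 1: "absK (sum f (X m) - sum f (X M)) < e" if "m \<ge> M" for m
      using sub[OF mono[OF that] fX XA] M by (rule le_less_trans)
    have 2: "absK (a - b) < e" if "absK (a - c) < e" "absK (b - c) < e" for a b c :: 'k
    proof -
      have "absK (a - b) \<le> max (absK (a - c)) (absK (b - c))"
        using absK_diff[of "a - c" "b - c"] by simp
      also have "\<dots> < e" using that by simp
      finally show ?thesis .
    qed
    show "\<exists>M. \<forall>m\<ge>M. \<forall>n\<ge>M. dist (sum f (X m)) (sum f (X n)) < e"
      unfolding dist_absK by (intro exI[of _ M] allI impI 2[OF 1 1])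
  qed
  then obtain s where s: "(\<lambda>n. sum f (X n)) \<longlonglongrightarrow> s"
    using Cauchy_convergent convergent_def by blast
  have "(f has_sum s) A"
    unfolding has_sum_def tendsto_iff eventually_finite_subsets_at_top
  proof safe
    fix e :: real assume "e > 0"
    then obtain M where M: "inverse (real (Suc M)) < e" using reals_Archimedean by blast
    obtain N where N: "\<And>n. n \<ge> N \<Longrightarrow> dist (sum f (X n)) s < e"
      using s \<open>e > 0\<close> unfolding lim_sequentially by blast
    define n where "n = max M N"
    have n: "inverse (real (Suc n)) < e" "dist (sum f (X n)) s < e"
      using M N[of n] le_less_trans[OF inv_mono[of M n] M] by (simp_all add: n_def del: of_nat_Suc)
    have *: "dist (sum f F) s < e" if F: "finite F" "X n \<subseteq> F" "F \<subseteq> A" for F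
    proof -
      have "absK (sum f F - s) \<le> max (absK (sum f F - sum f (X n))) (absK (sum f (X n) - s))"
        using absK_add[of "sum f F - sum f (X n)" "sum f (X n) - s"] by simp
      also have "\<dots> < e"
        using le_less_trans[OF sub[OF F(2,1,3)] n(1)] n(2) by (simp add: dist_absK)
      finally show ?thesis by (simp only: dist_absK)
    qed
    show "\<exists>X. finite X \<and> X \<subseteq> A \<and> (\<forall>Y. finite Y \<and> X \<subseteq> Y \<and> Y \<subseteq> A \<longrightarrow> dist (sum f Y) s < e)"
      by (intro exI[of _ "X n"] conjI fX XA allI impI *) simp_all
  qed
  then show ?thesis by (auto simp: summable_on_def)
qed

lemma absK_infsum_le:
  assumes a1: "\<And>i. i \<in> A \<Longrightarrow> absK (f i) \<le> B" and a2: "0 \<le> B"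
  shows "absK (infsum f A) \<le> B"
proof (cases "f summable_on A")
  case True
  have "(sum f \<longlongrightarrow> infsum f A) (finite_subsets_at_top A)"
    using has_sum_infsum[OF True] unfolding has_sum_def .
  then have *: "((\<lambda>F. dist (sum f F) 0) \<longlongrightarrow> dist (infsum f A) 0) (finite_subsets_at_top A)"
    using tendsto_const by (rule tendsto_dist)
  have **: "((\<lambda>F. absK (sum f F)) \<longlongrightarrow> absK (infsum f A)) (finite_subsets_at_top A)"
    using * unfolding absK_def .
  have "\<forall>\<^sub>F F in finite_subsets_at_top A. absK (sum f F) \<le> B"
    using a1 a2 by (intro eventually_finite_subsets_at_top_weakI absK_sum) blast+
  then show ?thesis by (rule tendsto_upperbound[OF **]) (rule finite_subsets_at_top_neq_bot)
next
  case False
  then show ?thesis using a2 infsum_not_exists[OF False] by (simp only: absK_0)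
qed

text \<open>The ring \<open>K{\<hbar>,\<hbar>\<^sup>-\<^sup>1}}\<close>: the function \<open>a\<close> is \<open>\<Sum>\<^sub>n a n \<hbar>\<^sup>n\<close>.\<close>

typedef (overloaded) 'k hseries =
  "{a :: int \<Rightarrow> 'k::complete_valuation_domain.
      ((\<lambda>n. vK (a n)) \<longlongrightarrow> \<infinity>) at_top \<and> (INF n. vK (a n)) > - \<infinity>}"
  morphisms hcoeff Abs_hseries
proof
  have "vK (0::'k) = \<infinity>" by (simp add: vK_eq_PInf)
  then show "(\<lambda>_. 0) \<in> {a :: int \<Rightarrow> 'k. ((\<lambda>n. vK (a n)) \<longlongrightarrow> \<infinity>) at_top \<and> (INF n. vK (a n)) > - \<infinity>}"
    by simp
qed

setup_lifting type_definition_hseries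

lemma tendsto_vK_PInf:
  "((\<lambda>n. vK (a n)) \<longlongrightarrow> \<infinity>) F \<longleftrightarrow> ((\<lambda>n. absK (a n)) \<longlongrightarrow> 0) F"
proof
  assume L: "((\<lambda>n. vK (a n)) \<longlongrightarrow> \<infinity>) F"
  show "((\<lambda>n. absK (a n)) \<longlongrightarrow> 0) F"
    unfolding tendsto_iff
  proof safe
    fix e :: real assume "e > 0"
    have "eventually (\<lambda>n. ereal (- ln e) < vK (a n)) F"
      using L unfolding tendsto_PInfty by (rule spec)
    then show "eventually (\<lambda>n. dist (absK (a n)) 0 < e) F"
    proof eventually_elim
      case (elim n)
      show ?case
      proof (cases "a n = 0")
        case False
        then obtain c where c: "vK (a n) = ereal c" by (rule vK_realE)
        then have "- c < ln e" using elim by simp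
        then have "exp (- c) < exp (ln e)" by (simp only: exp_less_cancel_iff)
        then have "absK (a n) < e" using False c \<open>e > 0\<close> by (simp add: absK_vK)
        then show ?thesis by simp
      qed (use \<open>e > 0\<close> in simp)
    qed
  qed
next
  assume R: "((\<lambda>n. absK (a n)) \<longlongrightarrow> 0) F"
  show "((\<lambda>n. vK (a n)) \<longlongrightarrow> \<infinity>) F"
    unfolding tendsto_PInfty
  proof
    fix r :: real
    have "eventually (\<lambda>n. absK (a n) < exp (- (r + 1))) F"
      by (rule order_tendstoD(2)[OF R]) simp
    then show "eventually (\<lambda>n. ereal r < vK (a n)) F"
    proof eventually_elim
      case (elim n)
      then have "ereal (r + 1) \<le> vK (a n)" by (simp only: absK_le_vK[symmetric] less_imp_le)
      moreover have "ereal r < ereal (r + 1)" by simp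
      ultimately show ?case by (rule less_le_trans[rotated])
    qed
  qed
qed

lemma INF_vK_MInf:
  "(INF n. vK (a n)) > - \<infinity> \<longleftrightarrow> (\<exists>B. \<forall>n. absK (a n) \<le> B)"
proof
  assume "(INF n. vK (a n)) > - \<infinity>"
  then obtain c where "ereal c < (INF n. vK (a n))" using ereal_dense2 by blast
  then have "ereal c \<le> vK (a n)" for n
    by (rule order_trans[OF less_imp_le INF_lower]) simp
  then have "absK (a n) \<le> exp (- c)" for n by (simp only: absK_le_vK)
  then show "\<exists>B. \<forall>n. absK (a n) \<le> B" by blast
next
  assume "\<exists>B. \<forall>n. absK (a n) \<le> B"
  then obtain B where B: "\<And>n. absK (a n) \<le> B" by blast
  have "absK (a n) \<le> exp (- (- ln (max B 1)))" for n
  proof -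
    have "exp (- (- ln (max B 1))) = max B 1" by (simp only: minus_minus exp_ln_iff max.strict_coboundedI2 zero_less_one)
    with B[of n] show ?thesis by linarith
  qed
  then have "ereal (- ln (max B 1)) \<le> vK (a n)" for n
    by (simp only: absK_le_vK)
  then have "ereal (- ln (max B 1)) \<le> (INF n. vK (a n))"
    by (intro INF_greatest)
  then show "(INF n. vK (a n)) > - \<infinity>"
    using less_le_trans[of "- \<infinity>" "ereal (- ln (max B 1))"] by auto
qed

lemma hseries_iff:
  "((\<lambda>n. vK (a n)) \<longlongrightarrow> \<infinity>) at_top \<and> (INF n. vK (a n)) > - \<infinity> \<longleftrightarrow>
    (\<forall>e>0. \<exists>N. \<forall>n\<ge>N. absK (a n) < e) \<and> (\<exists>B>0. \<forall>n. absK (a (n::int)) \<le> B)"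
proof -
  have 1: "(\<exists>B. \<forall>n. absK (a n) \<le> B) \<longleftrightarrow> (\<exists>B>0. \<forall>n. absK (a n) \<le> B)"
  proof
    assume "\<exists>B. \<forall>n. absK (a n) \<le> B"
    then obtain B where B: "\<forall>n. absK (a n) \<le> B" ..
    have "max B 1 > 0 \<and> (\<forall>n. absK (a n) \<le> max B 1)"
    proof (intro conjI allI)
      fix n show "absK (a n) \<le> max B 1"
        using B[THEN spec, of n] by linarith
    qed linarith
    then show "\<exists>B>0. \<forall>n. absK (a n) \<le> B" ..
  next
    assume "\<exists>B>0. \<forall>n. absK (a n) \<le> B"
    then show "\<exists>B. \<forall>n. absK (a n) \<le> B" by (elim exE conjE) (rule exI)
  qed
  have 2: "((\<lambda>n. absK (a n)) \<longlongrightarrow> 0) at_top \<longleftrightarrow> (\<forall>e>0. \<exists>N. \<forall>n\<ge>N. absK (a n) < e)"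
    by (simp only: tendsto_iff eventually_at_top_linorder dist_real_def diff_0_right abs_of_nonneg[OF absK_nonneg])
  show ?thesis
    unfolding tendsto_vK_PInf INF_vK_MInf 1 2 by (rule refl)
qed

lemma hcoeff_small:
  assumes "e > 0" obtains N where "\<And>n. n \<ge> N \<Longrightarrow> absK (hcoeff a n) < e"
proof -
  have "\<exists>N. \<forall>n\<ge>N. absK (hcoeff a n) < e"
    using hcoeff[of a, unfolded mem_Collect_eq hseries_iff] assms by simp
  then show thesis using that by blast
qed

lemma hcoeff_bounded:
  obtains B where "B > 0" "\<And>n. absK (hcoeff a n) \<le> B"
proof -
  have "\<exists>B>0. \<forall>n. absK (hcoeff a n) \<le> B"
    using hcoeff[of a, unfolded mem_Collect_eq hseries_iff] by simp
  then show thesis using that by blast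
qed

lemma hcoeff_inject_ext: "(\<And>n. hcoeff a n = hcoeff b n) \<Longrightarrow> a = b"
  by (metis ext hcoeff_inject)

instantiation hseries :: (complete_valuation_domain) comm_ring_1
begin

lift_definition zero_hseries :: "'a hseries" is "\<lambda>_. 0"
  unfolding hseries_iff by (auto intro: exI[of _ "1::real"])

lift_definition one_hseries :: "'a hseries" is "\<lambda>n. if n = 0 then 1 else 0"
  unfolding hseries_iff
  by (intro conjI allI impI exI[of _ "1::int"] exI[of _ "1::real"]) auto

lemma hseries_add_aux:
  fixes a b :: "int \<Rightarrow> 'a"
  assumes op: "\<And>n. absK (c n) \<le> max (absK (a n)) (absK (b n))"
    and a: "(\<forall>e>0. \<exists>N. \<forall>n\<ge>N. absK (a n) < e) \<and> (\<exists>B>0. \<forall>n. absK (a n) \<le> B)"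
    and b: "(\<forall>e>0. \<exists>N. \<forall>n\<ge>N. absK (b n) < e) \<and> (\<exists>B>0. \<forall>n. absK (b n) \<le> B)"
  shows "(\<forall>e>0. \<exists>N. \<forall>n\<ge>N. absK (c n) < e) \<and> (\<exists>B>0. \<forall>n. absK (c n) \<le> B)"
proof safe
  fix e :: real assume "e > 0"
  with a b obtain N M where "\<forall>n\<ge>N. absK (a n) < e" "\<forall>n\<ge>M. absK (b n) < e" by blast
  then have "\<forall>n\<ge>max N M. absK (c n) < e"
    using le_less_trans[OF op] by simp
  then show "\<exists>N. \<forall>n\<ge>N. absK (c n) < e" by blast
next
  obtain A B where "A > 0" "\<forall>n. absK (a n) \<le> A" "\<forall>n. absK (b n) \<le> B"
    using a b by blast
  then have "max A B > 0" "\<forall>n. absK (c n) \<le> max A B"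
    by (auto simp: less_max_iff_disj intro: order_trans[OF op max.mono])
  then show "\<exists>B>0. \<forall>n. absK (c n) \<le> B" by blast
qed

lift_definition plus_hseries :: "'a hseries \<Rightarrow> 'a hseries \<Rightarrow> 'a hseries" is "\<lambda>a b n. a n + b n"
  unfolding hseries_iff by (rule hseries_add_aux[OF absK_add])

lift_definition minus_hseries :: "'a hseries \<Rightarrow> 'a hseries \<Rightarrow> 'a hseries" is "\<lambda>a b n. a n - b n"
  unfolding hseries_iff by (rule hseries_add_aux[OF absK_diff])

lift_definition uminus_hseries :: "'a hseries \<Rightarrow> 'a hseries" is "\<lambda>a n. - a n"
  unfolding hseries_iff by simp

lift_definition times_hseries :: "'a hseries \<Rightarrow> 'a hseries \<Rightarrow> 'a hseries" is
  "\<lambda>a b n. \<Sum>\<^sub>\<infinity>i. a i * b (n - i)"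
  unfolding hseries_iff
proof (intro conjI allI impI; elim conjE exE)
  fix a b :: "int \<Rightarrow> 'a" and e A B :: real
  assume a: "\<forall>e>0. \<exists>N. \<forall>n\<ge>N. absK (a n) < e" and A: "0 < A" "\<forall>n. absK (a n) \<le> A"
    and b: "\<forall>e>0. \<exists>N. \<forall>n\<ge>N. absK (b n) < e" and B: "0 < B" "\<forall>n. absK (b n) \<le> B"
    and e: "e > 0"
  obtain N where N: "\<And>n. n \<ge> N \<Longrightarrow> absK (a n) < e / (2 * B)"
    using a e B(1) by (metis divide_pos_pos mult_pos_pos zero_less_numeral)
  obtain M where M: "\<And>n. n \<ge> M \<Longrightarrow> absK (b n) < e / (2 * A)"
    using b e A(1) by (metis divide_pos_pos mult_pos_pos zero_less_numeral)
  have "absK (\<Sum>\<^sub>\<infinity>i. a i * b (n - i)) \<le> e / 2" if n: "n \<ge> N + M" for n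
  proof (rule absK_infsum_le)
    fix i :: int
    have AB: "absK (a i) \<le> A" "absK (b (n - i)) \<le> B" using A B by auto
    show "absK (a i * b (n - i)) \<le> e / 2"
    proof (cases "i \<ge> N")
      case True
      have "absK (a i) * absK (b (n - i)) \<le> e / (2 * B) * B"
        using N[OF True] AB B(1) e by (intro mult_mono) auto
      then show ?thesis using B(1) by (simp add: absK_mult)
    next
      case False
      then have "n - i \<ge> M" using n by simp
      then have "absK (a i) * absK (b (n - i)) \<le> A * (e / (2 * A))"
        using M[of "n - i"] AB A(1) e by (intro mult_mono) auto
      then show ?thesis using A(1) by (simp add: absK_mult)
    qed
  qed (use e in simp)
  then have "\<forall>n\<ge>N+M. absK (\<Sum>\<^sub>\<infinity>i. a i * b (n - i)) < e"
    using e by force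
  then show "\<exists>N. \<forall>n\<ge>N. absK (\<Sum>\<^sub>\<infinity>i. a i * b (n - i)) < e" by blast
next
  fix a b :: "int \<Rightarrow> 'a" and A B :: real
  assume A: "0 < A" "\<forall>n. absK (a n) \<le> A" and B: "0 < B" "\<forall>n. absK (b n) \<le> B"
  have "absK (\<Sum>\<^sub>\<infinity>i. a i * b (n - i)) \<le> A * B" for n
    using A B by (intro absK_infsum_le) (auto simp: absK_mult intro!: mult_mono)
  then show "\<exists>B>0. \<forall>n. absK (\<Sum>\<^sub>\<infinity>i. a i * b (n - i)) \<le> B"
    using A(1) B(1) by (intro exI[of _ "A * B"]) auto
qed

lemma conv_summable:
  fixes a b :: "'a hseries"
  shows "(\<lambda>i. hcoeff a i * hcoeff b (n - i)) summable_on S"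
proof (rule summable_on_vK)
  fix e :: real assume e: "e > 0"
  obtain A where A: "A > 0" "\<And>n. absK (hcoeff a n) \<le> A" using hcoeff_bounded by blast
  obtain B where B: "B > 0" "\<And>n. absK (hcoeff b n) \<le> B" using hcoeff_bounded by blast
  obtain N where N: "\<And>n. n \<ge> N \<Longrightarrow> absK (hcoeff a n) < e / B"
    using hcoeff_small[of "e / B" a] e B(1) by auto
  obtain M where M: "\<And>n. n \<ge> M \<Longrightarrow> absK (hcoeff b n) < e / A"
    using hcoeff_small[of "e / A" b] e A(1) by auto
  have "i < N \<and> n - i < M" if "absK (hcoeff a i * hcoeff b (n - i)) > e" for i
  proof (rule ccontr)
    assume "\<not> (i < N \<and> n - i < M)"
    then consider "i \<ge> N" | "n - i \<ge> M" by linarith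
    then have "absK (hcoeff a i) * absK (hcoeff b (n - i)) \<le> e"
    proof cases
      case 1
      have "absK (hcoeff a i) * absK (hcoeff b (n - i)) \<le> e / B * B"
        using N[OF 1] B e by (intro mult_mono) auto
      then show ?thesis using B(1) by simp
    next
      case 2
      have "absK (hcoeff a i) * absK (hcoeff b (n - i)) \<le> A * (e / A)"
        using M[OF 2] A e by (intro mult_mono) auto
      then show ?thesis using A(1) by simp
    qed
    with that show False by (simp add: absK_mult)
  qed
  then have "{i \<in> S. absK (hcoeff a i * hcoeff b (n - i)) > e} \<subseteq> {n - M..N}" by force
  then show "finite {i \<in> S. absK (hcoeff a i * hcoeff b (n - i)) > e}"
    by (rule finite_subset) simp
qed

lemma conv3_summable:
  fixes a b c :: "'a hseries"
  shows "(\<lambda>(k, i). hcoeff a i * hcoeff b (k - i) * hcoeff c (n - k)) summable_on UNIV \<times> UNIV"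
proof (rule summable_on_vK)
  fix e :: real assume e: "e > 0"
  let ?f = "\<lambda>(k, i). hcoeff a i * hcoeff b (k - i) * hcoeff c (n - k)"
  obtain A where A: "A > 0" "\<And>n. absK (hcoeff a n) \<le> A" using hcoeff_bounded by blast
  obtain B where B: "B > 0" "\<And>n. absK (hcoeff b n) \<le> B" using hcoeff_bounded by blast
  obtain C where C: "C > 0" "\<And>n. absK (hcoeff c n) \<le> C" using hcoeff_bounded by blast
  obtain N where N: "\<And>n. n \<ge> N \<Longrightarrow> absK (hcoeff a n) < e / (B * C)"
    using hcoeff_small[of "e / (B * C)" a] e B(1) C(1) by auto
  obtain M where M: "\<And>n. n \<ge> M \<Longrightarrow> absK (hcoeff b n) < e / (A * C)"
    using hcoeff_small[of "e / (A * C)" b] e A(1) C(1) by auto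
  obtain L where L: "\<And>n. n \<ge> L \<Longrightarrow> absK (hcoeff c n) < e / (A * B)"
    using hcoeff_small[of "e / (A * B)" c] e A(1) B(1) by auto
  have "i < N \<and> k - i < M \<and> n - k < L" if "absK (?f (k, i)) > e" for i k
  proof (rule ccontr)
    assume "\<not> (i < N \<and> k - i < M \<and> n - k < L)"
    then consider "i \<ge> N" | "k - i \<ge> M" | "n - k \<ge> L" by linarith
    then have "absK (hcoeff a i) * absK (hcoeff b (k - i)) * absK (hcoeff c (n - k)) \<le> e"
    proof cases
      case 1
      have "absK (hcoeff a i) * absK (hcoeff b (k - i)) * absK (hcoeff c (n - k)) \<le> e / (B * C) * B * C"
        using N[OF 1] B C e by (intro mult_mono) auto
      then show ?thesis using B(1) C(1) by simp
    next
      case 2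
      have "absK (hcoeff a i) * absK (hcoeff b (k - i)) * absK (hcoeff c (n - k)) \<le> A * (e / (A * C)) * C"
        using M[OF 2] A C e by (intro mult_mono) auto
      then show ?thesis using A(1) C(1) by simp
    next
      case 3
      have "absK (hcoeff a i) * absK (hcoeff b (k - i)) * absK (hcoeff c (n - k)) \<le> A * B * (e / (A * B))"
        using L[OF 3] A B e by (intro mult_mono) auto
      then show ?thesis using A(1) B(1) by simp
    qed
    with that show False by (simp add: absK_mult)
  qed
  then have "{p \<in> UNIV \<times> UNIV. absK (?f p) > e} \<subseteq> {n - L..N + M} \<times> {n - L - M..N}"
    by (auto; force)
  then show "finite {p \<in> UNIV \<times> UNIV. absK (?f p) > e}"
    by (rule finite_subset) simp
qed

lemma infsum_int_reindex: "(\<Sum>\<^sub>\<infinity>i::int. f (n - i)) = (\<Sum>\<^sub>\<infinity>i. f i)"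
  by (rule infsum_reindex_bij_witness[of UNIV "\<lambda>i. n - i" "\<lambda>i. n - i"]) auto

instance
proof
  fix a b c :: "'a hseries"
  show "a + b + c = a + (b + c)" "a + b = b + a" "0 + a = a" "- a + a = 0" "a - b = a + - b"
    by (transfer; simp add: algebra_simps fun_eq_iff)+
  show "(0::'a hseries) \<noteq> 1"
    by transfer (auto simp: fun_eq_iff)
  show "a * b = b * a"
  proof (rule hcoeff_inject_ext)
    fix n
    show "hcoeff (a * b) n = hcoeff (b * a) n"
      using infsum_int_reindex[of "\<lambda>i. hcoeff a i * hcoeff b (n - i)" n]
      by (simp add: times_hseries.rep_eq mult.commute)
  qed
  show "1 * a = a"
  proof (rule hcoeff_inject_ext)
    fix n
    have "hcoeff (1 * a) n = (\<Sum>\<^sub>\<infinity>i. (if i = 0 then 1 else 0) * hcoeff a (n - i))"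
      by (simp only: times_hseries.rep_eq one_hseries.rep_eq)
    also have "\<dots> = (\<Sum>\<^sub>\<infinity>i\<in>{0}. hcoeff a (n - i))"
      by (rule infsum_cong_neutral) auto
    finally show "hcoeff (1 * a) n = hcoeff a n" by simp
  qed
  show "(a + b) * c = a * c + b * c"
  proof (rule hcoeff_inject_ext)
    fix n
    show "hcoeff ((a + b) * c) n = hcoeff (a * c + b * c) n"
      by (simp add: times_hseries.rep_eq plus_hseries.rep_eq distrib_right infsum_add conv_summable)
  qed
  show "a * b * c = a * (b * c)"
  proof (rule hcoeff_inject_ext)
    fix n
    have S: "(\<lambda>(k, i). hcoeff a i * hcoeff b (k - i) * hcoeff c (n - k)) summable_on UNIV \<times> UNIV"
      by (rule conv3_summable)
    have "hcoeff (a * b * c) n = (\<Sum>\<^sub>\<infinity>k. (\<Sum>\<^sub>\<infinity>i. hcoeff a i * hcoeff b (k - i)) * hcoeff c (n - k))"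
      by (simp add: times_hseries.rep_eq)
    also have "\<dots> = (\<Sum>\<^sub>\<infinity>k. \<Sum>\<^sub>\<infinity>i. hcoeff a i * hcoeff b (k - i) * hcoeff c (n - k))"
      by (simp add: infsum_cmult_left conv_summable)
    also have "\<dots> = (\<Sum>\<^sub>\<infinity>i. \<Sum>\<^sub>\<infinity>k. hcoeff a i * hcoeff b (k - i) * hcoeff c (n - k))"
    proof (rule infsum_swap[OF uniformly_continuous_plus_vK S])
      fix k show "(\<lambda>i. hcoeff a i * hcoeff b (k - i) * hcoeff c (n - k)) summable_on UNIV"
        by (intro summable_on_cmult_left conv_summable)
    next
      fix i
      have "(\<lambda>k. hcoeff b (k - i) * hcoeff c (n - k)) summable_on UNIV"
        using summable_on_reindex[of "\<lambda>k. k - i" UNIV "\<lambda>j. hcoeff b j * hcoeff c (n - i - j)"]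
          conv_summable[of b c "n - i"]
        by (simp add: o_def inj_on_def surj_def algebra_simps)
      then show "(\<lambda>k. hcoeff a i * hcoeff b (k - i) * hcoeff c (n - k)) summable_on UNIV"
        unfolding mult.assoc by (rule summable_on_cmult_right)
    qed
    also have "\<dots> = (\<Sum>\<^sub>\<infinity>i. \<Sum>\<^sub>\<infinity>j. hcoeff a i * (hcoeff b j * hcoeff c (n - i - j)))"
    proof (rule infsum_cong)
      fix i
      show "(\<Sum>\<^sub>\<infinity>k. hcoeff a i * hcoeff b (k - i) * hcoeff c (n - k)) =
            (\<Sum>\<^sub>\<infinity>j. hcoeff a i * (hcoeff b j * hcoeff c (n - i - j)))"
        by (rule infsum_reindex_bij_witness[of UNIV "\<lambda>j. j + i" "\<lambda>k. k - i"])
          (auto simp: algebra_simps)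
    qed
    also have "\<dots> = (\<Sum>\<^sub>\<infinity>i. hcoeff a i * (\<Sum>\<^sub>\<infinity>j. hcoeff b j * hcoeff c (n - i - j)))"
      by (simp add: infsum_cmult_right conv_summable)
    also have "\<dots> = hcoeff (a * (b * c)) n"
      by (simp add: times_hseries.rep_eq)
    finally show "hcoeff (a * b * c) n = hcoeff (a * (b * c)) n" .
  qed
qed

end

text \<open>Formal power series in variables indexed by \<open>'i\<close>, as functions of the exponent.\<close>

typedef ('i, 'a) mps = "UNIV :: (('i \<Rightarrow> nat) \<Rightarrow> 'a) set"
  morphisms mcoeff Abs_mps by (rule UNIV_witness)

setup_lifting type_definition_mps

lemma mcoeff_Abs_mps [simp]: "mcoeff (Abs_mps f) = f"
  by (simp add: Abs_mps_inverse)

lemma mps_eqI: "(\<And>e. mcoeff f e = mcoeff g e) \<Longrightarrow> f = g"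
  by (metis ext mcoeff_inject)

lemma finite_exponents_le: "finite {d. d \<le> (e :: 'i::finite \<Rightarrow> nat)}"
proof -
  have "{d. d \<le> e} \<subseteq> PiE UNIV (\<lambda>i. {..e i})"
    by (auto simp: le_fun_def)
  then show ?thesis by (rule finite_subset) (simp add: finite_PiE)
qed

lemma diff_diff_exponents: "d \<le> e \<Longrightarrow> e - (e - d) = (d :: 'i \<Rightarrow> nat)"
  by (auto simp: le_fun_def fun_eq_iff)

instantiation mps :: (finite, comm_ring_1) comm_ring_1
begin

lift_definition zero_mps :: "('a, 'b) mps" is "\<lambda>_. 0" .
lift_definition one_mps :: "('a, 'b) mps" is "\<lambda>e. if e = (\<lambda>_. 0) then 1 else 0" .
lift_definition plus_mps :: "('a, 'b) mps \<Rightarrow> ('a, 'b) mps \<Rightarrow> ('a, 'b) mps" is "\<lambda>f g e. f e + g e" .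
lift_definition minus_mps :: "('a, 'b) mps \<Rightarrow> ('a, 'b) mps \<Rightarrow> ('a, 'b) mps" is "\<lambda>f g e. f e - g e" .
lift_definition uminus_mps :: "('a, 'b) mps \<Rightarrow> ('a, 'b) mps" is "\<lambda>f e. - f e" .
lift_definition times_mps :: "('a, 'b) mps \<Rightarrow> ('a, 'b) mps \<Rightarrow> ('a, 'b) mps" is
  "\<lambda>f g e. \<Sum>d | d \<le> e. f d * g (e - d)" .

instance
proof
  fix f g h :: "('a, 'b) mps"
  show "f + g + h = f + (g + h)" "f + g = g + f" "0 + f = f" "- f + f = 0" "f - g = f + - g"
    by (transfer; simp add: algebra_simps fun_eq_iff)+
  show "(0 :: ('a, 'b) mps) \<noteq> 1"
    by transfer (auto simp: fun_eq_iff)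
  show "f * g = g * f"
  proof (rule mps_eqI)
    fix e
    show "mcoeff (f * g) e = mcoeff (g * f) e"
      unfolding times_mps.rep_eq
      by (rule sum.reindex_bij_witness[of _ "\<lambda>d. e - d" "\<lambda>d. e - d"])
        (simp_all add: diff_diff_exponents mult.commute, simp_all add: le_fun_def)
  qed
  show "1 * f = f"
  proof (rule mps_eqI)
    fix e
    have "mcoeff (1 * f) e = (\<Sum>d | d \<le> e. (if d = (\<lambda>_. 0) then 1 else 0) * mcoeff f (e - d))"
      by (simp only: times_mps.rep_eq one_mps.rep_eq)
    also have "\<dots> = (\<Sum>d\<in>{\<lambda>_. 0}. mcoeff f (e - d))"
      by (rule sum.mono_neutral_cong_right[OF finite_exponents_le]) (auto simp: le_fun_def)
    also have "\<dots> = mcoeff f e"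
    proof -
      have "e - (\<lambda>_. 0) = e" by (simp add: fun_eq_iff)
      then show ?thesis by simp
    qed
    finally show "mcoeff (1 * f) e = mcoeff f e" .
  qed
  show "(f + g) * h = f * h + g * h"
    by (rule mps_eqI) (simp add: times_mps.rep_eq plus_mps.rep_eq distrib_right sum.distrib)
  show "f * g * h = f * (g * h)"
  proof (rule mps_eqI)
    fix e
    have "mcoeff (f * g * h) e =
        (\<Sum>k | k \<le> e. \<Sum>d | d \<le> k. mcoeff f d * mcoeff g (k - d) * mcoeff h (e - k))"
      by (simp add: times_mps.rep_eq sum_distrib_right)
    also have "\<dots> = (\<Sum>(k, d)\<in>Sigma {k. k \<le> e} (\<lambda>k. {d. d \<le> k}).
        mcoeff f d * mcoeff g (k - d) * mcoeff h (e - k))"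
      by (rule sum.Sigma) (auto simp: finite_exponents_le)
    also have "\<dots> = (\<Sum>(d, c)\<in>Sigma {d. d \<le> e} (\<lambda>d. {c. c \<le> e - d}).
        mcoeff f d * (mcoeff g c * mcoeff h (e - d - c)))"
    proof (rule sum.reindex_bij_witness[of _ "\<lambda>(d, c). (\<lambda>i. d i + c i, d)" "\<lambda>(k, d). (d, k - d)"], goal_cases)
      case (1 p) then show ?case by (auto simp: le_fun_def fun_eq_iff)
    next
      case (2 p) then show ?case by (auto simp: le_fun_def intro: order_trans intro!: diff_le_mono)
    next
      case (3 p) then show ?case by (auto simp: le_fun_def fun_eq_iff)
    next
      case (4 p)
      obtain d c where p: "p = (d, c)" "\<And>i. d i \<le> e i" "\<And>i. c i \<le> e i - d i"
        using 4 by (auto simp: le_fun_def)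
      have "d i + c i \<le> e i" for i using p(2,3)[of i] by linarith
      then show ?case by (simp add: p(1) le_fun_def)
    next
      case (5 p)
      obtain k d where p: "p = (k, d)" "k \<le> e" "d \<le> k" using 5 by auto
      have "e - d - (k - d) = e - k"
        using p by (auto simp: fun_eq_iff le_fun_def)
      then show ?case by (simp add: p mult.assoc)
    qed
    also have "\<dots> = (\<Sum>d | d \<le> e. \<Sum>c | c \<le> e - d. mcoeff f d * (mcoeff g c * mcoeff h (e - d - c)))"
      by (rule sum.Sigma[symmetric]) (auto simp: finite_exponents_le)
    also have "\<dots> = mcoeff (f * (g * h)) e"
      by (simp add: times_mps.rep_eq sum_distrib_left)
    finally show "mcoeff (f * g * h) e = mcoeff (f * (g * h)) e" .
  qed
qed

end

section \<open>The ring of all series and its subrings\<close>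

text \<open>
  All base rings are subrings of the one ring \<open>K{\<hbar>,\<hbar>\<^sup>-\<^sup>1}}[[Q,t]]\<close>. The type \<open>'q\<close> indexes
  \<open>Q\<^sup>1, \<dots>, Q\<^sup>r\<close>, so \<open>r = CARD('q)\<close>, and the type \<open>'s\<close> indexes \<open>t\<^sup>0, \<dots>, t\<^sup>s\<close>, so
  \<open>s + 1 = CARD('s)\<close>. An exponent \<open>e :: 'q + 's \<Rightarrow> nat\<close> has \<open>Q\<close>-part \<open>e \<circ> Inl\<close> and \<open>t\<close>-part
  \<open>e \<circ> Inr\<close>. The variables \<open>t\<close> of the type are some co-ordinates of \<open>B\<close>, used to present
  \<open>\<O>\<^sub>B\<close>; they are not assumed to be centred at any particular point.
\<close>

type_synonym ('q, 's, 'k) ser = "('q + 's, 'k hseries) mps"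

definition coeff :: "('q, 's, 'k::complete_valuation_domain) ser \<Rightarrow> ('q + 's \<Rightarrow> nat) \<Rightarrow> int \<Rightarrow> 'k" where
  "coeff f e n = hcoeff (mcoeff f e) n"

lift_definition hmonom :: "int \<Rightarrow> 'k::complete_valuation_domain hseries" is
  "\<lambda>n m. if m = n then 1 else 0"
proof -
  fix n :: int
  show "((\<lambda>m. vK (if m = n then 1 else 0 :: 'k)) \<longlongrightarrow> \<infinity>) at_top \<and>
      (INF m. vK (if m = n then 1 else 0 :: 'k)) > - \<infinity>"
    unfolding hseries_iff
    by (intro conjI allI impI exI[of _ "n + 1"] exI[of _ "1::real"]) auto
qed

definition hpow :: "int \<Rightarrow> ('q, 's, 'k::complete_valuation_domain) ser" where
  "hpow n = Abs_mps (\<lambda>e. if e = (\<lambda>_. 0) then hmonom n else 0)"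

abbreviation hbar :: "('q, 's, 'k::complete_valuation_domain) ser" where
  "hbar \<equiv> hpow 1"

definition mvar :: "'i \<Rightarrow> ('i, 'a::comm_ring_1) mps" where
  "mvar i = Abs_mps (\<lambda>e. if e = (\<lambda>j. if j = i then 1 else 0) then 1 else 0)"

definition mderiv :: "'i \<Rightarrow> ('i, 'a::comm_ring_1) mps \<Rightarrow> ('i, 'a) mps" where
  "mderiv i f = Abs_mps (\<lambda>e. of_nat (e i + 1) * mcoeff f (e(i := e i + 1)))"

abbreviation Qvar :: "'q \<Rightarrow> ('q, 's, 'k::complete_valuation_domain) ser" where
  "Qvar a \<equiv> mvar (Inl a)"

abbreviation tvar :: "'s \<Rightarrow> ('q, 's, 'k::complete_valuation_domain) ser" where
  "tvar i \<equiv> mvar (Inr i)"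

abbreviation dt :: "'s \<Rightarrow> ('q, 's, 'k::complete_valuation_domain) ser \<Rightarrow> ('q, 's, 'k) ser" where
  "dt i \<equiv> mderiv (Inr i)"

abbreviation QdQ :: "'q::finite \<Rightarrow> ('q, 's::finite, 'k::complete_valuation_domain) ser \<Rightarrow> ('q, 's, 'k) ser" where
  "QdQ a f \<equiv> Qvar a * mderiv (Inl a) f"

lift_definition hflip_coeff :: "'k::complete_valuation_domain hseries \<Rightarrow> 'k hseries" is
  "\<lambda>a n. if even n then a n else - a n"
proof -
  fix a :: "int \<Rightarrow> 'k"
  have *: "absK (if even n then a n else - a n) = absK (a n)" for n by simp
  assume "((\<lambda>n. vK (a n)) \<longlongrightarrow> \<infinity>) at_top \<and> (INF n. vK (a n)) > - \<infinity>"
  then show "((\<lambda>n. vK (if even n then a n else - a n)) \<longlongrightarrow> \<infinity>) at_top \<and>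
      (INF n. vK (if even n then a n else - a n)) > - \<infinity>"
    unfolding hseries_iff * .
qed

text \<open>The substitution \<open>\<hbar> \<mapsto> -\<hbar>\<close>.\<close>
definition hflip :: "('q, 's, 'k::complete_valuation_domain) ser \<Rightarrow> ('q, 's, 'k) ser" where
  "hflip f = Abs_mps (\<lambda>e. hflip_coeff (mcoeff f e))"

text \<open>The substitution \<open>Q = 0\<close>.\<close>
definition at_Q0 :: "('q, 's, 'k::complete_valuation_domain) ser \<Rightarrow> ('q, 's, 'k) ser" where
  "at_Q0 f = Abs_mps (\<lambda>e. if \<forall>a. e (Inl a) = 0 then mcoeff f e else 0)"

definition t_free :: "('q, 's, 'k::complete_valuation_domain) ser set" where
  "t_free = {f. \<forall>e. (\<exists>i. e (Inr i) \<noteq> 0) \<longrightarrow> mcoeff f e = 0}"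

definition Q_free :: "('q, 's, 'k::complete_valuation_domain) ser set" where
  "Q_free = {f. \<forall>e. (\<exists>a. e (Inl a) \<noteq> 0) \<longrightarrow> mcoeff f e = 0}"

text \<open>\<open>ringOB\<close> is \<open>\<O>\<^sub>B\<close>, \<open>ringOBh\<close> is \<open>\<O>\<^sub>B\<^sup>\<hbar>\<close>, \<open>ringO\<close> is \<open>\<O>\<close>, \<open>ringOh\<close> is \<open>\<O>\<^sup>\<hbar> = K{\<hbar>}[[Q]]\<close>, \<open>ringKh\<close> is \<open>K{\<hbar>}\<close>
  and \<open>ringK\<close> is \<open>K\<close>.\<close>

definition ringOB :: "('q, 's, 'k::complete_valuation_domain) ser set" where
  "ringOB = {f. \<forall>e n. n \<noteq> 0 \<longrightarrow> coeff f e n = 0}"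

definition ringOBh :: "('q, 's, 'k::complete_valuation_domain) ser set" where
  "ringOBh = {f. \<forall>e n. n < 0 \<longrightarrow> coeff f e n = 0}"

definition ringO :: "('q, 's, 'k::complete_valuation_domain) ser set" where
  "ringO = ringOB \<inter> t_free"

definition ringOh :: "('q, 's, 'k::complete_valuation_domain) ser set" where
  "ringOh = ringOBh \<inter> t_free"

definition ringKh :: "('q, 's, 'k::complete_valuation_domain) ser set" where
  "ringKh = ringOh \<inter> Q_free"

definition ringK :: "('q, 's, 'k::complete_valuation_domain) ser set" where
  "ringK = ringO \<inter> Q_free"

text \<open>The basic neighbourhoods \<open>U\<^sub>n\<close> of zero. On \<open>\<O>\<^sub>B\<close> and \<open>\<O>\<close> only the coefficient of \<open>\<hbar>\<^sup>0\<close> matters;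
  in general the Gauss valuation is used on \<open>K{\<hbar>,\<hbar>\<^sup>-\<^sup>1}}\<close>.\<close>
definition nbhd0 :: "nat \<Rightarrow> ('q::finite, 's::finite, 'k::complete_valuation_domain) ser set" where
  "nbhd0 n = {f. \<forall>e. (\<Sum>i\<in>UNIV. e i) \<le> n \<longrightarrow> (\<forall>k. ereal (real n) \<le> vK (coeff f e k))}"

text \<open>Unordered convergence of the family \<open>a\<close> to \<open>f\<close> in this topology.\<close>
definition ser_sums :: "('j \<Rightarrow> ('q::finite, 's::finite, 'k::complete_valuation_domain) ser) \<Rightarrow> ('q, 's, 'k) ser \<Rightarrow> bool" where
  "ser_sums a f \<longleftrightarrow> (\<forall>n. \<exists>F0. finite F0 \<and> (\<forall>F. finite F \<and> F0 \<subseteq> F \<longrightarrow> f - sum a F \<in> nbhd0 n))"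

section \<open>Co-ordinates and points of the base\<close>

definition mK :: "'k::complete_valuation_domain set" where
  "mK = (if \<forall>x::'k. 0 \<le> vK x then {x. 0 < vK x} else {0})"

definition tuple_power :: "('s \<Rightarrow> ('q, 's, 'k) ser) \<Rightarrow> ('s \<Rightarrow> nat) \<Rightarrow> ('q::finite, 's::finite, 'k::complete_valuation_domain) ser" where
  "tuple_power T m = (\<Prod>i\<in>UNIV. T i ^ m i)"

text \<open>The last two conjuncts say \<open>\<O>\<^sub>B = \<O>[[T]]\<close>: \<open>(a\<^sub>m)\<^sub>m \<mapsto> \<Sum>\<^sub>m a\<^sub>m T\<^sup>m\<close> is a bijection from the families in
  \<open>\<O>\<close> to \<open>\<O>\<^sub>B\<close>.\<close>
definition coord_system :: "('s \<Rightarrow> ('q::finite, 's::finite, 'k::complete_valuation_domain) ser) \<Rightarrow> bool" where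
  "coord_system T \<longleftrightarrow>
     (\<forall>i. T i \<in> ringOB \<and> coeff (T i) (\<lambda>_. 0) 0 \<in> mK) \<and>
     (\<forall>a. (\<forall>m. a m \<in> ringO) \<longrightarrow> (\<exists>f\<in>ringOB. ser_sums (\<lambda>m. a m * tuple_power T m) f)) \<and>
     (\<forall>f\<in>ringOB. \<exists>!a. (\<forall>m. a m \<in> ringO) \<and> ser_sums (\<lambda>m. a m * tuple_power T m) f)"

text \<open>\<open>\<O>\<close>-valued points: continuous \<open>\<O>\<close>-algebra homomorphisms \<open>\<O>\<^sub>B \<rightarrow> \<O>\<close> (values off \<open>\<O>\<^sub>B\<close> are
  irrelevant).\<close>
definition O_point :: "(('q::finite, 's::finite, 'k::complete_valuation_domain) ser \<Rightarrow> ('q, 's, 'k) ser) \<Rightarrow> bool" where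
  "O_point b \<longleftrightarrow>
     (\<forall>f\<in>ringOB. b f \<in> ringO) \<and>
     (\<forall>f\<in>ringOB. \<forall>g\<in>ringOB. b (f + g) = b f + b g \<and> b (f * g) = b f * b g) \<and>
     (\<forall>f\<in>ringO. b f = f) \<and>
     (\<forall>f\<in>ringOB. \<forall>n. \<exists>m. \<forall>g\<in>ringOB. g - f \<in> nbhd0 m \<longrightarrow> b g - b f \<in> nbhd0 n)"

definition centered :: "('s \<Rightarrow> ('q::finite, 's::finite, 'k::complete_valuation_domain) ser) \<Rightarrow>
    (('q, 's, 'k) ser \<Rightarrow> ('q, 's, 'k) ser) \<Rightarrow> bool" where
  "centered T b \<longleftrightarrow> coord_system T \<and> (\<forall>i. b (T i) = 0)"

text \<open>The coefficient, in \<open>K{\<hbar>,\<hbar>\<^sup>-\<^sup>1}}[[Q]]\<close>, of \<open>t\<^sup>m\<close>.\<close>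
definition t_coeff :: "('s \<Rightarrow> nat) \<Rightarrow> ('q, 's, 'k::complete_valuation_domain) ser \<Rightarrow> ('q, 's, 'k) ser" where
  "t_coeff m f = Abs_mps (\<lambda>e. if \<forall>i. e (Inr i) = 0 then mcoeff f (case_sum (\<lambda>a. e (Inl a)) m) else 0)"

text \<open>\<open>f(Q, t(b), \<hbar>)\<close>, the extension of the point \<open>b\<close> from \<open>\<O>\<^sub>B\<close> to \<open>K{\<hbar>,\<hbar>\<^sup>-\<^sup>1}}[[Q,t]]\<close>.\<close>
definition eval_at :: "(('q::finite, 's::finite, 'k::complete_valuation_domain) ser \<Rightarrow> ('q, 's, 'k) ser) \<Rightarrow>
    ('q, 's, 'k) ser \<Rightarrow> ('q, 's, 'k) ser" where
  "eval_at b f = (THE g. ser_sums (\<lambda>m. t_coeff m f * tuple_power (\<lambda>i. b (tvar i)) m) g)"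

text \<open>\<open>inv_jac T $ j $ i\<close> is \<open>\<partial>t\<^sup>j/\<partial>T\<^sup>i\<close>. The vector fields \<open>\<partial>/\<partial>T\<^sup>i\<close> and \<open>Q\<^sup>a\<partial>/\<partial>Q\<^sup>a\<close> of the
  co-ordinate system \<open>(Q, T)\<close> are \<open>dT T i\<close> and \<open>QdQ_in T a\<close>; the latter kills the \<open>T\<^sup>i\<close>, so it differs
  from \<open>QdQ a\<close>, which kills the \<open>t\<^sup>i\<close>.\<close>
definition inv_jac :: "('s \<Rightarrow> ('q, 's, 'k) ser) \<Rightarrow> (('q::finite, 's::finite, 'k::complete_valuation_domain) ser)^'s^'s" where
  "inv_jac T = matrix_inv (\<chi> i j. dt j (T i))"

definition dT :: "('s \<Rightarrow> ('q::finite, 's::finite, 'k::complete_valuation_domain) ser) \<Rightarrow> 's \<Rightarrow>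
    ('q, 's, 'k) ser \<Rightarrow> ('q, 's, 'k) ser" where
  "dT T i f = (\<Sum>j\<in>UNIV. inv_jac T $ j $ i * dt j f)"

definition QdQ_in :: "('s \<Rightarrow> ('q::finite, 's::finite, 'k::complete_valuation_domain) ser) \<Rightarrow> 'q \<Rightarrow>
    ('q, 's, 'k) ser \<Rightarrow> ('q, 's, 'k) ser" where
  "QdQ_in T a f = QdQ a f - (\<Sum>i\<in>UNIV. QdQ a (T i) * dT T i f)"

section \<open>Modules over the Heisenberg algebra\<close>

record (overloaded) ('q, 's, 'k, 'e) dmodule =
  smul :: "('q, 's, 'k) ser \<Rightarrow> 'e \<Rightarrow> 'e"
  Pop :: "'q \<Rightarrow> 'e \<Rightarrow> 'e"
  Wop :: "'s \<Rightarrow> 'e \<Rightarrow> 'e"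

text \<open>A module over the algebra generated over \<open>\<O>\<^sub>B\<^sup>\<hbar>\<close> by commuting \<open>P\<^sub>a\<close>, \<open>\<wp>\<^sub>i\<close> with
  \<open>[P\<^sub>a, g] = \<hbar>Q\<^sup>a\<partial>g/\<partial>Q\<^sup>a\<close>, \<open>[\<wp>\<^sub>i, g] = \<hbar>\<partial>g/\<partial>t\<^sup>i\<close>: an \<open>\<O>\<^sub>B\<^sup>\<hbar>\<close>-module with operators satisfying the same
  relations. Scalars outside \<open>ringOBh\<close> are irrelevant.\<close>
definition DB_module :: "('q::finite, 's::finite, 'k::complete_valuation_domain, 'e::ab_group_add) dmodule \<Rightarrow> bool" where
  "DB_module E \<longleftrightarrow>
     (\<forall>x. smul E 1 x = x) \<and>
     (\<forall>f\<in>ringOBh. \<forall>x y. smul E f (x + y) = smul E f x + smul E f y) \<and>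
     (\<forall>f\<in>ringOBh. \<forall>g\<in>ringOBh. \<forall>x. smul E (f + g) x = smul E f x + smul E g x \<and>
                              smul E (f * g) x = smul E f (smul E g x)) \<and>
     (\<forall>a x y. Pop E a (x + y) = Pop E a x + Pop E a y) \<and>
     (\<forall>i x y. Wop E i (x + y) = Wop E i x + Wop E i y) \<and>
     (\<forall>a. \<forall>f\<in>ringOBh. \<forall>x. Pop E a (smul E f x) = smul E f (Pop E a x) + smul E (hbar * QdQ a f) x) \<and>
     (\<forall>i. \<forall>f\<in>ringOBh. \<forall>x. Wop E i (smul E f x) = smul E f (Wop E i x) + smul E (hbar * dt i f) x) \<and>
     (\<forall>a b x. Pop E a (Pop E b x) = Pop E b (Pop E a x)) \<and>
     (\<forall>i j x. Wop E i (Wop E j x) = Wop E j (Wop E i x)) \<and>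
     (\<forall>a i x. Pop E a (Wop E i x) = Wop E i (Pop E a x))"

text \<open>The generators of \<open>\<D>\<^sub>B\<close> belonging to the co-ordinates \<open>T\<close>: they commute with one another, and
  \<open>[opW E T i, g] = \<hbar>\<partial>g/\<partial>T\<^sup>i\<close>, \<open>[opP E T a, g] = \<hbar>Q\<^sup>a\<partial>g/\<partial>Q\<^sup>a\<close> in the co-ordinates \<open>(Q, T)\<close>.\<close>
definition opW :: "('q::finite, 's::finite, 'k::complete_valuation_domain, 'e::ab_group_add) dmodule \<Rightarrow>
    ('s \<Rightarrow> ('q, 's, 'k) ser) \<Rightarrow> 's \<Rightarrow> 'e \<Rightarrow> 'e" where
  "opW E T i x = (\<Sum>j\<in>UNIV. smul E (inv_jac T $ j $ i) (Wop E j x))"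

definition opP :: "('q::finite, 's::finite, 'k::complete_valuation_domain, 'e::ab_group_add) dmodule \<Rightarrow>
    ('s \<Rightarrow> ('q, 's, 'k) ser) \<Rightarrow> 'q \<Rightarrow> 'e \<Rightarrow> 'e" where
  "opP E T a x = Pop E a x - (\<Sum>i\<in>UNIV. smul E (QdQ a (T i)) (opW E T i x))"

section \<open>Fibers\<close>

text \<open>For \<open>T\<close> centered at \<open>b\<close>, the fiber \<open>E\<^sup>\<hbar>\<^bsub>b,0\<^esub>\<close> is \<open>E\<close> modulo \<open>sub_h E T = \<Sum>\<^sub>i T\<^sup>i E + \<Sum>\<^sub>a Q\<^sup>a E\<close>, and
  \<open>E\<^bsub>b,0\<^esub>\<close> is \<open>E\<close> modulo \<open>sub_0 E T = sub_h E T + \<hbar> E\<close>. Both are sets of equivalence classes.\<close>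
definition sub_h :: "('q::finite, 's::finite, 'k::complete_valuation_domain, 'e::ab_group_add) dmodule \<Rightarrow>
    ('s \<Rightarrow> ('q, 's, 'k) ser) \<Rightarrow> 'e set" where
  "sub_h E T = {(\<Sum>i\<in>UNIV. smul E (T i) (x i)) + (\<Sum>a\<in>UNIV. smul E (Qvar a) (y a)) | x y. True}"

definition sub_0 :: "('q::finite, 's::finite, 'k::complete_valuation_domain, 'e::ab_group_add) dmodule \<Rightarrow>
    ('s \<Rightarrow> ('q, 's, 'k) ser) \<Rightarrow> 'e set" where
  "sub_0 E T = {x + smul E hbar z | x z. x \<in> sub_h E T}"

definition cong_mod :: "'e::ab_group_add set \<Rightarrow> ('e \<times> 'e) set" where
  "cong_mod N = {(x, y). x - y \<in> N}"

definition qspace :: "'e::ab_group_add set \<Rightarrow> 'e set set" where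
  "qspace N = UNIV // cong_mod N"

definition qadd :: "'e::ab_group_add set \<Rightarrow> 'e set \<Rightarrow> 'e set \<Rightarrow> 'e set" where
  "qadd N X Y = (\<Union>x\<in>X. \<Union>y\<in>Y. cong_mod N `` {x + y})"

text \<open>The map into \<open>E/N\<close> induced by \<open>f\<close> on a quotient of \<open>E\<close>.\<close>
definition qmap :: "'e::ab_group_add set \<Rightarrow> ('e \<Rightarrow> 'e) \<Rightarrow> 'e set \<Rightarrow> 'e set" where
  "qmap N f X = (\<Union>x\<in>X. cong_mod N `` {f x})"

definition qcomb :: "('q::finite, 's::finite, 'k::complete_valuation_domain, 'e::ab_group_add) dmodule \<Rightarrow>
    'e set \<Rightarrow> ('s \<Rightarrow> ('q, 's, 'k) ser) \<Rightarrow> ('s \<Rightarrow> 'e set) \<Rightarrow> 'e set" where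
  "qcomb E N c \<beta> = (\<Union>x\<in>{x. \<forall>i. x i \<in> \<beta> i}. cong_mod N `` {\<Sum>i\<in>UNIV. smul E (c i) (x i)})"

text \<open>\<open>\<beta>\<close> is a basis of \<open>E/N\<close> over the ring of scalars \<open>S\<close>. Bases of the fibers can be indexed by
  \<open>'s\<close>: the rank is \<open>s + 1\<close> by the last conjunct of \<open>big_AQDM\<close> below.\<close>
definition qbasis :: "('q::finite, 's::finite, 'k::complete_valuation_domain, 'e::ab_group_add) dmodule \<Rightarrow>
    'e set \<Rightarrow> ('q, 's, 'k) ser set \<Rightarrow> ('s \<Rightarrow> 'e set) \<Rightarrow> bool" where
  "qbasis E N S \<beta> \<longleftrightarrow> (\<forall>i. \<beta> i \<in> qspace N) \<and>
     (\<forall>X\<in>qspace N. \<exists>!c. (\<forall>i. c i \<in> S) \<and> X = qcomb E N c \<beta>)"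

text \<open>The matrix, in the \<open>K\<close>-basis \<open>\<beta>\<close> of \<open>E\<^bsub>b,0\<^esub>\<close>, of an operator on \<open>E\<^bsub>b,0\<^esub>\<close>.\<close>
definition fiber_matrix :: "('q::finite, 's::finite, 'k::complete_valuation_domain, 'e::ab_group_add) dmodule \<Rightarrow>
    ('s \<Rightarrow> ('q, 's, 'k) ser) \<Rightarrow> ('s \<Rightarrow> 'e set) \<Rightarrow> ('e set \<Rightarrow> 'e set) \<Rightarrow> (('q, 's, 'k) ser)^'s^'s" where
  "fiber_matrix E T \<beta> f =
     (\<chi> i j. (THE c. (\<forall>i. c i \<in> ringK) \<and> f (\<beta> j) = qcomb E (sub_0 E T) c \<beta>) i)"

definition fiber_basis :: "('q::finite, 's::finite, 'k::complete_valuation_domain, 'e::ab_group_add) dmodule \<Rightarrow>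
    ('s \<Rightarrow> ('q, 's, 'k) ser) \<Rightarrow> ('s \<Rightarrow> 'e set) \<Rightarrow> bool" where
  "fiber_basis E T \<beta> \<longleftrightarrow> qbasis E (sub_0 E T) ringK \<beta>"

text \<open>\<open>p\<^sub>a\<close> and \<open>\<wp>\<^sub>i\<close> on \<open>E\<^bsub>b,0\<^esub>\<close>.\<close>
definition p_fib :: "('q::finite, 's::finite, 'k::complete_valuation_domain, 'e::ab_group_add) dmodule \<Rightarrow>
    ('s \<Rightarrow> ('q, 's, 'k) ser) \<Rightarrow> 'q \<Rightarrow> 'e set \<Rightarrow> 'e set" where
  "p_fib E T a = qmap (sub_0 E T) (opP E T a)"

definition w_fib :: "('q::finite, 's::finite, 'k::complete_valuation_domain, 'e::ab_group_add) dmodule \<Rightarrow>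
    ('s \<Rightarrow> ('q, 's, 'k) ser) \<Rightarrow> 's \<Rightarrow> 'e set \<Rightarrow> 'e set" where
  "w_fib E T i = qmap (sub_0 E T) (opW E T i)"

text \<open>\<open>\<Phi>\<^sub>0 : E\<^bsub>b,0\<^esub> \<rightarrow> E\<^sup>\<hbar>\<^bsub>b,0\<^esub>\<close> is a \<open>K\<close>-linear section of the projection inducing an isomorphism
  \<open>E\<^bsub>b,0\<^esub> \<otimes>\<^sub>K K{\<hbar>} \<cong> E\<^sup>\<hbar>\<^bsub>b,0\<^esub>\<close> of \<open>K{\<hbar>}[p\<^sub>1, \<dots>, p\<^sub>r]\<close>-modules. As \<open>E\<^bsub>b,0\<^esub>\<close> is free of finite rank, bijectivity
  means that \<open>\<Phi>\<^sub>0\<close> takes a \<open>K\<close>-basis to a \<open>K{\<hbar>}\<close>-basis.\<close>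
definition splitting_0 :: "('q::finite, 's::finite, 'k::complete_valuation_domain, 'e::ab_group_add) dmodule \<Rightarrow>
    ('s \<Rightarrow> ('q, 's, 'k) ser) \<Rightarrow> ('e set \<Rightarrow> 'e set) \<Rightarrow> bool" where
  "splitting_0 E T \<Phi>0 \<longleftrightarrow>
     (\<forall>X\<in>qspace (sub_0 E T). \<Phi>0 X \<in> qspace (sub_h E T) \<and> qmap (sub_0 E T) (\<lambda>x. x) (\<Phi>0 X) = X) \<and>
     (\<forall>X\<in>qspace (sub_0 E T). \<forall>Y\<in>qspace (sub_0 E T).
        \<Phi>0 (qadd (sub_0 E T) X Y) = qadd (sub_h E T) (\<Phi>0 X) (\<Phi>0 Y)) \<and>
     (\<forall>c\<in>ringK. \<forall>X\<in>qspace (sub_0 E T).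
        \<Phi>0 (qmap (sub_0 E T) (smul E c) X) = qmap (sub_h E T) (smul E c) (\<Phi>0 X)) \<and>
     (\<forall>a. \<forall>X\<in>qspace (sub_0 E T). \<Phi>0 (p_fib E T a X) = qmap (sub_h E T) (opP E T a) (\<Phi>0 X)) \<and>
     (\<exists>\<beta>. fiber_basis E T \<beta> \<and> qbasis E (sub_h E T) ringKh (\<Phi>0 \<circ> \<beta>))"

section \<open>Big abstract quantum D-modules, frames, fundamental solutions and cones\<close>

definition big_AQDM :: "('q::finite, 's::finite, 'k::complete_valuation_domain, 'e::ab_group_add) dmodule \<Rightarrow> bool" where
  "big_AQDM E \<longleftrightarrow> DB_module E \<and>
     (\<exists>(n::nat) g. \<forall>x. \<exists>!c. (\<forall>j<n. c j \<in> ringOBh) \<and> (\<forall>j\<ge>n. c j = 0) \<and> x = (\<Sum>j<n. smul E (c j) (g j))) \<and>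
     (\<exists>b T. O_point b \<and> centered T b \<and>
        (\<exists>\<Phi>0. splitting_0 E T \<Phi>0) \<and>
        (\<exists>\<beta>. fiber_basis E T \<beta> \<and>
          (\<exists>C::real. \<forall>a n i j. ereal C \<le> vK (coeff (fiber_matrix E T \<beta> (p_fib E T a ^^ n) $ i $ j) (\<lambda>_. 0) 0))) \<and>
        (\<exists>e0\<in>qspace (sub_0 E T). fiber_basis E T (\<lambda>i. w_fib E T i e0)))"

definition module_basis :: "('q::finite, 's::finite, 'k::complete_valuation_domain, 'e::ab_group_add) dmodule \<Rightarrow>
    ('s \<Rightarrow> 'e) \<Rightarrow> bool" where
  "module_basis E g \<longleftrightarrow> (\<forall>x. \<exists>!c. (\<forall>i. c i \<in> ringOBh) \<and> x = (\<Sum>i\<in>UNIV. smul E (c i) (g i)))"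

text \<open>The matrix whose \<open>j\<close>-th column has the \<open>\<O>\<^sub>B\<^sup>\<hbar>\<close>-co-ordinates of \<open>y j\<close> in the basis \<open>g\<close> of \<open>E\<close>.\<close>
definition module_matrix :: "('q::finite, 's::finite, 'k::complete_valuation_domain, 'e::ab_group_add) dmodule \<Rightarrow>
    ('s \<Rightarrow> 'e) \<Rightarrow> ('s \<Rightarrow> 'e) \<Rightarrow> (('q, 's, 'k) ser)^'s^'s" where
  "module_matrix E g y = (\<chi> i j. (THE c. (\<forall>i. c i \<in> ringOBh) \<and> y j = (\<Sum>i\<in>UNIV. smul E (c i) (g i))) i)"

text \<open>The last conjunct but one says that the induced \<open>E\<^bsub>b,0\<^esub> \<otimes>\<^sub>K \<O>\<^sub>B\<^sup>\<hbar> \<rightarrow> E\<close> is bijective.\<close>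
definition frame :: "('q::finite, 's::finite, 'k::complete_valuation_domain, 'e::ab_group_add) dmodule \<Rightarrow>
    ('s \<Rightarrow> ('q, 's, 'k) ser) \<Rightarrow> ('e set \<Rightarrow> 'e) \<Rightarrow> bool" where
  "frame E T \<Phi> \<longleftrightarrow>
     (\<forall>X\<in>qspace (sub_0 E T). \<Phi> X \<in> X) \<and>
     (\<forall>X\<in>qspace (sub_0 E T). \<forall>Y\<in>qspace (sub_0 E T). \<Phi> (qadd (sub_0 E T) X Y) = \<Phi> X + \<Phi> Y) \<and>
     (\<forall>c\<in>ringK. \<forall>X\<in>qspace (sub_0 E T). \<Phi> (qmap (sub_0 E T) (smul E c) X) = smul E c (\<Phi> X)) \<and>
     (\<exists>\<beta>. fiber_basis E T \<beta> \<and> module_basis E (\<Phi> \<circ> \<beta>)) \<and>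
     splitting_0 E T (\<lambda>X. cong_mod (sub_h E T) `` {\<Phi> X})"

text \<open>
  A \<open>K\<close>-basis \<open>\<beta>\<close> of \<open>E\<^bsub>b,0\<^esub>\<close> identifies \<open>E\<^bsub>b,0\<^esub> \<otimes> R\<close> with \<open>R\<close>-vectors and \<open>End(E\<^bsub>b,0\<^esub>) \<otimes> R\<close> with
  \<open>R\<close>-matrices, for each of the rings \<open>R\<close> above. Since \<open>\<hbar>Q\<^sup>a\<partial>/\<partial>Q\<^sup>a\<close> and \<open>\<hbar>\<partial>/\<partial>T\<^sup>i\<close> kill constant vectors,
  the columns of the connection operators are the images of the \<open>\<Phi>(\<beta>\<^sub>j)\<close>.
\<close>
definition conn_A :: "('q::finite, 's::finite, 'k::complete_valuation_domain, 'e::ab_group_add) dmodule \<Rightarrow>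
    ('s \<Rightarrow> ('q, 's, 'k) ser) \<Rightarrow> ('e set \<Rightarrow> 'e) \<Rightarrow> ('s \<Rightarrow> 'e set) \<Rightarrow> 'q \<Rightarrow> (('q, 's, 'k) ser)^'s^'s" where
  "conn_A E T \<Phi> \<beta> a = module_matrix E (\<Phi> \<circ> \<beta>) (\<lambda>j. opP E T a (\<Phi> (\<beta> j)))"

definition conn_Omega :: "('q::finite, 's::finite, 'k::complete_valuation_domain, 'e::ab_group_add) dmodule \<Rightarrow>
    ('s \<Rightarrow> ('q, 's, 'k) ser) \<Rightarrow> ('e set \<Rightarrow> 'e) \<Rightarrow> ('s \<Rightarrow> 'e set) \<Rightarrow> 's \<Rightarrow> (('q, 's, 'k) ser)^'s^'s" where
  "conn_Omega E T \<Phi> \<beta> i = module_matrix E (\<Phi> \<circ> \<beta>) (\<lambda>j. opW E T i (\<Phi> (\<beta> j)))"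

definition fundamental_solution :: "('q::finite, 's::finite, 'k::complete_valuation_domain, 'e::ab_group_add) dmodule \<Rightarrow>
    (('q, 's, 'k) ser \<Rightarrow> ('q, 's, 'k) ser) \<Rightarrow> ('s \<Rightarrow> ('q, 's, 'k) ser) \<Rightarrow> ('e set \<Rightarrow> 'e) \<Rightarrow> ('s \<Rightarrow> 'e set) \<Rightarrow>
    (('q, 's, 'k) ser)^'s^'s \<Rightarrow> bool" where
  "fundamental_solution E b T \<Phi> \<beta> L \<longleftrightarrow>
     (\<forall>i. map_matrix (\<lambda>f. hbar * dT T i f) L + conn_Omega E T \<Phi> \<beta> i ** L = 0) \<and>
     (\<forall>a. map_matrix (\<lambda>f. hbar * QdQ_in T a f) L + conn_A E T \<Phi> \<beta> a ** L
            - L ** fiber_matrix E T \<beta> (p_fib E T a) = 0) \<and>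
     map_matrix (\<lambda>f. at_Q0 (eval_at b f)) L = mat 1"

text \<open>The cone, as a set of vectors over \<open>K{\<hbar>,\<hbar>\<^sup>-\<^sup>1}}[[Q]]\<close>.

  Sign pitfall: if the connection operators at \<open>Q = 0\<close> are \<open>p\<^sub>a\<close> and \<open>\<wp>\<^sub>i\<close>, then
  \<open>L(0,T,\<hbar>) = exp(-(1/\<hbar>) \<Sum>\<^sub>i T\<^sup>i \<wp>\<^sub>i)\<close>. Recentering at the point with \<open>T\<^sup>i|\<^sub>Q\<^sub>=\<^sub>0 = c\<^sup>i\<close> multiplies \<open>L\<close> on the
  right by \<open>exp((1/\<hbar>) \<Sum>\<^sub>i c\<^sup>i \<wp>\<^sub>i)\<close>; as the cone involves \<open>L(Q,T,-\<hbar>)\<^sup>-\<^sup>1\<close>, it is multiplied on the left by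
  \<open>exp((1/\<hbar>) \<Sum>\<^sub>i c\<^sup>i \<wp>\<^sub>i)\<close> with a plus sign.\<close>
definition quantum_cone :: "(('q::finite, 's::finite, 'k::complete_valuation_domain) ser)^'s^'s \<Rightarrow> ((('q, 's, 'k) ser)^'s) set" where
  "quantum_cone L = (\<Union>b\<in>Collect O_point.
     (\<lambda>h. hbar *s (matrix_inv (map_matrix (\<lambda>f. hflip (eval_at b f)) L) *v h)) ` {h. \<forall>i. h $ i \<in> ringOh})"

definition mat_exp :: "(('q::finite, 's::finite, 'k::complete_valuation_domain) ser)^'s^'s \<Rightarrow> (('q, 's, 'k) ser)^'s^'s" where
  "mat_exp X = (THE Y. \<forall>i j. ser_sums
     (\<lambda>n. (THE u. of_nat (fact n) * u = 1) * (((**) X ^^ n) (mat 1)) $ i $ j) (Y $ i $ j))"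

end

theory Submission
  imports Defs
begin

text \<open>
  In the variables \<open>t\<close> the differential equations for a fundamental solution do not involve the base point, so
  \<open>L\<close> and \<open>Z = G L'\<close> satisfy the same equations, up to the operators \<open>p\<^sub>a\<close> on the two fibers, which are
  intertwined by \<open>G\<^sub>0\<close>. Flatness makes the \<open>\<wp>\<^sub>i\<close> commute, and \<open>L\<close> at \<open>Q = 0\<close> is
  \<open>exp(-(1/\<hbar>) \<Sum>\<^sub>i T\<^sup>i \<wp>\<^sub>i)\<close>. The quotient \<open>N = L\<^sup>-\<^sup>1 Z\<close> is independent of \<open>t\<close> and satisfies
  \<open>\<hbar> Q\<^sup>a \<partial>N/\<partial>Q\<^sup>a = N p'\<^sub>a - p\<^sub>a N\<close>; as the powers of \<open>p\<^sub>a\<close> are bounded, this forces \<open>N\<close> to be constant in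
  \<open>Q\<close>. Its value is found at \<open>b'\<close>, \<open>Q = 0\<close>, whence \<open>L' = G\<^sup>-\<^sup>1 L exp((1/\<hbar>) \<Sum>\<^sub>i c\<^sup>i \<wp>\<^sub>i) G\<^sub>0\<close>. In the
  cone, \<open>G\<close> drops out because it preserves \<open>K{\<hbar>}[[Q]]\<^sup>s\<close> at every point.
\<close>

section \<open>Coefficients and subrings\<close>

text \<open>Two features of \<open>K{\<hbar>,\<hbar>\<^sup>-\<^sup>1}}\<close> shape the proof. A
  series may contain infinitely many negative powers of \<hbar>, and the \<open>p\<^sub>a\<close>
  need not be nilpotent, so the equation for a Q-coefficient of N cannot be attacked from a lowest
  power of \<hbar>. It is pushed upwards instead, towards coefficients that tend to zero; this
  succeeds because the absolute value is ultrametric, so that the number of terms produced on the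
  way does not matter. Moreover 1/\<hbar> times a co-ordinate is not small in any obvious sense.
  Exponentials converge because the constant terms of co-ordinates lie in \<open>mK\<close>, and for
  this nilpotence has to be measured against ideals, which absorb arbitrary factors such as
  1/\<hbar>. A point is given only on \<open>ringOB\<close>, whereas fundamental solutions live in a
  larger ring. It is therefore extended to a substitution for t, which is possible because
  continuity alone forces the values of t at the point to be topologically nilpotent.\<close>

lemma hcoeff_simps [simp]:
  "hcoeff 0 k = 0" "hcoeff 1 k = (if k = 0 then 1 else 0)" "hcoeff (a + b) k = hcoeff a k + hcoeff b k"
  "hcoeff (a - b) k = hcoeff a k - hcoeff b k" "hcoeff (- a) k = - hcoeff a k"
  by (simp_all add: zero_hseries.rep_eq one_hseries.rep_eq plus_hseries.rep_eq minus_hseries.rep_eq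
      uminus_hseries.rep_eq)

lemma mcoeff_simps [simp]:
  "mcoeff 0 e = 0" "mcoeff (f + g) e = mcoeff f e + mcoeff g e" "mcoeff (f - g) e = mcoeff f e - mcoeff g e"
  "mcoeff (- f) e = - mcoeff f e"
  by (simp_all add: zero_mps.rep_eq plus_mps.rep_eq minus_mps.rep_eq uminus_mps.rep_eq)

lemma mcoeff_1: "mcoeff 1 e = (if e = (\<lambda>_. 0) then 1 else 0)"
  by (simp add: one_mps.rep_eq)

lemma mcoeff_sum: "mcoeff (sum f A) e = (\<Sum>i\<in>A. mcoeff (f i) e)"
  by (induction A rule: infinite_finite_induct) auto

lemma hcoeff_sum: "hcoeff (sum f A) k = (\<Sum>i\<in>A. hcoeff (f i) k)"
  by (induction A rule: infinite_finite_induct) auto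

lemma coeff_simps [simp]:
  "coeff 0 e k = 0" "coeff (f + g) e k = coeff f e k + coeff g e k" "coeff (f - g) e k = coeff f e k - coeff g e k"
  "coeff (- f) e k = - coeff f e k"
  by (simp_all add: coeff_def)

lemma coeff_sum: "coeff (sum f A) e k = (\<Sum>i\<in>A. coeff (f i) e k)"
  by (simp add: coeff_def mcoeff_sum hcoeff_sum)

lemma coeff_eqI: "(\<And>e k. coeff f e k = coeff g e k) \<Longrightarrow> f = g"
  by (auto simp: coeff_def intro!: mps_eqI hcoeff_inject_ext)

section \<open>Constants, powers of \<hbar> and scalars from \<open>K\<close> inside the big
  ring\<close>

definition mconst :: "'a \<Rightarrow> ('i, 'a::comm_ring_1) mps" where
  "mconst c = Abs_mps (\<lambda>e. if e = (\<lambda>_. 0) then c else 0)"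

lemma mcoeff_mconst: "mcoeff (mconst c) e = (if e = (\<lambda>_. 0) then c else 0)"
  by (simp add: mconst_def)

lemma mcoeff_mconst_mult [simp]:
  "mcoeff (mconst c * f) e = c * mcoeff (f :: ('i::finite, 'a::comm_ring_1) mps) e"
proof -
  have "mcoeff (mconst c * f) e = (\<Sum>d | d \<le> e. (if d = (\<lambda>_. 0) then c else 0) * mcoeff f (e - d))"
    by (simp add: times_mps.rep_eq mcoeff_mconst)
  also have "\<dots> = (\<Sum>d\<in>{\<lambda>_. 0}. c * mcoeff f (e - d))"
    by (rule sum.mono_neutral_cong_right[OF finite_exponents_le]) (auto simp: le_fun_def)
  also have "\<dots> = c * mcoeff f e"
    by (simp add: fun_diff_def)
  finally show ?thesis .
qed

lemma mconst_simps:
  fixes c :: "'a::comm_ring_1"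
  shows "mconst (c + d) = mconst c + mconst d" "(mconst (c * d) :: ('i::finite, 'a) mps) = mconst c * mconst d"
    "(mconst 1 :: ('i::finite, 'a) mps) = 1" "mconst 0 = 0"
  by (rule mps_eqI; simp add: mcoeff_mconst mcoeff_1)+

lift_definition hconst :: "'k::complete_valuation_domain \<Rightarrow> 'k hseries" is "\<lambda>c n. if n = 0 then c else 0"
  subgoal for c
    unfolding hseries_iff
    by (intro conjI allI impI exI[of _ "1::int"] exI[of _ "max 1 (absK c)"]) auto
  done

lemma hcoeff_hconst: "hcoeff (hconst c) k = (if k = 0 then c else 0)"
  by (simp add: hconst.rep_eq)

lemma hcoeff_hconst_mult [simp]: "hcoeff (hconst c * a) k = c * hcoeff a k"
proof -
  have "hcoeff (hconst c * a) k = (\<Sum>\<^sub>\<infinity>i. (if i = 0 then c else 0) * hcoeff a (k - i))"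
    by (simp only: times_hseries.rep_eq hconst.rep_eq)
  also have "\<dots> = (\<Sum>\<^sub>\<infinity>i\<in>{0}. c * hcoeff a (k - i))"
    by (rule infsum_cong_neutral) auto
  finally show ?thesis by simp
qed

lemma hconst_simps:
  "hconst (c + d) = hconst c + hconst d" "hconst (c * d) = hconst c * hconst d" "hconst 1 = 1" "hconst 0 = 0"
  by (rule hcoeff_inject_ext; simp add: hcoeff_hconst)+

lemma hcoeff_hmonom: "hcoeff (hmonom n) k = (if k = n then 1 else 0)"
  by (simp add: hmonom.rep_eq)

lemma hcoeff_hmonom_mult [simp]: "hcoeff (hmonom n * a) k = hcoeff a (k - n)"
proof -
  have "hcoeff (hmonom n * a) k = (\<Sum>\<^sub>\<infinity>i. (if i = n then 1 else 0) * hcoeff a (k - i))"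
    by (simp only: times_hseries.rep_eq hmonom.rep_eq)
  also have "\<dots> = (\<Sum>\<^sub>\<infinity>i\<in>{n}. hcoeff a (k - i))"
    by (rule infsum_cong_neutral) auto
  finally show ?thesis by simp
qed

lemma hmonom_mult: "hmonom m * hmonom n = hmonom (m + n)"
  by (rule hcoeff_inject_ext) (auto simp: hcoeff_hmonom)

lemma hpow_mconst: "hpow n = mconst (hmonom n)"
  by (simp add: hpow_def mconst_def)

lemma hpow_mult: "(hpow m :: ('q::finite, 's::finite, 'k::complete_valuation_domain) ser) * hpow n = hpow (m + n)"
  by (simp add: hpow_mconst mconst_simps(2)[symmetric] hmonom_mult)

lemma hpow_0: "(hpow 0 :: ('q::finite, 's::finite, 'k::complete_valuation_domain) ser) = 1"
proof -
  have "hmonom 0 = (1 :: 'k hseries)"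
    by (rule hcoeff_inject_ext) (simp add: hcoeff_hmonom)
  then show ?thesis by (simp add: hpow_mconst mconst_simps)
qed

lemma hpow_inverse: "hpow 1 * hpow (-1) = (1 :: ('q::finite, 's::finite, 'k::complete_valuation_domain) ser)"
  "hpow (-1) * hpow 1 = (1 :: ('q::finite, 's::finite, 'k::complete_valuation_domain) ser)"
  by (simp_all add: hpow_mult hpow_0)

lemma coeff_hpow_mult [simp]:
  "coeff (hpow n * f) e k = coeff (f :: ('q::finite, 's::finite, 'k::complete_valuation_domain) ser) e (k - n)"
  by (simp add: coeff_def hpow_mconst)

lemma hbar_cancel: "hbar * f = hbar * g \<Longrightarrow> f = (g :: ('q::finite, 's::finite, 'k::complete_valuation_domain) ser)"
proof -
  assume "hbar * f = hbar * g"
  then have "hpow (-1) * (hbar * f) = hpow (-1) * (hbar * g)" by simp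
  then show "f = g" by (simp only: mult.assoc[symmetric] hpow_inverse mult_1)
qed

definition sconst :: "'k::complete_valuation_domain \<Rightarrow> ('q, 's, 'k) ser" where
  "sconst c = mconst (hconst c)"

lemma coeff_sconst: "coeff (sconst c) e k = (if e = (\<lambda>_. 0) \<and> k = 0 then c else 0)"
  by (simp add: coeff_def sconst_def mcoeff_mconst hcoeff_hconst)

lemma coeff_sconst_mult [simp]:
  "coeff (sconst c * f) e k = c * coeff (f :: ('q::finite, 's::finite, 'k::complete_valuation_domain) ser) e k"
  by (simp add: coeff_def sconst_def)

lemma sconst_simps:
  fixes c :: "'k::complete_valuation_domain"
  shows "(sconst (c + d) :: ('q, 's, 'k) ser) = sconst c + sconst d"
    "(sconst (c * d) :: ('q::finite, 's::finite, 'k) ser) = sconst c * sconst d"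
    "(sconst 1 :: ('q::finite, 's::finite, 'k) ser) = 1" "(sconst 0 :: ('q, 's, 'k) ser) = 0"
  by (simp_all add: sconst_def hconst_simps mconst_simps)

lemma sconst_of_nat: "(sconst (of_nat n) :: ('q::finite, 's::finite, 'k::complete_valuation_domain) ser) = of_nat n"
  by (induction n) (simp_all add: sconst_simps)

text \<open>Nonzero integers have valuation 0, so the factors produced by differentiation, and their
  inverses, do not change absolute values. Continuity of \<open>mderiv\<close> and the recursion in
  \<open>bounded_uniqueness\<close> rest on this.\<close>

lemma absK_of_nat: "n \<noteq> 0 \<Longrightarrow> absK (of_nat n :: 'k::complete_valuation_domain) = 1"
proof -
  assume n: "n \<noteq> 0"
  have "vK (of_nat n :: 'k) = 0"
    by (rule vK_Rats[of "int n" 1]) (use n in auto)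
  moreover have "(of_nat n :: 'k) \<noteq> 0"
    using calculation by (metis vK_eq_PInf PInfty_neq_ereal(1) zero_ereal_def)
  ultimately show ?thesis by (simp add: absK_vK)
qed

lemma of_nat_inverseK:
  assumes "n \<noteq> 0" obtains x where "of_nat n * x = (1 :: 'k::complete_valuation_domain)" "absK x = 1"
proof -
  obtain x :: 'k where x: "of_int (int n) * x = 1"
    using Rats_subset[of "int n"] assms by auto
  then have "of_nat n * x = 1" by simp
  moreover from this have "absK x = 1"
    by (metis absK_1 absK_mult absK_of_nat assms mult_1)
  ultimately show thesis by (rule that)
qed

lemma of_nat_inverse_ser:
  assumes "n \<noteq> 0"
  obtains x where "of_nat n * sconst x = (1 :: ('q::finite, 's::finite, 'k::complete_valuation_domain) ser)" "absK x = 1"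
proof -
  obtain x :: 'k where x: "of_nat n * x = (1 :: 'k)" "absK x = 1"
    using of_nat_inverseK[OF assms] .
  then have "of_nat n * sconst x = (1 :: ('q, 's, 'k) ser)"
    by (simp add: sconst_of_nat[symmetric] sconst_simps(2)[symmetric] sconst_simps(3))
  then show thesis using x(2) by (rule that)
qed

lemma hcoeff_of_nat_mult [simp]: "hcoeff (of_nat n * a) k = of_nat n * hcoeff a k"
  by (induction n) (simp_all add: distrib_right)

lemma hseries_of_nat_mult_eq_0: "n \<noteq> 0 \<Longrightarrow> of_nat n * a = 0 \<Longrightarrow> a = (0 :: 'k::complete_valuation_domain hseries)"
proof (rule hcoeff_inject_ext)
  fix k assume n: "n \<noteq> 0" and "of_nat n * a = 0"
  then have "of_nat n * hcoeff a k = 0" by (metis hcoeff_of_nat_mult hcoeff_simps(1))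
  moreover have "(of_nat n :: 'k) \<noteq> 0" using absK_of_nat[OF n, where 'k = 'k] by auto
  ultimately show "hcoeff a k = hcoeff 0 k" by simp
qed

text \<open>\<open>hpos\<close> is \<open>K{\<hbar>}\<close> and \<open>hzero\<close> below is
  \<open>K\<close>, as subsets of the coefficient ring; \<open>ringOBh\<close> and
  \<open>ringOB\<close> are the series with all coefficients in them.\<close>

definition hpos :: "'k::complete_valuation_domain hseries set" where
  "hpos = {a. \<forall>n<0. hcoeff a n = 0}"

definition hzero :: "'k::complete_valuation_domain hseries set" where
  "hzero = {a. \<forall>n. n \<noteq> 0 \<longrightarrow> hcoeff a n = 0}"

lemma hpos_mult: "a \<in> hpos \<Longrightarrow> b \<in> hpos \<Longrightarrow> a * b \<in> hpos"
proof -
  assume ab: "a \<in> hpos" "b \<in> hpos"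
  have "hcoeff (a * b) n = 0" if "n < 0" for n
  proof -
    have z: "hcoeff a i * hcoeff b (n - i) = 0" for i
    proof (cases "i < 0")
      case True then show ?thesis using ab by (simp add: hpos_def)
    next
      case False then have "n - i < 0" using that by simp
      then show ?thesis using ab by (simp add: hpos_def)
    qed
    show ?thesis by (simp only: times_hseries.rep_eq z infsum_0_simp)
  qed
  then show ?thesis by (simp add: hpos_def)
qed

lemma hzero_hconst: "hzero = range hconst"
proof
  show "hzero \<subseteq> range (hconst :: 'a \<Rightarrow> _)"
  proof
    fix a :: "'a hseries" assume "a \<in> hzero"
    then have "a = hconst (hcoeff a 0)"
      by (intro hcoeff_inject_ext) (auto simp: hzero_def hcoeff_hconst)
    then show "a \<in> range hconst" by blast
  qed
qed (auto simp: hzero_def hcoeff_hconst)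

lemma hzero_mult: "a \<in> hzero \<Longrightarrow> b \<in> hzero \<Longrightarrow> a * b \<in> hzero"
  by (auto simp: hzero_hconst hconst_simps(2)[symmetric])

text \<open>If i is nonzero, one of i and -i is negative, so only i = 0 contributes. Reduction
  modulo \<hbar> is thus multiplicative on \<open>K{\<hbar>}\<close>, though not in the presence of
  negative powers.\<close>

lemma hcoeff_0_mult_hpos:
  assumes "a \<in> hpos" "b \<in> hpos"
  shows "hcoeff (a * b) 0 = hcoeff a 0 * hcoeff b 0"
proof -
  have "hcoeff (a * b) 0 = (\<Sum>\<^sub>\<infinity>i\<in>{0}. hcoeff a i * hcoeff b (0 - i))"
    unfolding times_hseries.rep_eq
  proof (rule infsum_cong_neutral)
    fix i :: int assume "i \<in> UNIV - {0}"
    then consider "i < 0" | "0 - i < 0" by force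
    then show "hcoeff a i * hcoeff b (0 - i) = 0"
      by cases (use assms in \<open>auto simp: hpos_def\<close>)
  qed auto
  then show ?thesis by simp
qed

lemma ringOBh_iff: "f \<in> ringOBh \<longleftrightarrow> (\<forall>e. mcoeff f e \<in> hpos)"
  by (auto simp: ringOBh_def coeff_def hpos_def)

lemma ringOB_iff: "f \<in> ringOB \<longleftrightarrow> (\<forall>e. mcoeff f e \<in> hzero)"
  by (auto simp: ringOB_def coeff_def hzero_def)

lemma sum_hpos: "(\<And>i. i \<in> A \<Longrightarrow> f i \<in> hpos) \<Longrightarrow> sum f A \<in> hpos"
  by (auto simp: hpos_def hcoeff_sum)

lemma sum_hzero: "(\<And>i. i \<in> A \<Longrightarrow> f i \<in> hzero) \<Longrightarrow> sum f A \<in> hzero"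
  by (auto simp: hzero_def hcoeff_sum)

lemma t_free_mult:
  assumes "f \<in> t_free" "g \<in> t_free"
  shows "f * g \<in> (t_free :: ('q::finite, 's::finite, 'k::complete_valuation_domain) ser set)"
proof -
  have "mcoeff (f * g) e = 0" if i: "e (Inr i) \<noteq> 0" for e i
    unfolding times_mps.rep_eq
  proof (rule sum.neutral, safe)
    fix d :: "'q + 's \<Rightarrow> nat" assume "d \<le> e"
    then have "d (Inr i) \<noteq> 0 \<or> (e - d) (Inr i) \<noteq> 0" using i by auto
    then have "mcoeff f d = 0 \<or> mcoeff g (e - d) = 0"
      using assms unfolding t_free_def by blast
    then show "mcoeff f d * mcoeff g (e - d) = 0" by auto
  qed
  then show ?thesis by (auto simp: t_free_def)
qed

definition subring_of :: "'a::comm_ring_1 set \<Rightarrow> bool" where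
  "subring_of S \<longleftrightarrow> 1 \<in> S \<and> (\<forall>x\<in>S. \<forall>y\<in>S. x - y \<in> S \<and> x * y \<in> S)"

lemma subring_of:
  assumes "subring_of S"
  shows "1 \<in> S" "0 \<in> S" "x \<in> S \<Longrightarrow> - x \<in> S" "x \<in> S \<Longrightarrow> y \<in> S \<Longrightarrow> x + y \<in> S"
    "x \<in> S \<Longrightarrow> y \<in> S \<Longrightarrow> x - y \<in> S" "x \<in> S \<Longrightarrow> y \<in> S \<Longrightarrow> x * y \<in> S"
proof -
  show 1: "1 \<in> S" using assms by (simp add: subring_of_def)
  have d: "x - y \<in> S" if "x \<in> S" "y \<in> S" for x y using assms that by (simp add: subring_of_def)
  show 0: "0 \<in> S" using d[OF 1 1] by simp
  have m: "- x \<in> S" if "x \<in> S" for x using d[OF 0 that] by simp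
  show "x \<in> S \<Longrightarrow> - x \<in> S" by (rule m)
  show "x \<in> S \<Longrightarrow> y \<in> S \<Longrightarrow> x + y \<in> S" using d[of x "- y"] m[of y] by simp
  show "x \<in> S \<Longrightarrow> y \<in> S \<Longrightarrow> x - y \<in> S" by (rule d)
  show "x \<in> S \<Longrightarrow> y \<in> S \<Longrightarrow> x * y \<in> S" using assms by (simp add: subring_of_def)
qed

lemma subring_of_sum: "subring_of S \<Longrightarrow> (\<And>i. i \<in> A \<Longrightarrow> f i \<in> S) \<Longrightarrow> sum f A \<in> S"
  by (induction A rule: infinite_finite_induct) (auto intro: subring_of)

lemma subring_of_prod: "subring_of S \<Longrightarrow> (\<And>i. i \<in> A \<Longrightarrow> f i \<in> S) \<Longrightarrow> prod f A \<in> S"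
  by (induction A rule: infinite_finite_induct) (auto intro: subring_of)

lemma subring_of_power: "subring_of S \<Longrightarrow> x \<in> S \<Longrightarrow> x ^ n \<in> S"
  by (induction n) (auto intro: subring_of)

lemma subring_of_Int: "subring_of S \<Longrightarrow> subring_of T \<Longrightarrow> subring_of (S \<inter> T)"
  by (auto simp: subring_of_def)

lemma subring_ringOBh: "subring_of (ringOBh :: ('q::finite, 's::finite, 'k::complete_valuation_domain) ser set)"
  unfolding subring_of_def
  by (auto simp: ringOBh_iff mcoeff_1 times_mps.rep_eq intro!: sum_hpos hpos_mult) (auto simp: hpos_def)

lemma subring_ringOB: "subring_of (ringOB :: ('q::finite, 's::finite, 'k::complete_valuation_domain) ser set)"
  unfolding subring_of_def
  by (auto simp: ringOB_iff mcoeff_1 times_mps.rep_eq intro!: sum_hzero hzero_mult) (auto simp: hzero_def)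

lemma subring_t_free: "subring_of (t_free :: ('q::finite, 's::finite, 'k::complete_valuation_domain) ser set)"
  unfolding subring_of_def
  by (auto simp: t_free_mult) (auto simp: t_free_def mcoeff_1)

lemma subring_ringO: "subring_of (ringO :: ('q::finite, 's::finite, 'k::complete_valuation_domain) ser set)"
  and subring_ringOh: "subring_of (ringOh :: ('q::finite, 's::finite, 'k::complete_valuation_domain) ser set)"
  unfolding ringO_def ringOh_def
  by (intro subring_of_Int subring_ringOB subring_ringOBh subring_t_free)+

lemma ringOB_subset: "ringOB \<subseteq> ringOBh"
  by (auto simp: ringOB_def ringOBh_def)

lemma ringK_subset: "ringK \<subseteq> ringO" "ringK \<subseteq> ringOB" "ringK \<subseteq> ringOBh" "ringK \<subseteq> t_free" "ringK \<subseteq> Q_free"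
  "ringO \<subseteq> ringOB" "ringO \<subseteq> t_free"
  using ringOB_subset by (auto simp: ringK_def ringO_def)

lemma ringK_sconst: "ringK = range (sconst :: 'k \<Rightarrow> ('q, 's, 'k::complete_valuation_domain) ser)"
proof
  show "ringK \<subseteq> range (sconst :: 'k \<Rightarrow> ('q, 's, 'k) ser)"
  proof
    fix f :: "('q, 's, 'k) ser" assume f: "f \<in> ringK"
    have "f = sconst (coeff f (\<lambda>_. 0) 0)"
    proof (rule coeff_eqI)
      fix e k
      show "coeff f e k = coeff (sconst (coeff f (\<lambda>_. 0) 0)) e k"
      proof (cases "e = (\<lambda>_. 0)")
        case True
        then show ?thesis using f by (auto simp: coeff_sconst ringK_def ringO_def ringOB_def)
      next
        case False
        then obtain j where j: "e j \<noteq> 0" by auto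
        then have "mcoeff f e = 0"
          using f by (cases j) (auto simp: ringK_def ringO_def t_free_def Q_free_def)
        then show ?thesis using False by (simp add: coeff_sconst) (simp add: coeff_def)
      qed
    qed
    then show "f \<in> range sconst" by blast
  qed
  show "range (sconst :: 'k \<Rightarrow> ('q, 's, 'k) ser) \<subseteq> ringK"
    by (auto simp: ringK_def ringO_def ringOB_def coeff_sconst) (auto simp: t_free_def Q_free_def sconst_def mcoeff_mconst)
qed

lemma ringK_coeff: "c \<in> ringK \<Longrightarrow> sconst (coeff c (\<lambda>_. 0) 0) = c"
  by (auto simp: ringK_sconst coeff_sconst)

lemma hpow_mem:
  "hpow n \<in> t_free" "hpow n \<in> Q_free" "n \<ge> 0 \<Longrightarrow> hpow n \<in> ringOBh"
  by (auto simp: t_free_def Q_free_def ringOBh_iff hpow_mconst mcoeff_mconst hpos_def hcoeff_hmonom)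

lemma mvar_mem:
  "mvar i \<in> ringOB" "mvar i \<in> ringOBh" "Qvar a \<in> t_free" "tvar j \<in> Q_free"
  by (auto simp: ringOB_iff ringOBh_iff t_free_def Q_free_def mvar_def hpos_def hzero_def fun_eq_iff split: if_splits)

lemma mderiv_mem:
  fixes f :: "('q::finite, 's::finite, 'k::complete_valuation_domain) ser"
  shows "f \<in> ringOBh \<Longrightarrow> mderiv i f \<in> ringOBh" "f \<in> ringOB \<Longrightarrow> mderiv i f \<in> ringOB"
  unfolding ringOBh_iff ringOB_iff mderiv_def
  by (simp_all only: mcoeff_Abs_mps) (simp_all add: hpos_def hzero_def del: of_nat_Suc of_nat_add)

section \<open>The substitutions Q = 0 and \<hbar> to -\<hbar>\<close>

lemma at_Q0_add [simp]: "at_Q0 (f + g) = at_Q0 f + at_Q0 g"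
  and at_Q0_diff [simp]: "at_Q0 (f - g) = at_Q0 f - at_Q0 g"
  and at_Q0_minus [simp]: "at_Q0 (- f) = - at_Q0 f"
  and at_Q0_0 [simp]: "at_Q0 0 = 0"
  by (rule mps_eqI; simp add: at_Q0_def)+

lemma at_Q0_mult [simp]: "at_Q0 (f * g) = at_Q0 f * at_Q0 (g :: ('q::finite, 's::finite, 'k::complete_valuation_domain) ser)"
proof (rule mps_eqI)
  fix e :: "'q + 's \<Rightarrow> nat"
  show "mcoeff (at_Q0 (f * g)) e = mcoeff (at_Q0 f * at_Q0 g) e"
  proof (cases "\<forall>a. e (Inl a) = 0")
    case True
    have "mcoeff (at_Q0 f) d * mcoeff (at_Q0 g) (e - d) = mcoeff f d * mcoeff g (e - d)" if "d \<le> e" for d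
    proof -
      have "d (Inl a) = 0" "(e - d) (Inl a) = 0" for a
        using le_funD[OF that, of "Inl a"] True by simp_all
      then show ?thesis by (simp add: at_Q0_def del: minus_apply)
    qed
    then have "mcoeff (at_Q0 f * at_Q0 g) e = mcoeff (f * g) e"
      unfolding times_mps.rep_eq by (intro sum.cong) auto
    then show ?thesis using True by (simp add: at_Q0_def)
  next
    case False
    then obtain a where a: "e (Inl a) \<noteq> 0" by auto
    have "mcoeff (at_Q0 f * at_Q0 g) e = 0"
      unfolding times_mps.rep_eq
    proof (rule sum.neutral, safe)
      fix d :: "'q + 's \<Rightarrow> nat" assume "d \<le> e"
      then have "d (Inl a) \<noteq> 0 \<or> (e - d) (Inl a) \<noteq> 0" using a by auto
      then show "mcoeff (at_Q0 f) d * mcoeff (at_Q0 g) (e - d) = 0"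
        unfolding at_Q0_def by auto
    qed
    moreover have "mcoeff (at_Q0 h) e = 0" for h :: "('q, 's, 'k) ser"
      using a by (auto simp: at_Q0_def)
    ultimately show ?thesis by simp
  qed
qed

lemma at_Q0_1 [simp]: "at_Q0 1 = 1"
  by (rule mps_eqI) (auto simp: at_Q0_def mcoeff_1)

lemma at_Q0_Q_free: "f \<in> Q_free \<Longrightarrow> at_Q0 f = f"
  by (rule mps_eqI) (auto simp: at_Q0_def Q_free_def)

lemma at_Q0_Qvar [simp]: "at_Q0 (Qvar a) = 0"
  by (rule mps_eqI) (auto simp: at_Q0_def mvar_def fun_eq_iff)

lemma at_Q0_hpow [simp]: "at_Q0 (hpow n) = hpow n"
  by (rule at_Q0_Q_free) (rule hpow_mem)

lemma at_Q0_mem: "f \<in> ringOBh \<Longrightarrow> at_Q0 f \<in> ringOBh" "f \<in> ringOB \<Longrightarrow> at_Q0 f \<in> ringOB" "f \<in> t_free \<Longrightarrow> at_Q0 f \<in> t_free"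
  "at_Q0 f \<in> Q_free"
  by (auto simp: at_Q0_def ringOBh_iff ringOB_iff t_free_def Q_free_def hpos_def hzero_def)

lemma at_Q0_idem [simp]: "at_Q0 (at_Q0 f) = at_Q0 f"
  by (simp add: at_Q0_Q_free at_Q0_mem)

lemma hcoeff_hflip: "hcoeff (hflip_coeff a) n = (if even n then hcoeff a n else - hcoeff a n)"
  by (simp add: hflip_coeff.rep_eq)

lemma hflip_coeff_mult: "hflip_coeff (a * b) = hflip_coeff a * hflip_coeff b"
proof (rule hcoeff_inject_ext)
  fix n
  have "hcoeff (hflip_coeff a * hflip_coeff b) n =
      (\<Sum>\<^sub>\<infinity>i. if even n then hcoeff a i * hcoeff b (n - i) else - (hcoeff a i * hcoeff b (n - i)))"
    unfolding times_hseries.rep_eq by (rule infsum_cong) (auto simp: hcoeff_hflip)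
  also have "\<dots> = hcoeff (hflip_coeff (a * b)) n"
    by (simp add: hcoeff_hflip times_hseries.rep_eq infsum_uminus)
  finally show "hcoeff (hflip_coeff (a * b)) n = hcoeff (hflip_coeff a * hflip_coeff b) n" ..
qed

lemma hflip_coeff_add: "hflip_coeff (a + b) = hflip_coeff a + hflip_coeff b"
  and hflip_coeff_diff: "hflip_coeff (a - b) = hflip_coeff a - hflip_coeff b"
  and hflip_coeff_0: "hflip_coeff 0 = 0" and hflip_coeff_1: "hflip_coeff 1 = 1"
  by (rule hcoeff_inject_ext; auto simp: hcoeff_hflip)+

lemma hflip_coeff_sum: "hflip_coeff (sum f A) = (\<Sum>i\<in>A. hflip_coeff (f i))"
  by (induction A rule: infinite_finite_induct) (simp_all add: hflip_coeff_add hflip_coeff_0)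

lemma hflip_add [simp]: "hflip (f + g) = hflip f + hflip g"
  and hflip_diff [simp]: "hflip (f - g) = hflip f - hflip g"
  and hflip_0 [simp]: "hflip 0 = 0"
  by (rule mps_eqI; simp add: hflip_def hflip_coeff_add hflip_coeff_diff hflip_coeff_0)+

lemma hflip_mult [simp]: "hflip (f * g) = hflip f * hflip (g :: ('q::finite, 's::finite, 'k::complete_valuation_domain) ser)"
  by (rule mps_eqI) (simp add: hflip_def times_mps.rep_eq hflip_coeff_sum hflip_coeff_mult)

lemma hflip_1 [simp]: "hflip 1 = 1"
  by (rule mps_eqI) (auto simp: hflip_def mcoeff_1 hflip_coeff_1 hflip_coeff_0)

lemma hflip_ringOB: "f \<in> ringOB \<Longrightarrow> hflip f = f"
proof (rule coeff_eqI)
  fix e k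
  assume "f \<in> ringOB"
  then have "k \<noteq> 0 \<Longrightarrow> hcoeff (mcoeff f e) k = 0" by (simp add: ringOB_def coeff_def)
  then show "coeff (hflip f) e k = coeff f e k"
    by (cases "k = 0") (simp_all add: hflip_def coeff_def hcoeff_hflip)
qed

text \<open>This is where the sign of the exponent gets reversed in the cone formula.\<close>

lemma hflip_hpow_m1: "hflip (hpow (-1)) = - hpow (-1)"
  by (rule coeff_eqI) (simp add: hflip_def coeff_def hcoeff_hflip hpow_mconst mcoeff_mconst hcoeff_hmonom)

lemma hflip_mem: "f \<in> ringOBh \<Longrightarrow> hflip f \<in> ringOBh" "f \<in> t_free \<Longrightarrow> hflip f \<in> t_free" "f \<in> ringOh \<Longrightarrow> hflip f \<in> ringOh"
  by (auto simp: hflip_def ringOBh_def coeff_def t_free_def ringOh_def hcoeff_hflip hflip_coeff_0)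

section \<open>Partial derivatives and the operators \<open>QdQ\<close>\<close>

lemma mderiv_add [simp]: "mderiv i (f + g) = mderiv i f + mderiv i g"
  and mderiv_diff [simp]: "mderiv i (f - g) = mderiv i f - mderiv i g"
  and mderiv_minus [simp]: "mderiv i (- f) = - mderiv i f"
  and mderiv_0 [simp]: "mderiv i 0 = 0"
  by (rule mps_eqI; simp add: mderiv_def algebra_simps del: of_nat_Suc of_nat_add)+

lemma mcoeff_mderiv: "mcoeff (mderiv i f) e = of_nat (Suc (e i)) * mcoeff f (e(i := Suc (e i)))"
  by (simp add: mderiv_def)

text \<open>One half of the product rule. At \<open>e(i := Suc (e i))\<close> the factor
  \<open>Suc (e i)\<close> splits into the i-exponent of d and that of its complement, and each part
  gives a sum of this shape. Terms with \<open>d i = 0\<close> drop out; the others are shifted down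
  by one in direction i.\<close>

lemma mcoeff_mderiv_aux:
  fixes f g :: "('i::finite, 'a::comm_ring_1) mps"
  shows "(\<Sum>d | d \<le> e(i := Suc (e i)). of_nat (d i) * (mcoeff f d * mcoeff g (e(i := Suc (e i)) - d))) =
    mcoeff (mderiv i f * g) e"
proof -
  let ?e = "e(i := Suc (e i))"
  have "(\<Sum>d | d \<le> ?e. of_nat (d i) * (mcoeff f d * mcoeff g (?e - d))) =
      (\<Sum>d | d \<le> ?e \<and> d i \<noteq> 0. of_nat (d i) * (mcoeff f d * mcoeff g (?e - d)))"
    by (rule sum.mono_neutral_right[OF finite_exponents_le]) auto
  also have "\<dots> = (\<Sum>d | d \<le> e. mcoeff (mderiv i f) d * mcoeff g (e - d))"
  proof (rule sum.reindex_bij_witness[of _ "\<lambda>d. d(i := Suc (d i))" "\<lambda>d. d(i := d i - 1)"], goal_cases)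
    case (2 d)
    then have "d j \<le> ?e j" for j by (simp add: le_fun_def)
    then have "d j \<le> e j \<or> j = i" "d i \<le> Suc (e i)" for j by (metis fun_upd_apply)+
    then show ?case by (auto simp: le_fun_def)
  next
    case (5 d)
    then have "?e - d = e - d(i := d i - 1)" by (auto simp: fun_eq_iff)
    with 5 show ?case by (simp add: mcoeff_mderiv fun_upd_idem mult.assoc)
  qed (auto simp: le_fun_def)
  finally show ?thesis by (simp add: times_mps.rep_eq)
qed

lemma mderiv_mult [simp]: "mderiv i (f * g) = mderiv i f * g + f * mderiv i (g :: ('i::finite, 'a::comm_ring_1) mps)"
proof (rule mps_eqI)
  fix e
  let ?e = "e(i := Suc (e i))"
  have "mcoeff (mderiv i (f * g)) e = (\<Sum>d | d \<le> ?e. of_nat (Suc (e i)) * (mcoeff f d * mcoeff g (?e - d)))"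
    by (simp add: mcoeff_mderiv times_mps.rep_eq sum_distrib_left del: of_nat_Suc)
  also have "\<dots> = (\<Sum>d | d \<le> ?e. of_nat (d i) * (mcoeff f d * mcoeff g (?e - d)) +
        of_nat ((?e - d) i) * (mcoeff g (?e - d) * mcoeff f d))"
  proof (rule sum.cong[OF refl])
    fix d assume "d \<in> {d. d \<le> ?e}"
    then have "d i \<le> Suc (e i)" using le_funD[of d ?e i] by simp
    then have *: "Suc (e i) = d i + (?e - d) i" by simp
    show "of_nat (Suc (e i)) * (mcoeff f d * mcoeff g (?e - d)) =
        of_nat (d i) * (mcoeff f d * mcoeff g (?e - d)) + of_nat ((?e - d) i) * (mcoeff g (?e - d) * mcoeff f d)"
      by (subst *) (simp add: algebra_simps del: of_nat_Suc fun_upd_apply minus_apply)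
  qed
  also have "\<dots> = mcoeff (mderiv i f * g) e +
      (\<Sum>d | d \<le> ?e. of_nat ((?e - d) i) * (mcoeff g (?e - d) * mcoeff f d))"
    by (simp only: sum.distrib mcoeff_mderiv_aux)
  also have "(\<Sum>d | d \<le> ?e. of_nat ((?e - d) i) * (mcoeff g (?e - d) * mcoeff f d)) =
      (\<Sum>d | d \<le> ?e. of_nat (d i) * (mcoeff g d * mcoeff f (?e - d)))"
    by (rule sum.reindex_bij_witness[of _ "\<lambda>d. ?e - d" "\<lambda>d. ?e - d"])
      (simp_all only: mem_Collect_eq diff_diff_exponents, simp_all add: le_fun_def)
  also have "\<dots> = mcoeff (mderiv i g * f) e" by (rule mcoeff_mderiv_aux)
  finally show "mcoeff (mderiv i (f * g)) e = mcoeff (mderiv i f * g + f * mderiv i g) e"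
    by (simp add: mult.commute)
qed

lemma mderiv_commute: "mderiv i (mderiv j f) = mderiv j (mderiv i (f :: ('i::finite, 'a::comm_ring_1) mps))"
  by (cases "i = j") (auto intro!: mps_eqI simp: mcoeff_mderiv fun_upd_twist mult_ac simp del: of_nat_Suc)

lemma mderiv_mconst [simp]: "mderiv i (mconst c) = 0"
  by (rule mps_eqI) (auto simp: mcoeff_mderiv mcoeff_mconst fun_eq_iff)

lemma mderiv_1 [simp]: "mderiv i (1 :: ('i::finite, 'a::comm_ring_1) mps) = 0"
  using mderiv_mconst[of i 1] by (simp add: mconst_simps)

lemma mderiv_hpow [simp]: "mderiv i (hpow n) = 0"
  by (simp add: hpow_mconst)

lemma mderiv_mvar: "mderiv i (mvar j) = (if i = j then 1 else (0 :: ('i::finite, 'a::comm_ring_1) mps))"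
proof (rule mps_eqI)
  fix e
  have "e(i := Suc (e i)) = (\<lambda>k. if k = j then 1 else 0) \<longleftrightarrow> i = j \<and> e = (\<lambda>_. 0)"
    by (simp add: fun_eq_iff) (metis One_nat_def Suc_inject Suc_neq_Zero)
  then show "mcoeff (mderiv i (mvar j)) e = mcoeff (if i = j then 1 else (0 :: ('i, 'a) mps)) e"
    by (simp add: mcoeff_mderiv mvar_def mcoeff_1)
qed

lemma dt_t_free: "f \<in> t_free \<Longrightarrow> dt i f = 0" for f :: "('q::finite, 's::finite, 'k::complete_valuation_domain) ser"
proof (rule mps_eqI)
  fix e :: "'q + 's \<Rightarrow> nat"
  assume "f \<in> t_free"
  moreover have "(e(Inr i := Suc (e (Inr i)))) (Inr i) \<noteq> 0" by simp
  ultimately have "mcoeff f (e(Inr i := Suc (e (Inr i)))) = 0" unfolding t_free_def by blast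
  then show "mcoeff (dt i f) e = mcoeff 0 e" by (simp add: mcoeff_mderiv)
qed

lemma mderiv_Q_free: "f \<in> Q_free \<Longrightarrow> mderiv (Inl a) f = 0" for f :: "('q::finite, 's::finite, 'k::complete_valuation_domain) ser"
proof (rule mps_eqI)
  fix e :: "'q + 's \<Rightarrow> nat"
  assume "f \<in> Q_free"
  moreover have "(e(Inl a := Suc (e (Inl a)))) (Inl a) \<noteq> 0" by simp
  ultimately have "mcoeff f (e(Inl a := Suc (e (Inl a)))) = 0" unfolding Q_free_def by blast
  then show "mcoeff (mderiv (Inl a) f) e = mcoeff 0 e" by (simp add: mcoeff_mderiv)
qed

text \<open>Characteristic zero: a derivative multiplies each coefficient by its exponent, a nonzero
  integer that can be cancelled.\<close>

lemma t_freeI: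
  fixes f :: "('q::finite, 's::finite, 'k::complete_valuation_domain) ser"
  assumes "\<And>i. dt i f = 0" shows "f \<in> t_free"
  unfolding t_free_def
proof safe
  fix e :: "'q + 's \<Rightarrow> nat" and i assume i: "0 < e (Inr i)"
  have "mcoeff (dt i f) (e(Inr i := e (Inr i) - 1)) = 0" by (simp add: assms)
  then have "of_nat (e (Inr i)) * mcoeff f e = 0"
    using i by (simp add: mcoeff_mderiv fun_upd_idem)
  then show "mcoeff f e = 0" using i hseries_of_nat_mult_eq_0 by blast
qed

lemma at_Q0_dt: "at_Q0 (dt i f) = dt i (at_Q0 f)"
  by (rule mps_eqI) (simp add: at_Q0_def mcoeff_mderiv)

lemma mcoeff_mvar_mult:
  fixes f :: "('i::finite, 'a::comm_ring_1) mps"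
  shows "mcoeff (mvar i * f) e = (if e i = 0 then 0 else mcoeff f (e(i := e i - 1)))"
proof -
  let ?v = "\<lambda>j. if j = i then 1 else (0::nat)"
  have *: "mcoeff (mvar i * f) e = (\<Sum>d | d \<le> e. (if d = ?v then 1 else 0) * mcoeff f (e - d))"
    by (simp add: times_mps.rep_eq mvar_def)
  show ?thesis
  proof (cases "e i = 0")
    case True
    then have "\<not> ?v \<le> e" by (auto simp: le_fun_def)
    then have "mcoeff (mvar i * f) e = 0" unfolding * by (intro sum.neutral) auto
    with True show ?thesis by simp
  next
    case False
    have "mcoeff (mvar i * f) e = (\<Sum>d\<in>{?v}. mcoeff f (e - d))"
      unfolding * by (rule sum.mono_neutral_cong_right[OF finite_exponents_le]) (use False in \<open>auto simp: le_fun_def\<close>)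
    moreover have "e - ?v = e(i := e i - 1)" by (auto simp: fun_eq_iff)
    ultimately show ?thesis using False by simp
  qed
qed

text \<open>The Euler operator is diagonal on monomials, so an equation whose other terms are
  products with constant matrices decouples into one equation for each exponent.\<close>

lemma mcoeff_QdQ:
  "mcoeff (QdQ a f) e = of_nat (e (Inl a)) * mcoeff (f :: ('q::finite, 's::finite, 'k::complete_valuation_domain) ser) e"
  by (simp add: mcoeff_mvar_mult mcoeff_mderiv del: of_nat_Suc)

section \<open>Convergence of series\<close>

definition edeg :: "('i::finite \<Rightarrow> nat) \<Rightarrow> nat" where
  "edeg e = (\<Sum>i\<in>UNIV. e i)"

lemma edeg_mono: "d \<le> e \<Longrightarrow> edeg d \<le> edeg e"
  by (auto simp: edeg_def le_fun_def intro: sum_mono)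

lemma finite_edeg_le: "finite {e :: 'i::finite \<Rightarrow> nat. edeg e \<le> n}"
proof (rule finite_subset[OF _ finite_exponents_le[of "\<lambda>_. n"]])
  show "{e :: 'i \<Rightarrow> nat. edeg e \<le> n} \<subseteq> {d. d \<le> (\<lambda>_. n)}"
  proof (auto simp: le_fun_def)
    fix e :: "'i \<Rightarrow> nat" and i assume "edeg e \<le> n"
    moreover have "e i \<le> edeg e" unfolding edeg_def by (rule member_le_sum) auto
    ultimately show "e i \<le> n" by simp
  qed
qed

lemma nbhd0_iff: "f \<in> nbhd0 n \<longleftrightarrow> (\<forall>e. edeg e \<le> n \<longrightarrow> (\<forall>k. absK (coeff f e k) \<le> exp (- real n)))"
  by (simp add: nbhd0_def absK_le_vK edeg_def)

lemma nbhd0_0 [simp]: "0 \<in> nbhd0 n"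
  by (simp add: nbhd0_iff)

lemma nbhd0_diff: "f \<in> nbhd0 n \<Longrightarrow> g \<in> nbhd0 n \<Longrightarrow> f - g \<in> nbhd0 n"
  unfolding nbhd0_iff coeff_simps by (blast intro: order_trans[OF absK_diff] max.boundedI)

lemma nbhd0_add: "f \<in> nbhd0 n \<Longrightarrow> g \<in> nbhd0 n \<Longrightarrow> f + g \<in> nbhd0 n"
  unfolding nbhd0_iff coeff_simps by (blast intro: order_trans[OF absK_add] max.boundedI)

lemma nbhd0_sum: "(\<And>i. i \<in> A \<Longrightarrow> f i \<in> nbhd0 n) \<Longrightarrow> sum f A \<in> nbhd0 n"
  by (induction A rule: infinite_finite_induct) (auto intro: nbhd0_add)

lemma nbhd0_minus: "f \<in> nbhd0 n \<Longrightarrow> - f \<in> nbhd0 n"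
  using nbhd0_diff[of 0 n f] by simp

lemma nbhd0_antimono: "m \<le> n \<Longrightarrow> nbhd0 n \<subseteq> (nbhd0 m :: ('q::finite, 's::finite, 'k::complete_valuation_domain) ser set)"
proof
  fix f :: "('q, 's, 'k) ser" assume mn: "m \<le> n" and f: "f \<in> nbhd0 n"
  have "exp (- real n) \<le> exp (- real m)" using mn by simp
  then show "f \<in> nbhd0 m"
    using f mn unfolding nbhd0_iff by (meson order_trans)
qed

text \<open>The topology is separated, which gives uniqueness of sums. \<open>nbhd0 m\<close>
  controls a coefficient only once m reaches its degree, hence m is the maximum of
  \<open>edeg e\<close> and the bound coming from r.\<close>

lemma nbhd0_Inter:
  assumes "\<And>n. f \<in> nbhd0 n" shows "f = 0"
proof (rule coeff_eqI)
  fix e k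
  have "absK (coeff f e k) \<le> r" if r: "0 < r" for r
  proof -
    obtain n :: nat where n: "- ln r \<le> real n" using real_arch_simple by blast
    define m where "m = max n (edeg e)"
    have "absK (coeff f e k) \<le> exp (- real m)"
      using assms[of m] by (auto simp: nbhd0_iff m_def)
    also have "\<dots> \<le> exp (ln r)" using n by (simp add: m_def del: exp_ln_iff exp_ln)
    finally show ?thesis using r by simp
  qed
  then have "absK (coeff f e k) \<le> 0" by (rule field_le_epsilon[where y = 0, simplified])
  then show "coeff f e k = coeff 0 e k"
    using absK_nonneg[of "coeff f e k"] absK_eq_0[of "coeff f e k"] by simp
qed

lemma absK_hmult:
  assumes "\<And>k. absK (hcoeff a k) \<le> A" "\<And>k. absK (hcoeff b k) \<le> B" "0 \<le> A" "0 \<le> B"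
  shows "absK (hcoeff (a * b) k) \<le> A * B"
  unfolding times_hseries.rep_eq
  by (rule absK_infsum_le) (auto simp: absK_mult assms intro!: mult_mono)

lemma absK_mult_coeff:
  assumes "\<And>d k. edeg d \<le> n \<Longrightarrow> absK (coeff f d k) \<le> A" "\<And>d k. edeg d \<le> n \<Longrightarrow> absK (coeff g d k) \<le> B"
    and "0 \<le> A" "0 \<le> B" "edeg e \<le> n"
  shows "absK (coeff (f * g) e k) \<le> A * B"
  unfolding coeff_def times_mps.rep_eq hcoeff_sum
proof (rule absK_sum[OF finite_exponents_le])
  fix d assume "d \<in> {d. d \<le> e}"
  then have "edeg d \<le> n" "edeg (e - d) \<le> n"
    using assms(5) edeg_mono[of d e] edeg_mono[of "e - d" e] by (auto simp: le_fun_def intro: order_trans)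
  then show "absK (hcoeff (mcoeff f d * mcoeff g (e - d)) k) \<le> A * B"
    using assms unfolding coeff_def by (intro absK_hmult) auto
qed (use assms in simp)

text \<open>Only finitely many exponents have degree at most n, and each coefficient is a bounded
  series in \<hbar>. The normalisation B \<ge> 1 keeps ln B nonnegative.\<close>

lemma coeff_bounded:
  fixes f :: "('q::finite, 's::finite, 'k::complete_valuation_domain) ser"
  obtains B where "B \<ge> 1" "\<And>e k. edeg e \<le> n \<Longrightarrow> absK (coeff f e k) \<le> B"
proof -
  have "\<exists>B. \<forall>k. absK (coeff f e k) \<le> B" for e
    using hcoeff_bounded[of "mcoeff f e"] unfolding coeff_def by blast
  then obtain B where B: "\<And>e k. absK (coeff f e k) \<le> B e" by metis
  let ?S = "insert 1 (B ` {e. edeg e \<le> n})"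
  have fin: "finite ?S" using finite_edeg_le by blast
  show thesis
  proof (rule that[of "Max ?S"])
    show "1 \<le> Max ?S" using fin by (intro Max_ge) auto
    fix e :: "'q + 's \<Rightarrow> nat" and k assume "edeg e \<le> n"
    then have "B e \<le> Max ?S" using fin by (intro Max_ge) auto
    then show "absK (coeff f e k) \<le> Max ?S" using B[of e k] by linarith
  qed
qed

text \<open>Additivity is stated through differences because convergence is; compatibility with 0,
  with finite sums and with infinite sums follows, and continuity at 0 is enough.\<close>

definition ser_cont :: "(('q::finite, 's::finite, 'k::complete_valuation_domain) ser \<Rightarrow> ('q, 's, 'k) ser) \<Rightarrow> bool" where
  "ser_cont h \<longleftrightarrow> (\<forall>x y. h (x - y) = h x - h y) \<and> (\<forall>n. \<exists>m. \<forall>x\<in>nbhd0 m. h x \<in> nbhd0 n)"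

lemma ser_contI:
  assumes "\<And>x y. h (x - y) = h x - h y" "\<And>n. \<exists>m. \<forall>x\<in>nbhd0 m. h x \<in> nbhd0 n"
  shows "ser_cont h"
  using assms by (simp add: ser_cont_def)

lemma ser_cont_diff: "ser_cont h \<Longrightarrow> h (x - y) = h x - h y"
  by (simp add: ser_cont_def)

lemma ser_cont_0: "ser_cont h \<Longrightarrow> h 0 = 0"
  using ser_cont_diff[of h 0 0] by simp

lemma ser_cont_add: "ser_cont h \<Longrightarrow> h (x + y) = h x + h y"
  using ser_cont_diff[of h "x + y" y] by (simp add: algebra_simps)

lemma ser_cont_sum: "ser_cont h \<Longrightarrow> h (sum f A) = (\<Sum>i\<in>A. h (f i))"
  by (induction A rule: infinite_finite_induct) (simp_all add: ser_cont_0 ser_cont_add)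

text \<open>\<open>nbhd0 n\<close> need not be an ideal, so the factor c has a cost: its
  coefficients up to degree n are bounded by some B, and m exceeds n by at least ln B to absorb
  it.\<close>

lemma ser_cont_mult: "ser_cont (\<lambda>x. c * (x :: ('q::finite, 's::finite, 'k::complete_valuation_domain) ser))"
proof (rule ser_contI)
  fix n
  obtain B where B: "B \<ge> 1" "\<And>e k. edeg e \<le> n \<Longrightarrow> absK (coeff c e k) \<le> B"
    using coeff_bounded by blast
  obtain m :: nat where m: "real n + ln B \<le> real m" using real_arch_simple by blast
  have nm: "n \<le> m" using m B(1) by (smt (verit) ln_ge_zero of_nat_le_iff)
  have "B * exp (- real m) = exp (ln B - real m)" using B(1) by (simp add: exp_diff exp_minus field_simps)
  also have "\<dots> \<le> exp (- real n)" using m by simp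
  finally have le: "B * exp (- real m) \<le> exp (- real n)" .
  have "c * x \<in> nbhd0 n" if x: "x \<in> nbhd0 m" for x
    unfolding nbhd0_iff
  proof (intro allI impI)
    fix e :: "'q + 's \<Rightarrow> nat" and k assume e: "edeg e \<le> n"
    have "absK (coeff (c * x) e k) \<le> B * exp (- real m)"
      by (rule absK_mult_coeff[of n, OF B(2) _ _ _ e]) (use x nm B(1) in \<open>auto simp: nbhd0_iff\<close>)
    then show "absK (coeff (c * x) e k) \<le> exp (- real n)" using le by linarith
  qed
  then show "\<exists>m. \<forall>x\<in>nbhd0 m. c * (x :: ('q, 's, 'k) ser) \<in> nbhd0 n" by blast
qed (simp add: algebra_simps)

lemma ser_cont_comp: "ser_cont g \<Longrightarrow> ser_cont h \<Longrightarrow> ser_cont (\<lambda>x. g (h x))"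
proof (rule ser_contI)
  fix n assume gh: "ser_cont g" "ser_cont h"
  obtain m where m: "\<forall>x\<in>nbhd0 m. g x \<in> nbhd0 n" using gh(1) unfolding ser_cont_def by blast
  obtain l where "\<forall>x\<in>nbhd0 l. h x \<in> nbhd0 m" using gh(2) unfolding ser_cont_def by blast
  with m show "\<exists>m. \<forall>x\<in>nbhd0 m. g (h x) \<in> nbhd0 n" by blast
qed (simp add: ser_cont_diff)

text \<open>A coefficient of the derivative in degree n comes from degree n + 1, and its integer
  factor has absolute value 1.\<close>

lemma ser_cont_mderiv:
  "ser_cont (mderiv i :: ('q::finite, 's::finite, 'k::complete_valuation_domain) ser \<Rightarrow> _)"
proof (rule ser_contI)
  fix n
  have "mderiv i x \<in> nbhd0 n" if x: "x \<in> nbhd0 (Suc n)" for x :: "('q, 's, 'k) ser"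
    unfolding nbhd0_iff
  proof (intro allI impI)
    fix e :: "'q + 's \<Rightarrow> nat" and k assume e: "edeg e \<le> n"
    let ?e = "e(i := Suc (e i))"
    have "edeg ?e = Suc (edeg e)"
      by (simp add: edeg_def sum.remove[of UNIV i])
    then have "absK (coeff x ?e k) \<le> exp (- real (Suc n))" using x e by (auto simp only: nbhd0_iff)
    moreover have "absK (coeff (mderiv i x) e k) = absK (coeff x ?e k)"
      unfolding coeff_def mcoeff_mderiv hcoeff_of_nat_mult absK_mult by (subst absK_of_nat) simp_all
    ultimately show "absK (coeff (mderiv i x) e k) \<le> exp (- real n)" by (simp add: order_trans)
  qed
  then show "\<exists>m. \<forall>x\<in>nbhd0 m. mderiv i (x :: ('q, 's, 'k) ser) \<in> nbhd0 n" by blast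
qed simp

lemma ser_cont_at_Q0:
  "ser_cont (at_Q0 :: ('q::finite, 's::finite, 'k::complete_valuation_domain) ser \<Rightarrow> _)"
proof (rule ser_contI)
  fix n
  have "at_Q0 x \<in> nbhd0 n" if "x \<in> nbhd0 n" for x :: "('q, 's, 'k) ser"
    using that by (auto simp: nbhd0_iff at_Q0_def coeff_def)
  then show "\<exists>m. \<forall>x\<in>nbhd0 m. at_Q0 (x :: ('q, 's, 'k) ser) \<in> nbhd0 n" by blast
qed simp

lemma ser_cont_hflip:
  "ser_cont (hflip :: ('q::finite, 's::finite, 'k::complete_valuation_domain) ser \<Rightarrow> _)"
proof (rule ser_contI)
  fix n
  have "hflip x \<in> nbhd0 n" if "x \<in> nbhd0 n" for x :: "('q, 's, 'k) ser"
    using that by (auto simp: nbhd0_iff hflip_def coeff_def hcoeff_hflip)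
  then show "\<exists>m. \<forall>x\<in>nbhd0 m. hflip (x :: ('q, 's, 'k) ser) \<in> nbhd0 n" by blast
qed simp

section \<open>Unordered sums of series\<close>

lemma ser_sumsE:
  assumes "ser_sums a f"
  obtains F where "finite F" "\<forall>H. finite H \<longrightarrow> F \<subseteq> H \<longrightarrow> f - sum a H \<in> nbhd0 n"
proof -
  have "\<exists>F. finite F \<and> (\<forall>H. finite H \<and> F \<subseteq> H \<longrightarrow> f - sum a H \<in> nbhd0 n)"
    using assms unfolding ser_sums_def by (rule spec)
  then show thesis using that by auto
qed

lemma ser_sums_unique:
  assumes "ser_sums a f" "ser_sums a g" shows "f = g"
proof -
  have "f - g \<in> nbhd0 n" for n
  proof -
    obtain F where F: "finite F" "\<And>H. finite H \<Longrightarrow> F \<subseteq> H \<Longrightarrow> f - sum a H \<in> nbhd0 n"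
      by (rule ser_sumsE[OF assms(1), of n]) (rule that, assumption, blast)
    obtain G where G: "finite G" "\<And>H. finite H \<Longrightarrow> G \<subseteq> H \<Longrightarrow> g - sum a H \<in> nbhd0 n"
      by (rule ser_sumsE[OF assms(2), of n]) (rule that, assumption, blast)
    have "(f - sum a (F \<union> G)) - (g - sum a (F \<union> G)) \<in> nbhd0 n"
      using F(1) G(1) by (intro nbhd0_diff[OF F(2) G(2)]) auto
    then show ?thesis by simp
  qed
  then show ?thesis using nbhd0_Inter[of "f - g"] by simp
qed

lemma ser_sums_the: "ser_sums a f \<Longrightarrow> (THE g. ser_sums a g) = f"
  using ser_sums_unique by blast

lemma ser_sums_cont:
  assumes "ser_cont h" "ser_sums a f" shows "ser_sums (\<lambda>j. h (a j)) (h f)"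
  unfolding ser_sums_def
proof
  fix n
  obtain m where m: "\<forall>x\<in>nbhd0 m. h x \<in> nbhd0 n" using assms(1) unfolding ser_cont_def by blast
  obtain F where F: "finite F" "\<And>H. finite H \<Longrightarrow> F \<subseteq> H \<Longrightarrow> f - sum a H \<in> nbhd0 m"
    by (rule ser_sumsE[OF assms(2), of m]) (rule that, assumption, blast)
  have "h f - (\<Sum>j\<in>H. h (a j)) \<in> nbhd0 n" if "finite H" "F \<subseteq> H" for H
    using m F(2)[OF that] by (simp add: ser_cont_sum[OF assms(1), symmetric] ser_cont_diff[OF assms(1), symmetric])
  with F(1) show "\<exists>F0. finite F0 \<and> (\<forall>H. finite H \<and> F0 \<subseteq> H \<longrightarrow> h f - (\<Sum>j\<in>H. h (a j)) \<in> nbhd0 n)"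
    by blast
qed

lemma ser_sums_mult: "ser_sums a f \<Longrightarrow> ser_sums (\<lambda>j. c * a j) (c * f)"
  by (rule ser_sums_cont[OF ser_cont_mult])

lemma ser_sums_0: "ser_sums (\<lambda>_. 0) 0"
  by (auto simp: ser_sums_def)

lemma ser_sums_diff:
  assumes "ser_sums a f" "ser_sums b g" shows "ser_sums (\<lambda>j. a j - b j) (f - g)"
  unfolding ser_sums_def
proof
  fix n
  obtain F where F: "finite F" "\<And>H. finite H \<Longrightarrow> F \<subseteq> H \<Longrightarrow> f - sum a H \<in> nbhd0 n"
    by (rule ser_sumsE[OF assms(1), of n]) (rule that, assumption, blast)
  obtain G where G: "finite G" "\<And>H. finite H \<Longrightarrow> G \<subseteq> H \<Longrightarrow> g - sum b H \<in> nbhd0 n"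
    by (rule ser_sumsE[OF assms(2), of n]) (rule that, assumption, blast)
  have "f - g - (\<Sum>j\<in>H. a j - b j) \<in> nbhd0 n" if "finite H" "F \<union> G \<subseteq> H" for H
    using nbhd0_diff[OF F(2) G(2), of H H] that by (simp add: sum_subtractf algebra_simps)
  with F(1) G(1) show "\<exists>F0. finite F0 \<and> (\<forall>H. finite H \<and> F0 \<subseteq> H \<longrightarrow> f - g - (\<Sum>j\<in>H. a j - b j) \<in> nbhd0 n)"
    by (intro exI[of _ "F \<union> G"]) blast
qed

lemma ser_sums_add:
  assumes "ser_sums a f" "ser_sums b g" shows "ser_sums (\<lambda>j. a j + b j) (f + g)"
  using ser_sums_diff[OF assms(1) ser_sums_diff[OF ser_sums_0 assms(2)]] by simp

lemma ser_sums_sum: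
  assumes "\<And>i. i \<in> A \<Longrightarrow> ser_sums (a i) (f i)"
  shows "ser_sums (\<lambda>j. \<Sum>i\<in>A. a i j) (\<Sum>i\<in>A. f i)"
  using assms by (induction A rule: infinite_finite_induct) (auto intro: ser_sums_0 ser_sums_add)

text \<open>Reindexing along an injection that misses only zero terms. It carries all index shifts
  below: in the geometric series, under multiplication by a variable, and in differentiated
  expansions and exponentials.\<close>

lemma ser_sums_inj:
  assumes "inj r" "\<And>j. j \<notin> range r \<Longrightarrow> a j = 0"
  shows "ser_sums (\<lambda>i. a (r i)) f \<longleftrightarrow> ser_sums a f"
proof
  have s: "sum a (r ` H) = (\<Sum>i\<in>H. a (r i))" for H
    by (subst sum.reindex) (use assms(1) in \<open>auto simp: inj_on_def inj_def\<close>)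
  show "ser_sums (\<lambda>i. a (r i)) f" if f: "ser_sums a f"
    unfolding ser_sums_def
  proof
    fix n
    obtain F where F: "finite F" "\<And>H. finite H \<Longrightarrow> F \<subseteq> H \<Longrightarrow> f - sum a H \<in> nbhd0 n"
      by (rule ser_sumsE[OF f, of n]) (rule that, assumption, blast)
    have "f - (\<Sum>i\<in>H. a (r i)) \<in> nbhd0 n" if H: "finite H" "r -` F \<subseteq> H" for H
    proof -
      have "a i = 0" if "i \<in> F" "i \<notin> r ` H" for i
        using that H(2) assms(2)[of i] by (cases "i \<in> range r") auto
      then have "sum a (r ` H \<union> F) = sum a (r ` H)"
        using H(1) F(1) by (intro sum.mono_neutral_right) auto
      then show ?thesis using F(2)[of "r ` H \<union> F"] H F(1) by (simp add: s)
    qed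
    moreover have "finite (r -` F)" using F(1) assms(1) by (rule finite_vimageI)
    ultimately show "\<exists>F0. finite F0 \<and> (\<forall>H. finite H \<and> F0 \<subseteq> H \<longrightarrow> f - (\<Sum>i\<in>H. a (r i)) \<in> nbhd0 n)"
      by blast
  qed
  show "ser_sums a f" if f: "ser_sums (\<lambda>i. a (r i)) f"
    unfolding ser_sums_def
  proof
    fix n
    obtain F where F: "finite F" "\<And>H. finite H \<Longrightarrow> F \<subseteq> H \<Longrightarrow> f - (\<Sum>i\<in>H. a (r i)) \<in> nbhd0 n"
      by (rule ser_sumsE[OF f, of n]) (rule that, assumption, blast)
    have "f - sum a H \<in> nbhd0 n" if H: "finite H" "r ` F \<subseteq> H" for H
    proof -
      have "finite (r -` H)" using H(1) assms(1) by (rule finite_vimageI)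
      moreover have "F \<subseteq> r -` H" using H by blast
      ultimately have "f - (\<Sum>i\<in>r -` H. a (r i)) \<in> nbhd0 n" by (rule F(2))
      moreover have "sum a H = sum a (r ` (r -` H))"
        by (rule sum.mono_neutral_right) (use H assms(2) in auto)
      ultimately show ?thesis by (simp only: s)
    qed
    with F(1) show "\<exists>F0. finite F0 \<and> (\<forall>H. finite H \<and> F0 \<subseteq> H \<longrightarrow> f - sum a H \<in> nbhd0 n)"
      by (intro exI[of _ "r ` F"]) blast
  qed
qed

lemma ser_sums_single: "ser_sums (\<lambda>j. if j = j0 then x else 0) x"
  unfolding ser_sums_def
  by (intro allI exI[of _ "{j0}"]) (auto simp: sum.delta)

lemma ser_sums_closed:
  assumes "ser_sums a f" "\<And>j. a j \<in> nbhd0 n" shows "f \<in> nbhd0 n"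
proof -
  obtain F where F: "finite F" "f - sum a F \<in> nbhd0 n"
    by (rule ser_sumsE[OF assms(1), of n]) auto
  have "(f - sum a F) + sum a F \<in> nbhd0 n"
    by (intro nbhd0_add nbhd0_sum F assms(2))
  then show ?thesis by simp
qed

text \<open>Coefficients depend continuously on the series, so the base rings, which are cut out by
  vanishing coefficients, are closed under infinite sums.\<close>

lemma ser_sums_coeff_0:
  assumes "ser_sums a f" "\<And>j. coeff (a j) e k = 0" shows "coeff f e k = 0"
proof -
  have "absK (coeff f e k) \<le> r" if r: "0 < r" for r
  proof -
    obtain n :: nat where n: "- ln r \<le> real n" using real_arch_simple by blast
    define m where "m = max n (edeg e)"
    obtain F where F: "finite F" "f - sum a F \<in> nbhd0 m"
      by (rule ser_sumsE[OF assms(1), of m]) auto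
    have "absK (coeff (f - sum a F) e k) \<le> exp (- real m)"
      using F(2) by (auto simp: nbhd0_iff m_def)
    then have "absK (coeff f e k) \<le> exp (- real m)" by (simp add: coeff_sum assms(2))
    also have "\<dots> \<le> exp (ln r)" using n by (simp add: m_def del: exp_ln_iff exp_ln)
    finally show ?thesis using r by simp
  qed
  then have "absK (coeff f e k) \<le> 0" by (rule field_le_epsilon[where y = 0, simplified])
  then show ?thesis using absK_nonneg[of "coeff f e k"] absK_eq_0[of "coeff f e k"] by simp
qed

lemma ser_sums_mem:
  fixes f :: "('q::finite, 's::finite, 'k::complete_valuation_domain) ser"
  assumes "ser_sums a f"
  shows "(\<And>j. a j \<in> ringOBh) \<Longrightarrow> f \<in> ringOBh" "(\<And>j. a j \<in> ringOB) \<Longrightarrow> f \<in> ringOB" "(\<And>j. a j \<in> t_free) \<Longrightarrow> f \<in> t_free"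
proof -
  note * = ser_sums_coeff_0[OF assms]
  show "f \<in> ringOBh" if "\<And>j. a j \<in> ringOBh"
    using that by (auto simp: ringOBh_def intro!: *)
  show "f \<in> ringOB" if "\<And>j. a j \<in> ringOB"
    using that by (auto simp: ringOB_def intro!: *)
  have t: "f \<in> t_free \<longleftrightarrow> (\<forall>e k. (\<exists>i. e (Inr i) \<noteq> 0) \<longrightarrow> coeff f e k = 0)" for f :: "('q, 's, 'k) ser"
    by (auto simp: t_free_def coeff_def intro!: hcoeff_inject_ext)
  show "f \<in> t_free" if "\<And>j. a j \<in> t_free"
    using that unfolding t by (auto intro!: *)
qed

text \<open>A null family has a sum because \<open>K\<close> is complete: sum each coefficient in
  \<open>K\<close>. The work lies in showing that, for a fixed exponent e, the results again form an
  element of \<open>K{\<hbar>,\<hbar>\<^sup>-\<^sup>1}}\<close>.\<close>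

lemma ser_sums_exists:
  fixes a :: "'j \<Rightarrow> ('q::finite, 's::finite, 'k::complete_valuation_domain) ser"
  assumes null: "\<And>n. finite {j. a j \<notin> nbhd0 n}"
  obtains f where "ser_sums a f"
proof -
  \<comment> \<open>The bound holds for all k at once: outside a finite set of indices j no power of
    \<hbar> has a coefficient above r. Finitely many j then decide both the decay and the
    boundedness of the sum.\<close>
  have small: "finite {j. \<exists>k. absK (coeff (a j) e k) > r}" if r: "r > 0" for e r
  proof -
    obtain n :: nat where n: "- ln r \<le> real n" using real_arch_simple by blast
    define m where "m = max n (edeg e)"
    have "exp (- real m) \<le> exp (ln r)" using n by (simp add: m_def del: exp_ln_iff exp_ln)
    then have m: "exp (- real m) \<le> r" using r by simp
    have "{j. \<exists>k. absK (coeff (a j) e k) > r} \<subseteq> {j. a j \<notin> nbhd0 m}"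
    proof safe
      fix j k assume r: "r < absK (coeff (a j) e k)" and "a j \<in> nbhd0 m"
      then have "absK (coeff (a j) e k) \<le> exp (- real m)" by (auto simp: nbhd0_iff m_def)
      then show False using r m by simp
    qed
    then show ?thesis by (rule finite_subset[OF _ null])
  qed
  have summ: "(\<lambda>j. coeff (a j) e k) summable_on A" for e k A
  proof (rule summable_on_vK)
    fix r :: real assume "r > 0"
    then show "finite {j \<in> A. absK (coeff (a j) e k) > r}"
      by (rule finite_subset[rotated, OF small[of r e]]) auto
  qed
  define c where "c e k = (\<Sum>\<^sub>\<infinity>j. coeff (a j) e k)" for e k
  have c: "(\<forall>r>0. \<exists>N. \<forall>n\<ge>N. absK (c e n) < r) \<and> (\<exists>B>0. \<forall>n. absK (c e n) \<le> B)" for e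
  proof (intro conjI allI impI)
    fix r :: real assume r: "r > 0"
    let ?J = "{j. \<exists>k. absK (coeff (a j) e k) > r / 2}"
    have fin: "finite ?J" using r by (intro small) simp
    have "\<exists>N. \<forall>n\<ge>N. absK (coeff (a j) e n) < r / 2" for j
      using hcoeff_small[of "r / 2" "mcoeff (a j) e"] r unfolding coeff_def by (metis half_gt_zero)
    then obtain N where N: "\<And>j n. n \<ge> N j \<Longrightarrow> absK (coeff (a j) e n) < r / 2" by metis
    define M where "M = Max (insert 0 (N ` ?J))"
    have "absK (c e n) \<le> r / 2" if n: "n \<ge> M" for n
      unfolding c_def
    proof (rule absK_infsum_le)
      fix j
      show "absK (coeff (a j) e n) \<le> r / 2"
      proof (cases "j \<in> ?J")
        case True
        then have "N j \<le> M" unfolding M_def using fin by (intro Max_ge) auto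
        then show ?thesis using N[of j n] n by simp
      next
        case False
        then show ?thesis using not_less by blast
      qed
    qed (use r in simp)
    then have "absK (c e n) < r" if "n \<ge> M" for n
      using that r by fastforce
    then show "\<exists>N. \<forall>n\<ge>N. absK (c e n) < r" by blast
  next
    let ?J = "{j. \<exists>k. absK (coeff (a j) e k) > 1}"
    have fin: "finite ?J" by (intro small) simp
    have "\<exists>B. \<forall>k. absK (coeff (a j) e k) \<le> B" for j
      using hcoeff_bounded[of "mcoeff (a j) e"] unfolding coeff_def by blast
    then obtain B where B: "\<And>j k. absK (coeff (a j) e k) \<le> B j" by metis
    define C where "C = Max (insert 1 (B ` ?J))"
    have C1: "1 \<le> C" unfolding C_def using fin by (intro Max_ge) auto
    have "absK (c e n) \<le> C" for n
      unfolding c_def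
    proof (rule absK_infsum_le)
      fix j
      show "absK (coeff (a j) e n) \<le> C"
      proof (cases "j \<in> ?J")
        case True
        then have "B j \<le> C" unfolding C_def using fin by (intro Max_ge) auto
        then show ?thesis using B[of j n] by simp
      next
        case False
        then have "absK (coeff (a j) e n) \<le> 1" using not_less by blast
        then show ?thesis using C1 by simp
      qed
    qed (use C1 in simp)
    then show "\<exists>B>0. \<forall>n. absK (c e n) \<le> B" using C1 by (intro exI[of _ C]) auto
  qed
  define f where "f = Abs_mps (\<lambda>e. Abs_hseries (c e))"
  have f: "coeff f e k = c e k" for e k
    using c[of e, folded hseries_iff] by (simp add: f_def coeff_def Abs_hseries_inverse)
  have "ser_sums a f"
    unfolding ser_sums_def
  proof
    fix n
    let ?F = "{j. a j \<notin> nbhd0 n}"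
    have "f - sum a H \<in> nbhd0 n" if H: "finite H" "?F \<subseteq> H" for H
      unfolding nbhd0_iff
    proof (intro allI impI)
      fix e :: "'q + 's \<Rightarrow> nat" and k assume e: "edeg e \<le> n"
      have "c e k = (\<Sum>\<^sub>\<infinity>j\<in>H \<union> - H. coeff (a j) e k)" by (simp add: c_def)
      also have "\<dots> = (\<Sum>\<^sub>\<infinity>j\<in>H. coeff (a j) e k) + (\<Sum>\<^sub>\<infinity>j\<in>- H. coeff (a j) e k)"
        by (rule infsum_Un_disjoint) (auto intro: summ)
      finally have "coeff (f - sum a H) e k = (\<Sum>\<^sub>\<infinity>j\<in>- H. coeff (a j) e k)"
        using H(1) by (simp add: f coeff_sum)
      also have "absK \<dots> \<le> exp (- real n)"
      proof (rule absK_infsum_le)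
        fix j assume "j \<in> - H"
        then have "a j \<in> nbhd0 n" using H(2) by blast
        then show "absK (coeff (a j) e k) \<le> exp (- real n)" using e by (auto simp: nbhd0_iff)
      qed simp
      finally show "absK (coeff (f - sum a H) e k) \<le> exp (- real n)" .
    qed
    with null[of n] show "\<exists>F0. finite F0 \<and> (\<forall>H. finite H \<and> F0 \<subseteq> H \<longrightarrow> f - sum a H \<in> nbhd0 n)"
      by blast
  qed
  then show thesis by (rule that)
qed

text \<open>\<open>nbhd0 n\<close> itself is not an ideal if \<open>K\<close> has elements of negative valuation.\<close>
definition nideal :: "nat \<Rightarrow> ('q::finite, 's::finite, 'k::complete_valuation_domain) ser set" where
  "nideal n = {f. \<forall>g. g * f \<in> nbhd0 n}"

lemma nideal_add: "f \<in> nideal n \<Longrightarrow> g \<in> nideal n \<Longrightarrow> f + g \<in> nideal n"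
  by (auto simp: nideal_def distrib_left intro: nbhd0_add)

lemma nideal_0 [simp]: "0 \<in> nideal n"
  by (simp add: nideal_def)

lemma nideal_mult: "f \<in> nideal n \<Longrightarrow> g * f \<in> nideal n"
  by (auto simp: nideal_def mult.assoc[symmetric])

lemma nideal_mult2: "f \<in> nideal n \<Longrightarrow> f * g \<in> nideal n"
  using nideal_mult[of f n g] by (simp add: mult.commute)

lemma nideal_sum: "(\<And>i. i \<in> A \<Longrightarrow> f i \<in> nideal n) \<Longrightarrow> sum f A \<in> nideal n"
  by (induction A rule: infinite_finite_induct) (auto intro: nideal_add)

lemma nideal_nbhd0: "f \<in> nideal n \<Longrightarrow> f \<in> nbhd0 n"
  using mult_1[of f] unfolding nideal_def by (metis (mono_tags, lifting) mem_Collect_eq)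

text \<open>Powers are required to enter \<open>nideal n\<close> and not just
  \<open>nbhd0 n\<close>; the property then passes to all multiples, in particular to the product
  with 1/\<hbar>.\<close>

definition topnil :: "('q::finite, 's::finite, 'k::complete_valuation_domain) ser \<Rightarrow> bool" where
  "topnil x \<longleftrightarrow> (\<forall>n. \<exists>k. x ^ k \<in> nideal n)"

lemma topnil_power:
  assumes "topnil x" obtains K where "\<And>k. k \<ge> K \<Longrightarrow> x ^ k \<in> nideal n"
proof -
  obtain K where "x ^ K \<in> nideal n" using assms by (auto simp: topnil_def)
  then have "x ^ k \<in> nideal n" if "k \<ge> K" for k
    using nideal_mult[of "x ^ K" n "x ^ (k - K)"] that by (simp add: power_add[symmetric])
  then show thesis by (rule that)
qed

text \<open>In each binomial term of total exponent K + M, one of the two factors already has a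
  sufficiently high power.\<close>

lemma topnil_add:
  assumes "topnil x" "topnil y" shows "topnil (x + y)"
  unfolding topnil_def
proof
  fix n
  obtain K where K: "\<And>k. k \<ge> K \<Longrightarrow> x ^ k \<in> nideal n" using topnil_power[OF assms(1)] by blast
  obtain M where M: "\<And>k. k \<ge> M \<Longrightarrow> y ^ k \<in> nideal n" using topnil_power[OF assms(2)] by blast
  have "(x + y) ^ (K + M) \<in> nideal n"
    unfolding binomial_ring
  proof (rule nideal_sum)
    fix k
    consider "k \<ge> K" | "K + M - k \<ge> M" by linarith
    then show "of_nat ((K + M) choose k) * x ^ k * y ^ (K + M - k) \<in> nideal n"
      by cases (auto intro: nideal_mult2[OF nideal_mult[OF K]] nideal_mult[OF M])
  qed
  then show "\<exists>k. (x + y) ^ k \<in> nideal n" ..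
qed

lemma topnil_mult: "topnil x \<Longrightarrow> topnil (c * x)"
  unfolding topnil_def power_mult_distrib by (blast intro: nideal_mult)

lemma coeff_mult_order:
  assumes "\<And>d k. edeg d < m \<Longrightarrow> coeff f d k = 0" "\<And>d k. edeg d < n \<Longrightarrow> coeff g d k = 0" "edeg e < m + n"
  shows "coeff (f * g) e k = 0"
  unfolding coeff_def times_mps.rep_eq hcoeff_sum
proof (rule sum.neutral, safe)
  fix d assume d: "d \<le> e"
  have "edeg d + edeg (e - d) = edeg e"
    unfolding edeg_def sum.distrib[symmetric] using d by (intro sum.cong) (auto simp: le_fun_def)
  then have "edeg d < m \<or> edeg (e - d) < n" using assms(3) by linarith
  then have "mcoeff f d = 0 \<or> mcoeff g (e - d) = 0"
    using assms(1,2)[unfolded coeff_def] by (auto intro: hcoeff_inject_ext)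
  then show "hcoeff (mcoeff f d * mcoeff g (e - d)) k = 0" by auto
qed

lemma edeg_eq_0: "edeg e = 0 \<longleftrightarrow> e = (\<lambda>_. 0)"
  by (auto simp: edeg_def)

text \<open>The power with exponent n + 1 has no terms of degree at most n, and neither do its
  multiples, whatever their valuations are.\<close>

lemma topnil_no_const:
  assumes "mcoeff x (\<lambda>_. 0) = 0" shows "topnil x"
  unfolding topnil_def
proof
  fix n
  have "edeg d < m \<Longrightarrow> coeff (x ^ m) d k = 0" for m d k
  proof (induction m arbitrary: d k)
    case (Suc m)
    have "coeff (x * x ^ m) d k = 0"
      by (rule coeff_mult_order[where m = 1 and n = m])
        (use assms Suc in \<open>auto simp: edeg_eq_0 coeff_def\<close>)
    then show ?case by simp
  qed simp
  then have "coeff (g * x ^ Suc n) d k = 0" if "edeg d \<le> n" for g d k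
    by (intro coeff_mult_order[where m = 0 and n = "Suc n"]) (use that in \<open>auto simp del: power_Suc\<close>)
  then have "x ^ Suc n \<in> nideal n" by (auto simp: nideal_def nbhd0_iff)
  then show "\<exists>k. x ^ k \<in> nideal n" ..
qed

lemma absK_le_1: "(\<forall>x::'k::complete_valuation_domain. 0 \<le> vK x) \<Longrightarrow> absK (x::'k) \<le> 1"
  using absK_le_vK[of x 0] by (simp add: zero_ereal_def)

lemma absK_power: "absK (x ^ n) = absK x ^ n"
  by (induction n) (simp_all add: absK_mult)

lemma sconst_power: "(sconst c :: ('q::finite, 's::finite, 'k::complete_valuation_domain) ser) ^ n = sconst (c ^ n)"
  by (induction n) (simp_all add: sconst_simps)

lemma mK_absK: "c \<in> mK \<Longrightarrow> c = 0 \<or> (\<forall>x::'k::complete_valuation_domain. 0 \<le> vK x) \<and> absK (c::'k) < 1"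
proof (cases "c = 0")
  case False
  assume c: "c \<in> mK"
  then have *: "\<forall>x::'k. 0 \<le> vK x" "0 < vK c" using False by (auto simp: mK_def split: if_splits)
  obtain r where "vK c = ereal r" using vK_realE[OF False] .
  then show ?thesis using * False by (simp add: absK_vK)
qed simp

text \<open>This is what the case distinction in \<open>mK\<close> achieves. If all valuations are
  nonnegative, the coefficients of g have absolute value at most 1 and powers of c make every
  multiple small; otherwise c = 0.\<close>

lemma topnil_sconst:
  assumes "c \<in> mK" shows "topnil (sconst c :: ('q::finite, 's::finite, 'k::complete_valuation_domain) ser)"
proof (cases "c = 0")
  case True
  then show ?thesis by (intro topnil_no_const) (simp add: sconst_simps)
next
  case False
  then have v: "\<forall>x::'k. 0 \<le> vK x" and c: "absK c < 1" using mK_absK[OF assms] by auto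
  show ?thesis
    unfolding topnil_def
  proof
    fix n
    obtain m where m: "absK c ^ m < exp (- real n)" using real_arch_pow_inv[OF _ c] by force
    have "g * sconst (c ^ m) \<in> nbhd0 n" for g :: "('q, 's, 'k) ser"
      unfolding nbhd0_iff
    proof (intro allI impI)
      fix e k
      have "absK (coeff (g * sconst (c ^ m)) e k) = absK c ^ m * absK (coeff g e k)"
        by (simp add: mult.commute[of g] absK_mult absK_power)
      also have "\<dots> \<le> absK c ^ m * 1" by (intro mult_left_mono absK_le_1[OF v]) simp
      finally show "absK (coeff (g * sconst (c ^ m)) e k) \<le> exp (- real n)" using m by simp
    qed
    then have "sconst c ^ m \<in> (nideal n :: ('q, 's, 'k) ser set)" by (simp add: nideal_def sconst_power)
    then show "\<exists>k. sconst c ^ k \<in> (nideal n :: ('q, 's, 'k) ser set)" ..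
  qed
qed

lemma topnil_ringOB:
  assumes "x \<in> ringOB" "coeff x (\<lambda>_. 0) 0 \<in> mK"
  shows "topnil (x :: ('q::finite, 's::finite, 'k::complete_valuation_domain) ser)"
proof -
  let ?c = "sconst (coeff x (\<lambda>_. 0) 0)"
  have "mcoeff (x - ?c) (\<lambda>_. 0) = 0"
  proof (rule hcoeff_inject_ext)
    fix k
    have "k \<noteq> 0 \<Longrightarrow> coeff x (\<lambda>_. 0) k = 0" using assms(1) by (simp add: ringOB_def)
    then have "coeff (x - ?c) (\<lambda>_. 0) k = 0" by (cases "k = 0") (simp_all add: coeff_sconst)
    then show "hcoeff (mcoeff (x - ?c) (\<lambda>_. 0)) k = hcoeff 0 k" unfolding coeff_def hcoeff_simps .
  qed
  then have "topnil (?c + (x - ?c))"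
    by (intro topnil_add topnil_sconst topnil_no_const assms)
  then show ?thesis by simp
qed

lemma topnil_geometric:
  assumes "topnil x" obtains y where "(1 - x) * y = 1"
proof -
  have "finite {k. x ^ k \<notin> nbhd0 n}" for n
  proof -
    obtain K where K: "\<And>k. k \<ge> K \<Longrightarrow> x ^ k \<in> nideal n" using topnil_power[OF assms] by blast
    have "{k. x ^ k \<notin> nbhd0 n} \<subseteq> {..<K}"
      using K nideal_nbhd0 not_le by blast
    then show ?thesis by (rule finite_subset) simp
  qed
  then obtain y where y: "ser_sums (\<lambda>k. x ^ k) y" by (rule ser_sums_exists)
  \<comment> \<open>The series x + x^2 + ..., indexed so that it can be subtracted termwise from the
    geometric series; the entry 0 at index 0 leaves the term 1 there.\<close>
  let ?b = "\<lambda>k. if k = 0 then 0 else x ^ k"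
  have z: "?b j = 0" if "j \<notin> range Suc" for j
    using that by (cases j) auto
  have m: "ser_sums (\<lambda>k. ?b (Suc k)) (x * y)"
    using ser_sums_mult[OF y, of x] by simp
  have "ser_sums ?b (x * y)"
    by (rule iffD1[OF ser_sums_inj[OF inj_Suc, of ?b], OF z m])
  from ser_sums_diff[OF y this] have "ser_sums (\<lambda>k::nat. if k = 0 then 1 else 0) (y - x * y)"
    by (rule back_subst[where P = "\<lambda>a. ser_sums a _"]) (auto simp: fun_eq_iff)
  then have "y - x * y = 1" by (rule ser_sums_unique) (rule ser_sums_single)
  then show thesis using that[of y] by (simp add: algebra_simps)
qed

text \<open>The n-th power of the ideal generated by the tuple x, presented through monomials of
  degree n. It will contain the entries of the n-th power of a matrix with entries in that
  ideal.\<close>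

inductive_set idpow :: "('s \<Rightarrow> ('q::finite, 's::finite, 'k::complete_valuation_domain) ser) \<Rightarrow> nat \<Rightarrow> ('q, 's, 'k) ser set"
  for x :: "'s \<Rightarrow> ('q::finite, 's::finite, 'k::complete_valuation_domain) ser" and n :: nat where
  zero: "0 \<in> idpow x n"
| add: "f \<in> idpow x n \<Longrightarrow> edeg m = n \<Longrightarrow> g * tuple_power x m + f \<in> idpow x n"

lemma idpow_add: "f \<in> idpow x n \<Longrightarrow> g \<in> idpow x n \<Longrightarrow> f + g \<in> idpow x n"
  by (induction rule: idpow.induct) (auto simp: add.assoc intro: idpow.add)

lemma idpow_sum: "(\<And>i. i \<in> A \<Longrightarrow> f i \<in> idpow x n) \<Longrightarrow> sum f A \<in> idpow x n"
  by (induction A rule: infinite_finite_induct) (auto intro: idpow.zero idpow_add)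

lemma idpow_mult: "f \<in> idpow x n \<Longrightarrow> c * f \<in> idpow x n"
  by (induction rule: idpow.induct) (auto simp: distrib_left mult.assoc[symmetric] intro: idpow.zero idpow.add)

lemma tuple_power_Suc: "x i * tuple_power x m = tuple_power x (m(i := Suc (m i)))"
  by (simp add: tuple_power_def prod.remove[of UNIV i] mult_ac)

lemma tuple_power_0 [simp]: "tuple_power x (\<lambda>_. 0) = 1"
  by (simp add: tuple_power_def)

lemma edeg_Suc: "edeg (m(i := Suc (m i))) = Suc (edeg m)"
  by (simp add: edeg_def sum.remove[of UNIV i])

lemma idpow_Suc: "f \<in> idpow x n \<Longrightarrow> x i * f \<in> idpow x (Suc n)"
proof (induction rule: idpow.induct)
  case (add f m g)
  have "x i * (g * tuple_power x m + f) = g * tuple_power x (m(i := Suc (m i))) + x i * f"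
    by (simp add: tuple_power_Suc[symmetric] algebra_simps)
  then show ?case using add by (auto simp: edeg_Suc intro: idpow.add)
qed (auto intro: idpow.zero)

lemma idpow_1: "1 \<in> idpow x 0"
  using idpow.add[OF idpow.zero, of "\<lambda>_. 0" 0 1 x] by (simp add: edeg_eq_0)

text \<open>Pigeonhole: a monomial whose degree exceeds the sum of the thresholds \<open>K i\<close>
  has some exponent \<open>m i\<close> at least \<open>K i\<close>; the other factors do no harm in
  an ideal.\<close>

lemma tuple_power_nideal:
  fixes x :: "'s::finite \<Rightarrow> ('q::finite, 's, 'k::complete_valuation_domain) ser"
  assumes "\<And>i. topnil (x i)"
  shows "\<exists>K. \<forall>m. edeg m \<ge> K \<longrightarrow> tuple_power x m \<in> nideal n"
proof -
  have "\<exists>K. \<forall>k\<ge>K. x i ^ k \<in> nideal n" for i using topnil_power[OF assms] by metis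
  then obtain K where K: "\<And>i k. k \<ge> K i \<Longrightarrow> x i ^ k \<in> nideal n" by metis
  have "tuple_power x m \<in> nideal n" if m: "edeg m \<ge> Suc (sum K UNIV)" for m
  proof -
    have "\<exists>i. K i \<le> m i"
    proof (rule ccontr)
      assume "\<not> (\<exists>i. K i \<le> m i)"
      then have "\<And>i. m i \<le> K i" by (metis nat_le_linear)
      then have "edeg m \<le> sum K UNIV" unfolding edeg_def by (intro sum_mono)
      then show False using m by simp
    qed
    then obtain i where i: "K i \<le> m i" ..
    have "tuple_power x m = x i ^ m i * (\<Prod>j\<in>UNIV - {i}. x j ^ m j)"
      by (simp add: tuple_power_def prod.remove[of UNIV i])
    then show ?thesis using nideal_mult2[OF K[OF i]] by simp
  qed
  then show ?thesis by blast
qed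

lemma idpow_nideal:
  fixes x :: "'s::finite \<Rightarrow> ('q::finite, 's, 'k::complete_valuation_domain) ser"
  assumes "\<And>i. topnil (x i)"
  shows "\<exists>K. \<forall>k\<ge>K. idpow x k \<subseteq> nideal n"
proof -
  obtain K where K: "\<forall>m. edeg m \<ge> K \<longrightarrow> tuple_power x m \<in> nideal n"
    using tuple_power_nideal[OF assms] ..
  have "f \<in> nideal n" if "f \<in> idpow x k" "k \<ge> K" for f k
    using that K by (induction rule: idpow.induct) (auto intro!: nideal_add nideal_mult)
  then show ?thesis by blast
qed

section \<open>Evaluation at points of the base\<close>

lemma nbhd0_commute: "f - g \<in> nbhd0 n \<Longrightarrow> g - f \<in> nbhd0 n"
  using nbhd0_minus[of "f - g" n] by simp

lemma exponent_induct [case_names zero Suc]: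
  fixes m :: "'i::finite \<Rightarrow> nat"
  assumes zero: "P (\<lambda>_. 0)" and Suc: "\<And>m i. P m \<Longrightarrow> P (m(i := Suc (m i)))"
  shows "P m"
proof (induction "edeg m" arbitrary: m)
  case 0
  then have "m = (\<lambda>_. 0)" using edeg_eq_0[of m] by simp
  then show ?case using zero by blast
next
  case (Suc n)
  then have "m \<noteq> (\<lambda>_. 0)" using edeg_eq_0[of m] by auto
  then obtain i where i: "m i \<noteq> 0" by auto
  let ?m = "m(i := m i - 1)"
  have m: "m = ?m(i := Suc (?m i))" using i by auto
  then have "edeg m = Suc (edeg ?m)" using edeg_Suc[of ?m i] by simp
  then have "P ?m" using Suc.hyps by (intro Suc.hyps(1)) simp
  then have "P (?m(i := Suc (?m i)))" by (rule assms(2))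
  then show ?case by (subst m)
qed

section \<open>Expansion in powers of t with t-free coefficients\<close>

lemma mcoeff_t_coeff:
  "mcoeff (t_coeff m f) e = (if \<forall>i. e (Inr i) = 0 then mcoeff f (case_sum (\<lambda>a. e (Inl a)) m) else 0)"
  by (simp add: t_coeff_def)

lemma t_coeff_mem:
  "t_coeff m f \<in> t_free" "f \<in> ringOBh \<Longrightarrow> t_coeff m f \<in> ringOBh" "f \<in> ringOB \<Longrightarrow> t_coeff m f \<in> ringOB"
  by (auto simp: t_free_def ringOBh_iff ringOB_iff mcoeff_t_coeff hpos_def hzero_def)

lemma t_coeff_diff [simp]: "t_coeff m (f - g) = t_coeff m f - t_coeff m g"
  by (rule mps_eqI) (simp add: mcoeff_t_coeff)

lemma t_coeff_mult:
  fixes f :: "('q::finite, 's::finite, 'k::complete_valuation_domain) ser"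
  assumes c: "c \<in> t_free" shows "t_coeff m (c * f) = c * t_coeff m f"
proof (rule mps_eqI)
  fix e :: "'q + 's \<Rightarrow> nat"
  show "mcoeff (t_coeff m (c * f)) e = mcoeff (c * t_coeff m f) e"
  proof (cases "\<forall>i. e (Inr i) = 0")
    case True
    let ?e = "case_sum (\<lambda>a. e (Inl a)) m"
    have le: "d \<le> e \<longleftrightarrow> d \<le> ?e \<and> (\<forall>i. d (Inr i) = 0)" for d
      using True by (auto simp: le_fun_def split_sum_all)
    have "mcoeff (t_coeff m (c * f)) e = (\<Sum>d | d \<le> ?e. mcoeff c d * mcoeff f (?e - d))"
      using True by (simp add: mcoeff_t_coeff times_mps.rep_eq)
    also have "\<dots> = (\<Sum>d | d \<le> e. mcoeff c d * mcoeff (t_coeff m f) (e - d))"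
    proof (rule sum.mono_neutral_cong_right[OF finite_exponents_le])
      show "{d. d \<le> e} \<subseteq> {d. d \<le> ?e}" using le by auto
      show "\<forall>d\<in>{d. d \<le> ?e} - {d. d \<le> e}. mcoeff c d * mcoeff f (?e - d) = 0"
        using c le by (auto simp: t_free_def)
      fix d assume "d \<in> {d. d \<le> e}"
      then have d: "\<And>i. d (Inr i) = 0" using le by auto
      then have "?e - d = case_sum (\<lambda>a. (e - d) (Inl a)) m"
        by (auto simp: fun_eq_iff split: sum.split)
      then show "mcoeff c d * mcoeff f (?e - d) = mcoeff c d * mcoeff (t_coeff m f) (e - d)"
        using True d by (simp add: mcoeff_t_coeff)
    qed
    finally show ?thesis by (simp add: times_mps.rep_eq)
  next
    case False
    then have "mcoeff g e = 0" if "g \<in> t_free" for g :: "('q, 's, 'k) ser"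
      using that by (auto simp: t_free_def)
    then show ?thesis using c t_free_mult t_coeff_mem(1) by metis
  qed
qed

lemma t_coeff_tvar_mult:
  fixes f :: "('q::finite, 's::finite, 'k::complete_valuation_domain) ser"
  shows "t_coeff m (tvar i * f) = (if m i = 0 then 0 else t_coeff (m(i := m i - 1)) f)"
proof (rule mps_eqI)
  fix e :: "'q + 's \<Rightarrow> nat"
  have "(case_sum (\<lambda>a. e (Inl a)) m)(Inr i := m i - 1) = case_sum (\<lambda>a. e (Inl a)) (m(i := m i - 1))"
    by (auto simp: fun_eq_iff split: sum.split)
  then show "mcoeff (t_coeff m (tvar i * f)) e = mcoeff (if m i = 0 then 0 else t_coeff (m(i := m i - 1)) f) e"
    by (auto simp: mcoeff_t_coeff mcoeff_mvar_mult)
qed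

lemma t_coeff_t_free:
  fixes f :: "('q::finite, 's::finite, 'k::complete_valuation_domain) ser"
  assumes "f \<in> t_free" shows "t_coeff m f = (if m = (\<lambda>_. 0) then f else 0)"
proof (rule mps_eqI)
  fix e :: "'q + 's \<Rightarrow> nat"
  show "mcoeff (t_coeff m f) e = mcoeff (if m = (\<lambda>_. 0) then f else 0) e"
  proof (cases "m = (\<lambda>_. 0)")
    case True
    have "case_sum (\<lambda>a. e (Inl a)) (\<lambda>_. 0) = e" if "\<forall>i. e (Inr i) = 0"
      using that by (auto simp: fun_eq_iff split: sum.split)
    then show ?thesis using True assms by (auto simp: mcoeff_t_coeff t_free_def)
  next
    case False
    then obtain i where "m i \<noteq> 0" by auto
    then have "(case_sum (\<lambda>a. e (Inl a)) m) (Inr i) \<noteq> 0" by simp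
    then have "mcoeff f (case_sum (\<lambda>a. e (Inl a)) m) = 0"
      using assms unfolding t_free_def by blast
    then show ?thesis using False by (simp add: mcoeff_t_coeff)
  qed
qed

lemma at_Q0_t_coeff: "at_Q0 (t_coeff m f) = t_coeff m (at_Q0 f)"
  by (rule mps_eqI) (auto simp: at_Q0_def mcoeff_t_coeff)

lemma t_coeff_nbhd0:
  fixes f :: "('q::finite, 's::finite, 'k::complete_valuation_domain) ser"
  assumes "f \<in> nbhd0 (n + edeg m)" shows "t_coeff m f \<in> nbhd0 n"
  unfolding nbhd0_iff
proof (intro allI impI)
  fix e :: "'q + 's \<Rightarrow> nat" and k assume e: "edeg e \<le> n"
  show "absK (coeff (t_coeff m f) e k) \<le> exp (- real n)"
  proof (cases "\<forall>i. e (Inr i) = 0")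
    case True
    let ?e = "case_sum (\<lambda>a. e (Inl a)) m"
    have "edeg ?e = (\<Sum>a\<in>UNIV. e (Inl a)) + edeg m"
      unfolding edeg_def UNIV_sum by (subst sum.union_disjoint) (auto simp: sum.reindex inj_on_def)
    moreover have "edeg e = (\<Sum>a\<in>UNIV. e (Inl a)) + (\<Sum>i\<in>UNIV. e (Inr i))"
      unfolding edeg_def UNIV_sum by (subst sum.union_disjoint) (auto simp: sum.reindex inj_on_def)
    ultimately have "edeg ?e \<le> n + edeg m" using e by simp
    then have "absK (coeff f ?e k) \<le> exp (- real (n + edeg m))"
      using assms by (auto simp only: nbhd0_iff)
    also have "\<dots> \<le> exp (- real n)" by simp
    finally show ?thesis using True by (simp add: coeff_def mcoeff_t_coeff)
  qed (auto simp: coeff_def mcoeff_t_coeff)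
qed

lemma mcoeff_tuple_power_tvar_mult:
  fixes f :: "('q::finite, 's::finite, 'k::complete_valuation_domain) ser"
  shows "mcoeff (tuple_power tvar m * f) e =
    (if \<forall>i. m i \<le> e (Inr i) then mcoeff f (case_sum (\<lambda>a. e (Inl a)) (\<lambda>i. e (Inr i) - m i)) else 0)"
proof (induction m arbitrary: e rule: exponent_induct)
  case zero
  have "case_sum (\<lambda>a. e (Inl a)) (\<lambda>i. e (Inr i)) = e" by (auto simp: fun_eq_iff split: sum.split)
  then show ?case by simp
next
  case (Suc m i)
  let ?e = "e(Inr i := e (Inr i) - 1)"
  have "mcoeff (tuple_power tvar (m(i := Suc (m i))) * f) e =
      (if e (Inr i) = 0 then 0 else mcoeff (tuple_power tvar m * f) ?e)"
    by (simp add: tuple_power_Suc[symmetric] mult.assoc mcoeff_mvar_mult)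
  also have "\<dots> = (if \<forall>j. (m(i := Suc (m i))) j \<le> e (Inr j)
      then mcoeff f (case_sum (\<lambda>a. e (Inl a)) (\<lambda>j. e (Inr j) - (m(i := Suc (m i))) j)) else 0)"
  proof (cases "e (Inr i) = 0")
    case True
    then have "\<not> (m(i := Suc (m i))) i \<le> e (Inr i)" by simp
    then show ?thesis using True by (metis (no_types, lifting))
  next
    case False
    have 1: "(\<forall>j. m j \<le> ?e (Inr j)) \<longleftrightarrow> (\<forall>j. (m(i := Suc (m i))) j \<le> e (Inr j))"
      using False by (auto split: if_splits)
    have 2: "case_sum (\<lambda>a. ?e (Inl a)) (\<lambda>j. ?e (Inr j) - m j) =
        case_sum (\<lambda>a. e (Inl a)) (\<lambda>j. e (Inr j) - (m(i := Suc (m i))) j)"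
      by (auto simp: fun_eq_iff split: sum.split)
    show ?thesis unfolding Suc.IH 1 2 using False by simp
  qed
  finally show ?case .
qed

text \<open>Each exponent is hit by exactly one m, its own t-part. As soon as H contains all m of
  degree at most n, the difference therefore vanishes in degrees up to n.\<close>

lemma t_expansion:
  fixes f :: "('q::finite, 's::finite, 'k::complete_valuation_domain) ser"
  shows "ser_sums (\<lambda>m. t_coeff m f * tuple_power tvar m) f"
  unfolding ser_sums_def
proof
  fix n
  let ?F = "{m :: 's \<Rightarrow> nat. edeg m \<le> n}"
  have "f - (\<Sum>m\<in>H. t_coeff m f * tuple_power tvar m) \<in> nbhd0 n" if H: "finite H" "?F \<subseteq> H" for H
    unfolding nbhd0_iff
  proof (intro allI impI)
    fix e :: "'q + 's \<Rightarrow> nat" and k assume e: "edeg e \<le> n"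
    let ?m = "\<lambda>i. e (Inr i)"
    have eq: "case_sum (\<lambda>a. e (Inl a)) ?m = e" by (auto simp: fun_eq_iff split: sum.split)
    have "edeg ?m \<le> edeg e"
    proof -
      have "edeg e = (\<Sum>a\<in>UNIV. e (Inl a)) + (\<Sum>i\<in>UNIV. e (Inr i))"
        unfolding edeg_def UNIV_sum by (subst sum.union_disjoint) (auto simp: sum.reindex inj_on_def)
      then show ?thesis by (simp add: edeg_def)
    qed
    then have mH: "?m \<in> H" using H e by auto
    have "mcoeff (t_coeff m f * tuple_power tvar m) e = (if m = ?m then mcoeff f e else 0)" for m
    proof (cases "m = ?m")
      case True
      then show ?thesis by (simp add: mult.commute[of "t_coeff _ f"] mcoeff_tuple_power_tvar_mult mcoeff_t_coeff eq)
    next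
      case False
      then have "\<not> (\<forall>i. m i \<le> e (Inr i)) \<or> \<not> (\<forall>i. e (Inr i) - m i = 0)"
        by (auto simp: fun_eq_iff) (metis le_antisym)
      then show ?thesis using False
        by (auto simp: mult.commute[of "t_coeff m f"] mcoeff_tuple_power_tvar_mult mcoeff_t_coeff)
    qed
    then have "(\<Sum>m\<in>H. mcoeff (t_coeff m f * tuple_power tvar m) e) = mcoeff f e"
      using H(1) mH by (simp add: sum.delta')
    then have "coeff (f - (\<Sum>m\<in>H. t_coeff m f * tuple_power tvar m)) e k = 0"
      by (simp only: coeff_def mcoeff_simps mcoeff_sum) simp
    then show "absK (coeff (f - (\<Sum>m\<in>H. t_coeff m f * tuple_power tvar m)) e k) \<le> exp (- real n)" by simp
  qed
  then show "\<exists>F0. finite F0 \<and> (\<forall>F. finite F \<and> F0 \<subseteq> F \<longrightarrow> f - (\<Sum>m\<in>F. t_coeff m f * tuple_power tvar m) \<in> nbhd0 n)"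
    using finite_edeg_le[of n, where 'i = 's] by blast
qed

text \<open>Substitution of t-free, topologically nilpotent values for t. It uses only the values of
  a point on the variables, and so makes sense for all series, including those with negative powers
  of \<hbar>.\<close>

locale series_eval =
  fixes \<tau> :: "'s::finite \<Rightarrow> ('q::finite, 's, 'k::complete_valuation_domain) ser"
  assumes topnil: "topnil (\<tau> i)" and t_free: "\<tau> i \<in> t_free"
begin

definition ev :: "('q, 's, 'k) ser \<Rightarrow> ('q, 's, 'k) ser" where
  "ev f = (THE g. ser_sums (\<lambda>m. t_coeff m f * tuple_power \<tau> m) g)"

lemma ev_sums: "ser_sums (\<lambda>m. t_coeff m f * tuple_power \<tau> m) (ev f)"
proof -
  have "finite {m. t_coeff m f * tuple_power \<tau> m \<notin> nbhd0 n}" for n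
  proof -
    obtain K where K: "\<forall>m. edeg m \<ge> K \<longrightarrow> tuple_power \<tau> m \<in> nideal n"
      using tuple_power_nideal[OF topnil] ..
    have "{m. t_coeff m f * tuple_power \<tau> m \<notin> nbhd0 n} \<subseteq> {m. edeg m \<le> K}"
      using K by (auto dest: nideal_mult nideal_nbhd0 intro: nat_le_linear) (meson nat_le_linear nideal_mult nideal_nbhd0)
    then show ?thesis using finite_edeg_le by (rule finite_subset)
  qed
  then obtain g where g: "ser_sums (\<lambda>m. t_coeff m f * tuple_power \<tau> m) g" by (rule ser_sums_exists)
  then show ?thesis unfolding ev_def by (simp add: ser_sums_the)
qed

lemma ev_eqI: "ser_sums (\<lambda>m. t_coeff m f * tuple_power \<tau> m) g \<Longrightarrow> ev f = g"
  by (rule ser_sums_unique[OF ev_sums])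

lemma ser_cont_ev: "ser_cont ev"
proof (rule ser_contI)
  fix f g show "ev (f - g) = ev f - ev g"
    using ser_sums_diff[OF ev_sums[of f] ev_sums[of g]] by (intro ev_eqI) (simp add: left_diff_distrib)
next
  fix n
  \<comment> \<open>Monomials of degree at least K are small whatever their coefficient is; each of
    the finitely many others depends continuously on the series, with its own threshold
    \<open>M m\<close>.\<close>
  obtain K where K: "\<forall>m. edeg m \<ge> K \<longrightarrow> tuple_power \<tau> m \<in> nideal n"
    using tuple_power_nideal[OF topnil] ..
  have "\<exists>M. \<forall>x\<in>nbhd0 M. t_coeff m x * tuple_power \<tau> m \<in> nbhd0 n" for m
  proof -
    obtain M where M: "\<forall>x\<in>nbhd0 M. tuple_power \<tau> m * x \<in> nbhd0 n"
      using ser_cont_mult[of "tuple_power \<tau> m"] unfolding ser_cont_def by blast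
    have "t_coeff m x * tuple_power \<tau> m \<in> nbhd0 n" if "x \<in> nbhd0 (M + edeg m)" for x
      using M t_coeff_nbhd0[OF that] by (simp add: mult.commute)
    then show ?thesis by blast
  qed
  then obtain M where M: "\<And>m x. x \<in> nbhd0 (M m) \<Longrightarrow> t_coeff m x * tuple_power \<tau> m \<in> nbhd0 n" by metis
  define N where "N = Max (insert 0 (M ` {m. edeg m \<le> K}))"
  have "ev x \<in> nbhd0 n" if x: "x \<in> nbhd0 N" for x
  proof (rule ser_sums_closed[OF ev_sums])
    fix m
    show "t_coeff m x * tuple_power \<tau> m \<in> nbhd0 n"
    proof (cases "edeg m \<le> K")
      case True
      then have "M m \<le> N" unfolding N_def using finite_edeg_le[of K] by (intro Max_ge) auto
      then show ?thesis using x nbhd0_antimono M by blast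
    next
      case False
      then have "tuple_power \<tau> m \<in> nideal n" using K by simp
      then show ?thesis by (intro nideal_nbhd0 nideal_mult)
    qed
  qed
  then show "\<exists>m. \<forall>x\<in>nbhd0 m. ev x \<in> nbhd0 n" by blast
qed

lemmas ev_diff = ser_cont_diff[OF ser_cont_ev] and ev_0 = ser_cont_0[OF ser_cont_ev]
  and ev_add = ser_cont_add[OF ser_cont_ev] and ev_sum = ser_cont_sum[OF ser_cont_ev]
  and ev_ser_sums = ser_sums_cont[OF ser_cont_ev]

lemma ev_t_free: "f \<in> t_free \<Longrightarrow> ev f = f"
proof (rule ev_eqI)
  assume f: "f \<in> t_free"
  have "ser_sums (\<lambda>m. if m = (\<lambda>_. 0) then f else 0) f" by (rule ser_sums_single)
  then show "ser_sums (\<lambda>m. t_coeff m f * tuple_power \<tau> m) f"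
    by (rule back_subst[where P = "\<lambda>a. ser_sums a _"]) (intro ext, simp add: t_coeff_t_free[OF f])
qed

lemma ev_t_free_mult: "c \<in> t_free \<Longrightarrow> ev (c * f) = c * ev f"
  using ser_sums_mult[OF ev_sums[of f], of c] by (intro ev_eqI) (simp add: t_coeff_mult mult.assoc)

lemma ev_tvar_mult: "ev (tvar i * f) = \<tau> i * ev f"
proof (rule ev_eqI)
  let ?r = "\<lambda>m :: 's \<Rightarrow> nat. m(i := Suc (m i))"
  let ?a = "\<lambda>m. t_coeff m (tvar i * f) * tuple_power \<tau> m"
  have inj: "inj ?r"
    by (rule injI) (metis (mono_tags, lifting) fun_upd_idem_iff fun_upd_same fun_upd_upd nat.inject)
  have z: "?a m = 0" if "m \<notin> range ?r" for m
  proof -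
    have "m i = 0"
    proof (rule ccontr)
      assume "m i \<noteq> 0"
      then have "m = ?r (m(i := m i - 1))" by auto
      then show False using that by blast
    qed
    then show ?thesis by (simp add: t_coeff_tvar_mult)
  qed
  have "(\<lambda>m. \<tau> i * (t_coeff m f * tuple_power \<tau> m)) = (\<lambda>m. ?a (?r m))"
    by (intro ext) (simp add: t_coeff_tvar_mult fun_upd_idem tuple_power_Suc[symmetric] mult.left_commute del: fun_upd_apply, simp)
  then have s: "ser_sums (\<lambda>m. ?a (?r m)) (\<tau> i * ev f)"
    using ser_sums_mult[OF ev_sums[of f], of "\<tau> i"] by simp
  show "ser_sums ?a (\<tau> i * ev f)"
    by (rule iffD1[OF ser_sums_inj[OF inj, of ?a], OF z s])
qed

lemma ev_tuple_power_mult: "ev (tuple_power tvar m * f) = tuple_power \<tau> m * ev f"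
proof (induction m rule: exponent_induct)
  case (Suc m i)
  show ?case by (simp only: tuple_power_Suc[symmetric] mult.assoc ev_tvar_mult Suc)
qed simp

text \<open>Expand f and use continuity of \<open>ev\<close>: it suffices to treat one term
  \<open>t_coeff m f * tuple_power tvar m\<close>, from which both factors can be pulled out. This
  avoids rearranging a product of two infinite sums.\<close>

lemma ev_mult: "ev (f * g) = ev f * ev g"
proof -
  have "ser_sums (\<lambda>m. ev (g * (t_coeff m f * tuple_power tvar m))) (ev (g * f))"
    by (intro ev_ser_sums ser_sums_mult t_expansion)
  moreover have "ev (g * (t_coeff m f * tuple_power tvar m)) = ev g * (t_coeff m f * tuple_power \<tau> m)" for m
  proof -
    have "ev (g * (t_coeff m f * tuple_power tvar m)) = ev (t_coeff m f * (tuple_power tvar m * g))"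
      by (simp add: mult_ac)
    then show ?thesis
      by (simp only: ev_t_free_mult[OF t_coeff_mem(1)] ev_tuple_power_mult) (simp add: mult_ac)
  qed
  ultimately have "ser_sums (\<lambda>m. ev g * (t_coeff m f * tuple_power \<tau> m)) (ev (g * f))" by simp
  then have "ev (g * f) = ev g * ev f"
    using ser_sums_mult[OF ev_sums] by (rule ser_sums_unique)
  then show ?thesis by (simp add: mult.commute)
qed

lemma ev_1: "ev 1 = 1"
  by (rule ev_t_free) (rule subring_of[OF subring_t_free])

lemma tuple_power_t_free: "tuple_power \<tau> m \<in> t_free"
  unfolding tuple_power_def by (intro subring_of_prod subring_of_power subring_t_free t_free)

lemma ev_mem: "ev f \<in> t_free"
  by (rule ser_sums_mem(3)[OF ev_sums]) (intro t_free_mult t_coeff_mem tuple_power_t_free)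

lemma ev_ringOBh:
  assumes "\<And>i. \<tau> i \<in> ringOBh" "f \<in> ringOBh" shows "ev f \<in> ringOBh"
proof (rule ser_sums_mem(1)[OF ev_sums])
  fix m
  have "tuple_power \<tau> m \<in> ringOBh"
    unfolding tuple_power_def by (intro subring_of_prod subring_of_power subring_ringOBh assms)
  then show "t_coeff m f * tuple_power \<tau> m \<in> ringOBh"
    by (intro subring_of(6)[OF subring_ringOBh] t_coeff_mem assms)
qed

text \<open>The values substituted for t may involve Q, but \<open>at_Q0\<close> is multiplicative
  and commutes with \<open>t_coeff\<close>, so the two expansions agree termwise after
  restriction.\<close>

lemma at_Q0_ev_at_Q0: "at_Q0 (ev (at_Q0 f)) = at_Q0 (ev f)"
proof (rule ser_sums_unique)
  show "ser_sums (\<lambda>m. at_Q0 (t_coeff m (at_Q0 f) * tuple_power \<tau> m)) (at_Q0 (ev (at_Q0 f)))"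
    by (intro ser_sums_cont[OF ser_cont_at_Q0] ev_sums)
  have "ser_sums (\<lambda>m. at_Q0 (t_coeff m f * tuple_power \<tau> m)) (at_Q0 (ev f))"
    by (intro ser_sums_cont[OF ser_cont_at_Q0] ev_sums)
  then show "ser_sums (\<lambda>m. at_Q0 (t_coeff m (at_Q0 f) * tuple_power \<tau> m)) (at_Q0 (ev f))"
    by (simp add: at_Q0_t_coeff)
qed

end

lemma mcoeff_mult_0:
  "mcoeff (f * g) (\<lambda>_. 0) = mcoeff f (\<lambda>_. 0) * mcoeff (g :: ('i::finite, 'a::comm_ring_1) mps) (\<lambda>_. 0)"
proof -
  have "{d :: 'i \<Rightarrow> nat. d \<le> (\<lambda>_. 0)} = {\<lambda>_. 0}" by (auto simp: le_fun_def fun_eq_iff)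
  then show ?thesis by (simp add: times_mps.rep_eq fun_diff_def)
qed

lemma coeff_0_mult:
  assumes "f \<in> ringOBh" "g \<in> ringOBh"
  shows "coeff (f * g) (\<lambda>_. 0) 0 = coeff f (\<lambda>_. 0) 0 * coeff (g :: ('q::finite, 's::finite, 'k::complete_valuation_domain) ser) (\<lambda>_. 0) 0"
  using assms by (simp add: coeff_def mcoeff_mult_0 hcoeff_0_mult_hpos ringOBh_iff)

lemma coeff_0_power:
  assumes "f \<in> ringOBh"
  shows "coeff (f ^ n) (\<lambda>_. 0) 0 = coeff (f :: ('q::finite, 's::finite, 'k::complete_valuation_domain) ser) (\<lambda>_. 0) 0 ^ n"
proof (induction n)
  case 0
  then show ?case by (simp add: coeff_def mcoeff_1)
next
  case (Suc n)
  then show ?case using coeff_0_mult[OF assms subring_of_power[OF subring_ringOBh assms]] by simp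
qed

lemma coeff_mvar_power_order: "edeg d < k \<Longrightarrow> coeff (mvar i ^ k :: ('q::finite, 's::finite, 'k::complete_valuation_domain) ser) d n = 0"
proof (induction k arbitrary: d n)
  case (Suc k)
  have "coeff (mvar i * mvar i ^ k :: ('q, 's, 'k) ser) d n = 0"
    by (rule coeff_mult_order[where m = 1 and n = k])
      (use Suc in \<open>auto simp: edeg_eq_0 coeff_def mvar_def fun_eq_iff\<close>)
  then show ?case by simp
qed simp

lemma zero_mem_mK: "(0 :: 'k::complete_valuation_domain) \<in> mK"
proof -
  have "vK (0 :: 'k) = \<infinity>" by (simp only: vK_eq_PInf)
  then show ?thesis by (simp add: mK_def)
qed

locale point =
  fixes b :: "('q::finite, 's::finite, 'k::complete_valuation_domain) ser \<Rightarrow> ('q, 's, 'k) ser"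
  assumes O_point: "O_point b"
begin

lemma b_mem: "f \<in> ringOB \<Longrightarrow> b f \<in> ringO"
  and b_add: "f \<in> ringOB \<Longrightarrow> g \<in> ringOB \<Longrightarrow> b (f + g) = b f + b g"
  and b_mult: "f \<in> ringOB \<Longrightarrow> g \<in> ringOB \<Longrightarrow> b (f * g) = b f * b g"
  and b_ringO: "f \<in> ringO \<Longrightarrow> b f = f"
  and b_cont: "f \<in> ringOB \<Longrightarrow> \<exists>m. \<forall>g\<in>ringOB. g - f \<in> nbhd0 m \<longrightarrow> b g - b f \<in> nbhd0 n"
  using O_point unfolding O_point_def by blast+

lemma b_sum: "(\<And>i. i \<in> A \<Longrightarrow> f i \<in> ringOB) \<Longrightarrow> b (sum f A) = (\<Sum>i\<in>A. b (f i))"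
proof (induction A rule: infinite_finite_induct)
  case (insert x F)
  then show ?case by (simp add: b_add subring_of_sum[OF subring_ringOB])
qed (auto intro: b_ringO subring_of[OF subring_ringO])

lemma b_power: "f \<in> ringOB \<Longrightarrow> b (f ^ n) = b f ^ n"
  by (induction n) (simp_all add: b_mult b_ringO subring_of[OF subring_ringO] subring_of_power[OF subring_ringOB])

lemma b_tuple_power: "b (tuple_power tvar m) = tuple_power (\<lambda>i. b (tvar i)) m"
proof (induction m rule: exponent_induct)
  case zero
  then show ?case by (simp add: b_ringO subring_of[OF subring_ringO])
next
  case (Suc m i)
  have "tuple_power tvar m \<in> (ringOB :: ('q, 's, 'k) ser set)"
    unfolding tuple_power_def by (intro subring_of_prod subring_of_power subring_ringOB mvar_mem)
  then show ?case by (simp only: tuple_power_Suc[symmetric] b_mult mvar_mem Suc)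
qed

text \<open>Forced by continuity at 0. For every a in \<open>K\<close> the element a t^(m+1) lies in
  \<open>nbhd0 m\<close>, so the constant term c of the value of t satisfies |a| |c|^(m+1) \<le> 1/e
  with m independent of a. Taking a = 1 gives |c| < 1; if \<open>K\<close> has elements of negative
  valuation, large a leave only c = 0. These are the two cases of \<open>mK\<close>.\<close>

lemma b_tvar_mK: "coeff (b (tvar i)) (\<lambda>_. 0) 0 \<in> mK"
proof -
  let ?c = "coeff (b (tvar i)) (\<lambda>_. 0) 0"
  have zero: "0 \<in> ringOB" "b 0 = 0"
    using subring_of[OF subring_ringOB] b_ringO[of 0] subring_of[OF subring_ringO] by auto
  obtain m where m: "\<forall>g\<in>ringOB. g - 0 \<in> nbhd0 m \<longrightarrow> b g - b 0 \<in> nbhd0 1"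
    using b_cont[OF zero(1)] by blast
  have key: "absK a * absK ?c ^ Suc m \<le> exp (-1)" for a :: 'k
  proof -
    let ?g = "sconst a * tvar i ^ Suc m :: ('q, 's, 'k) ser"
    have s: "sconst a \<in> (ringO :: ('q, 's, 'k) ser set)" "tvar i ^ Suc m \<in> (ringOB :: ('q, 's, 'k) ser set)"
      using ringK_subset ringK_sconst by (blast, intro subring_of_power subring_ringOB mvar_mem)
    then have g: "?g \<in> ringOB" using ringK_subset by (intro subring_of(6)[OF subring_ringOB]) auto
    have "coeff ?g d k = 0" if "edeg d \<le> m" for d k
    proof -
      have "coeff (tvar i ^ Suc m :: ('q, 's, 'k) ser) d k = 0"
        by (rule coeff_mvar_power_order) (use that in simp)
      then show ?thesis by (simp only: coeff_sconst_mult mult_zero_right)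
    qed
    then have "?g \<in> nbhd0 m" by (simp add: nbhd0_iff del: coeff_sconst_mult)
    then have "b ?g \<in> nbhd0 1" using m g zero by auto
    moreover have "b ?g = sconst a * b (tvar i) ^ Suc m"
      using s g ringK_subset by (subst b_mult) (auto simp del: power_Suc simp: b_ringO b_power mvar_mem)
    ultimately have "absK (coeff (sconst a * b (tvar i) ^ Suc m) (\<lambda>_. 0) 0) \<le> exp (- real 1)"
      unfolding nbhd0_iff by (metis edeg_eq_0 zero_le)
    moreover have "b (tvar i) \<in> ringOBh"
      using b_mem[OF mvar_mem(1)] ringK_subset ringOB_subset by blast
    ultimately show ?thesis
      by (simp only: coeff_sconst_mult coeff_0_power absK_mult absK_power of_nat_1)
  qed
  show ?thesis
  proof (cases "\<forall>x::'k. 0 \<le> vK x")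
    case True
    have "absK ?c < 1"
    proof (rule ccontr)
      assume "\<not> absK ?c < 1"
      then have "1 \<le> absK ?c ^ Suc m" by (intro one_le_power) simp
      moreover have "absK ?c ^ Suc m \<le> exp (-1)" using key[of 1] by (simp del: power_Suc)
      moreover have "exp (-1) < (1::real)" by simp
      ultimately show False by linarith
    qed
    have "0 < vK ?c"
    proof (cases "?c = 0")
      case True
      then show ?thesis using vK_eq_PInf[of ?c] by simp
    next
      case False
      then obtain r where "vK ?c = ereal r" by (rule vK_realE)
      then show ?thesis using False \<open>absK ?c < 1\<close> by (simp add: absK_vK)
    qed
    then show ?thesis using True by (simp add: mK_def)
  next
    case False
    then obtain a :: 'k where a: "vK a < 0" by (auto simp: not_le)
    then have a0: "a \<noteq> 0" using vK_eq_PInf[of a] by auto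
    then obtain r where r: "vK a = ereal r" by (rule vK_realE)
    then have a1: "1 < absK a" using a a0 by (simp add: absK_vK)
    have "?c = 0"
    proof (rule ccontr)
      assume "?c \<noteq> 0"
      then have "0 < absK ?c ^ Suc m" using absK_nonneg[of ?c] absK_eq_0[of ?c] by (intro zero_less_power) linarith
      obtain j where j: "1 / absK ?c ^ Suc m < absK a ^ j" using real_arch_pow[OF a1] by blast
      then have "1 < absK a ^ j * absK ?c ^ Suc m" using \<open>0 < absK ?c ^ Suc m\<close> by (simp add: field_simps)
      moreover have "absK a ^ j * absK ?c ^ Suc m \<le> exp (-1)"
        using key[of "a ^ j"] by (simp add: absK_power del: power_Suc)
      moreover have "exp (-1) < (1::real)" by simp
      ultimately show False by linarith
    qed
    then show ?thesis by (simp only: zero_mem_mK)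
  qed
qed

sublocale series_eval "\<lambda>i. b (tvar i)"
proof
  fix i
  have m: "b (tvar i) \<in> ringO" by (intro b_mem mvar_mem)
  then show "b (tvar i) \<in> t_free" using ringK_subset by blast
  show "topnil (b (tvar i))"
    using m ringK_subset by (intro topnil_ringOB b_tvar_mK) auto
qed

lemma eval_at_ev: "eval_at b f = ev f"
  by (simp add: eval_at_def ev_def)

text \<open>A continuous homomorphism that fixes \<open>ringO\<close> is determined by its values on
  t: apply b to the partial sums of the expansion of f.\<close>

lemma ev_ringOB: "f \<in> ringOB \<Longrightarrow> ev f = b f"
proof (rule ev_eqI)
  assume f: "f \<in> ringOB"
  let ?a = "\<lambda>m. t_coeff m f * tuple_power tvar m"
  have a: "?a m \<in> ringOB" for m
    unfolding tuple_power_def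
    by (intro subring_of(6)[OF subring_ringOB] t_coeff_mem f subring_of_prod subring_of_power subring_ringOB mvar_mem)
  have ba: "b (?a m) = t_coeff m f * tuple_power (\<lambda>i. b (tvar i)) m" for m
  proof -
    have "tuple_power tvar m \<in> (ringOB :: ('q, 's, 'k) ser set)"
      unfolding tuple_power_def by (intro subring_of_prod subring_of_power subring_ringOB mvar_mem)
    then show ?thesis
      using f by (simp add: b_mult t_coeff_mem b_tuple_power b_ringO ringO_def)
  qed
  show "ser_sums (\<lambda>m. t_coeff m f * tuple_power (\<lambda>i. b (tvar i)) m) (b f)"
    unfolding ser_sums_def
  proof
    fix n
    obtain N where N: "\<forall>g\<in>ringOB. g - f \<in> nbhd0 N \<longrightarrow> b g - b f \<in> nbhd0 n"
      using b_cont[OF f] by blast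
    obtain F where F: "finite F" "\<forall>H. finite H \<longrightarrow> F \<subseteq> H \<longrightarrow> f - sum ?a H \<in> nbhd0 N"
      using ser_sumsE[OF t_expansion[of f], of N] by blast
    have "b f - (\<Sum>m\<in>H. t_coeff m f * tuple_power (\<lambda>i. b (tvar i)) m) \<in> nbhd0 n" if H: "finite H" "F \<subseteq> H" for H
    proof -
      have "f - sum ?a H \<in> nbhd0 N" using F(2) H by blast
      then have "sum ?a H - f \<in> nbhd0 N" by (rule nbhd0_commute)
      then have "b (sum ?a H) - b f \<in> nbhd0 n"
        using N subring_of_sum[OF subring_ringOB, of H ?a] a by simp
      then have "b f - b (sum ?a H) \<in> nbhd0 n" by (rule nbhd0_commute)
      then show ?thesis by (simp add: b_sum a ba)
    qed
    with F(1) show "\<exists>F0. finite F0 \<and> (\<forall>H. finite H \<and> F0 \<subseteq> H \<longrightarrow>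
        b f - (\<Sum>m\<in>H. t_coeff m f * tuple_power (\<lambda>i. b (tvar i)) m) \<in> nbhd0 n)" by blast
  qed
qed

lemma ev_ringOBh': "f \<in> ringOBh \<Longrightarrow> ev f \<in> ringOBh"
  using b_mem[OF mvar_mem(1)] ringK_subset ringOB_subset by (intro ev_ringOBh) blast+

lemma ev_ringOh: "f \<in> ringOBh \<Longrightarrow> ev f \<in> ringOh"
  by (simp add: ringOh_def ev_ringOBh' ev_mem)

text \<open>The reduction from \<open>\<O>\<^sub>B\<^sup>\<hbar>\<close> to
  \<open>K{\<hbar>}\<close> that underlies the fiber before \<hbar> is set to 0, extended to series
  with negative powers of \<hbar>.\<close>

definition ev0 :: "('q, 's, 'k) ser \<Rightarrow> ('q, 's, 'k) ser" where
  "ev0 f = at_Q0 (ev f)"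

lemma ev0_simps:
  "ev0 (f + g) = ev0 f + ev0 g" "ev0 (f - g) = ev0 f - ev0 g" "ev0 (f * g) = ev0 f * ev0 g" "ev0 0 = 0" "ev0 1 = 1"
  "ev0 (at_Q0 f) = ev0 f"
  by (simp_all add: ev0_def ev_add ev_diff ev_mult ev_0 ev_1 at_Q0_ev_at_Q0)

lemma ser_cont_ev0: "ser_cont ev0"
  unfolding ev0_def using ser_cont_comp[OF ser_cont_at_Q0 ser_cont_ev] by simp

lemma ev0_t_free: "f \<in> t_free \<Longrightarrow> ev0 f = at_Q0 f"
  by (simp add: ev0_def ev_t_free)

lemma ev0_ringOB: "f \<in> ringOB \<Longrightarrow> ev0 f = at_Q0 (b f)"
  by (simp add: ev0_def ev_ringOB)

lemma ev0_mem: "ev0 f \<in> t_free" "ev0 f \<in> Q_free" "f \<in> ringOBh \<Longrightarrow> ev0 f \<in> ringOBh"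
  by (auto simp: ev0_def intro: at_Q0_mem ev_mem ev_ringOBh')

lemma ev0_ringK: "f \<in> ringK \<Longrightarrow> ev0 f = f"
  using ringK_subset by (subst ev0_t_free) (auto intro: at_Q0_Q_free)

end

section \<open>Matrices over commutative rings\<close>

lemma matrix_diff_ldistrib: "A ** (B - C) = A ** B - A ** (C :: 'a::comm_ring_1^'n^'m)"
  and matrix_diff_rdistrib: "(A' - B') ** C = A' ** C - B' ** (C :: 'a::comm_ring_1^'n^'m)"
  and matrix_minus_left: "(- A') ** C = - (A' ** C)"
  and matrix_minus_right: "A ** (- C) = - (A ** C)"
  and matrix_add_rdistrib': "(A' + B') ** C = A' ** C + B' ** C"
  by (simp_all add: vec_eq_iff matrix_matrix_mult_def algebra_simps sum_subtractf sum_negf sum.distrib)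

lemma matrix_zero [simp]: "A ** 0 = 0" "0 ** (A :: 'a::comm_ring_1^'n^'m) = 0"
  by (simp_all add: vec_eq_iff matrix_matrix_mult_def)

definition smult_mat :: "'a::comm_ring_1 \<Rightarrow> 'a^'n^'m \<Rightarrow> 'a^'n^'m" where
  "smult_mat c A = map_matrix (\<lambda>f. c * f) A"

lemma smult_mat_nth [simp]: "smult_mat c A $ i $ j = c * A $ i $ j"
  by (simp add: smult_mat_def)

lemma smult_mat_mult [simp]: "smult_mat c A ** B = smult_mat c (A ** B)" "A ** smult_mat c B = smult_mat c (A ** B)"
  by (simp_all add: vec_eq_iff matrix_matrix_mult_def sum_distrib_left mult_ac)

lemma smult_mat_simps:
  "smult_mat c (A + B) = smult_mat c A + smult_mat c B" "smult_mat c (A - B) = smult_mat c A - smult_mat c B"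
  "smult_mat c (- A) = - smult_mat c A"
  "smult_mat c (smult_mat d A) = smult_mat (c * d) A" "smult_mat 1 A = A" "smult_mat c 0 = 0"
  "smult_mat (c + d) A = smult_mat c A + smult_mat d A"
  by (simp_all add: vec_eq_iff algebra_simps)

lemma smult_mat_sum: "smult_mat c (sum f S) = (\<Sum>i\<in>S. smult_mat c (f i))"
  by (induction S rule: infinite_finite_induct) (simp_all add: smult_mat_simps)

lemma sum_smult_mat: "smult_mat (sum f S) A = (\<Sum>i\<in>S. smult_mat (f i) A)"
  by (induction S rule: infinite_finite_induct) (simp_all add: smult_mat_simps, simp_all add: vec_eq_iff)

lemma matrix_sum_left: "sum f S ** B = (\<Sum>i\<in>S. f i ** (B :: 'a::comm_ring_1^'n^'m))"
  by (induction S rule: infinite_finite_induct) (simp_all add: matrix_add_rdistrib')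

lemma matrix_sum_right: "B ** sum f S = (\<Sum>i\<in>S. B ** (f i :: 'a::comm_ring_1^'n^'m))"
  by (induction S rule: infinite_finite_induct) (simp_all add: matrix_add_ldistrib)

lemma adjugate_right:
  fixes A :: "'a::comm_ring_1^'n^'n"
  obtains X where "A ** X = smult_mat (det A) (mat 1)"
proof -
  define e :: "'n \<Rightarrow> 'a^'n" where "e k = (\<chi> l. if l = k then 1 else 0)" for k
  define X where "X = (\<chi> k j. det (\<chi> i. if i = j then e k else A $ i))"
  have "(A ** X) $ i $ j = det A * (if i = j then 1 else 0)" for i j
  proof -
    have "(A ** X) $ i $ j = (\<Sum>k\<in>UNIV. det (\<chi> l. if l = j then A $ i $ k *s e k else A $ l))"
      by (simp add: matrix_matrix_mult_def X_def det_row_mul)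
    also have "\<dots> = det (\<chi> l. if l = j then (\<Sum>k\<in>UNIV. A $ i $ k *s e k) else A $ l)"
      using det_linear_row_sum[of UNIV j "\<lambda>l k. A $ i $ k *s e k" "\<lambda>l. A $ l"] by simp
    also have "(\<Sum>k\<in>UNIV. A $ i $ k *s e k) = A $ i"
      by (simp add: vec_eq_iff e_def if_distrib sum.delta cong: if_cong)
    also have "det (\<chi> l. if l = j then A $ i else A $ l) = det A * (if i = j then 1 else 0)"
    proof (cases "i = j")
      case True
      then have "(\<chi> l. if l = j then A $ i else A $ l) = A" by (simp add: vec_eq_iff)
      then show ?thesis using True by simp
    next
      case False
      then show ?thesis
        by (subst det_identical_rows[of i j]) (auto simp: row_def vec_eq_iff)
    qed
    finally show ?thesis .
  qed
  then have "A ** X = smult_mat (det A) (mat 1)"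
    by (simp add: vec_eq_iff mat_def)
  then show thesis by (rule that)
qed

lemma det_unit_right_inverse:
  fixes A :: "'a::comm_ring_1^'n^'n"
  assumes "det A * u = 1" obtains X where "A ** X = mat 1"
proof -
  obtain X where "A ** X = smult_mat (det A) (mat 1)" by (rule adjugate_right)
  then have "A ** smult_mat u X = smult_mat (det A * u) (mat 1)"
    by (simp add: smult_mat_simps mult.commute)
  then have "A ** smult_mat u X = mat 1" by (simp only: assms smult_mat_simps)
  then show thesis by (rule that)
qed

text \<open>AB = 1 makes \<open>det B\<close> a unit, so B has a right inverse C, and A = A(BC) =
  C.\<close>

lemma matrix_left_right_inverse_comm:
  fixes A B :: "'a::comm_ring_1^'n^'n"
  assumes "A ** B = mat 1" shows "B ** A = mat 1"
proof -
  have "det A * det B = 1" using assms by (metis det_I det_mul)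
  then obtain C where C: "B ** C = mat 1"
    by (metis det_unit_right_inverse mult.commute)
  have "A = A ** (B ** C)" by (simp add: C)
  also have "\<dots> = C" by (simp add: matrix_mul_assoc assms)
  finally show ?thesis using C by simp
qed

lemma det_unit_inverse:
  fixes A :: "'a::comm_ring_1^'n^'n"
  assumes "det A * u = 1" obtains X where "A ** X = mat 1" "X ** A = mat 1"
  using det_unit_right_inverse[OF assms] matrix_left_right_inverse_comm by metis

lemma matrix_inv_unique:
  fixes A B :: "'a::comm_ring_1^'n^'n"
  assumes "A ** B = mat 1" shows "matrix_inv A = B"
proof -
  have "B ** A = mat 1" by (rule matrix_left_right_inverse_comm[OF assms])
  then have "A ** matrix_inv A = mat 1 \<and> matrix_inv A ** A = mat 1"
    unfolding matrix_inv_def using assms by (intro someI[of "\<lambda>X. A ** X = mat 1 \<and> X ** A = mat 1" B]) simp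
  then have "matrix_inv A = (B ** A) ** matrix_inv A" using \<open>B ** A = mat 1\<close> by simp
  also have "\<dots> = B" using \<open>A ** matrix_inv A = mat 1 \<and> _\<close> by (simp add: matrix_mul_assoc[symmetric])
  finally show ?thesis .
qed

section \<open>Homomorphisms and derivations applied entrywise, and matrix powers\<close>

definition rhom :: "('a::comm_ring_1 \<Rightarrow> 'b::comm_ring_1) \<Rightarrow> bool" where
  "rhom h \<longleftrightarrow> h 1 = 1 \<and> (\<forall>x y. h (x + y) = h x + h y) \<and> (\<forall>x y. h (x * y) = h x * h y)"

lemma rhom_simps:
  assumes "rhom h"
  shows "h 1 = 1" "h 0 = 0" "h (x + y) = h x + h y" "h (x * y) = h x * h y" "h (- x) = - h x" "h (x - y) = h x - h y"
proof -
  show 1: "h 1 = 1" "h (x + y) = h x + h y" "h (x * y) = h x * h y" for x y using assms by (auto simp: rhom_def)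
  show 0: "h 0 = 0" using 1(2)[of 0 0] by simp
  show m: "h (- x) = - h x" for x using 1(2)[of x "- x"] 0 by (simp add: eq_neg_iff_add_eq_0 add.commute)
  show "h (x - y) = h x - h y" using 1(2)[of x "- y"] m by simp
qed

lemma rhom_sum: "rhom h \<Longrightarrow> h (sum f A) = (\<Sum>i\<in>A. h (f i))"
  by (induction A rule: infinite_finite_induct) (simp_all add: rhom_simps)

lemma rhom_prod: "rhom h \<Longrightarrow> h (prod f A) = (\<Prod>i\<in>A. h (f i))"
  by (induction A rule: infinite_finite_induct) (simp_all add: rhom_simps)

lemma rhom_of_nat: "rhom h \<Longrightarrow> h (of_nat n) = of_nat n"
  by (induction n) (simp_all add: rhom_simps)

lemma rhom_det: "rhom h \<Longrightarrow> det (map_matrix h A) = h (det A)"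
proof -
  assume h: "rhom h"
  have "h (of_int (sign p)) = of_int (sign p)" for p :: "'c \<Rightarrow> 'c"
    by (cases p rule: sign_cases) (simp_all add: rhom_simps[OF h])
  then show ?thesis
    by (simp add: det_def rhom_sum[OF h] rhom_simps[OF h] rhom_prod[OF h])
qed

lemma map_matrix_rhom:
  assumes "rhom h"
  shows "map_matrix h (A ** B) = map_matrix h A ** map_matrix h B" "map_matrix h (mat 1) = mat 1"
    "map_matrix h (A' + B') = map_matrix h A' + map_matrix h B'" "map_matrix h (A' - B') = map_matrix h A' - map_matrix h B'"
    "map_matrix h (- A') = - map_matrix h A'" "map_matrix h 0 = 0"
    "map_matrix h (smult_mat c A') = smult_mat (h c) (map_matrix h A')"
  by (simp_all add: vec_eq_iff matrix_matrix_mult_def rhom_sum[OF assms] rhom_simps[OF assms] mat_def)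

lemma map_matrix_rhom_sum: "rhom h \<Longrightarrow> map_matrix h (sum f S) = (\<Sum>i\<in>S. map_matrix h (f i))"
  by (induction S rule: infinite_finite_induct) (simp_all add: map_matrix_rhom)

lemma map_matrix_map: "map_matrix f (map_matrix g A) = map_matrix (\<lambda>x. f (g x)) A"
  by (simp add: vec_eq_iff)

definition derivation :: "('a::comm_ring_1 \<Rightarrow> 'a) \<Rightarrow> bool" where
  "derivation D \<longleftrightarrow> (\<forall>x y. D (x + y) = D x + D y) \<and> (\<forall>x y. D (x * y) = D x * y + x * D y)"

lemma derivation_simps:
  assumes "derivation D"
  shows "D (x + y) = D x + D y" "D (x * y) = D x * y + x * D y" "D 0 = 0" "D 1 = 0"
proof -
  show 1: "D (x + y) = D x + D y" "D (x * y) = D x * y + x * D y" for x y using assms by (auto simp: derivation_def)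
  show "D 0 = 0" using 1(1)[of 0 0] by simp
  show "D 1 = 0" using 1(2)[of 1 1] by simp
qed

lemma derivation_sum: "derivation D \<Longrightarrow> D (sum f A) = (\<Sum>i\<in>A. D (f i))"
  by (induction A rule: infinite_finite_induct) (simp_all add: derivation_simps)

lemma derivation_of_nat: "derivation D \<Longrightarrow> D (of_nat n) = 0"
  by (induction n) (simp_all add: derivation_simps)

lemma map_matrix_derivation:
  assumes "derivation D"
  shows "map_matrix D (A ** B) = map_matrix D A ** B + A ** map_matrix D B" "map_matrix D (mat 1) = 0"
    "map_matrix D (A' + B') = map_matrix D A' + map_matrix D B'"
    "map_matrix D (smult_mat c A') = smult_mat (D c) A' + smult_mat c (map_matrix D A')"
  by (simp_all add: vec_eq_iff matrix_matrix_mult_def derivation_sum[OF assms] derivation_simps[OF assms] mat_def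
      sum.distrib)

lemma map_matrix_derivation_sum: "derivation D \<Longrightarrow> map_matrix D (sum f S) = (\<Sum>i\<in>S. map_matrix D (f i))"
proof (induction S rule: infinite_finite_induct)
  case (insert x F)
  then show ?case by (simp add: map_matrix_derivation)
qed (simp_all add: vec_eq_iff derivation_simps)

lemma derivation_mderiv: "derivation (mderiv i :: ('i::finite, 'a::comm_ring_1) mps \<Rightarrow> _)"
  by (simp add: derivation_def)

lemma derivation_QdQ: "derivation (QdQ a :: ('q::finite, 's::finite, 'k::complete_valuation_domain) ser \<Rightarrow> _)"
  by (simp add: derivation_def algebra_simps)

definition mpow :: "'a::comm_ring_1^'n^'n \<Rightarrow> nat \<Rightarrow> 'a^'n^'n" where
  "mpow X n = ((**) X ^^ n) (mat 1)"

lemma mpow_0 [simp]: "mpow X 0 = mat 1" and mpow_Suc [simp]: "mpow X (Suc n) = X ** mpow X n"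
  by (simp_all add: mpow_def)

lemma mpow_commute: "A ** X = X ** A \<Longrightarrow> A ** mpow X n = mpow X n ** A"
proof (induction n)
  case (Suc n)
  have "A ** (X ** mpow X n) = X ** (A ** mpow X n)" by (simp add: matrix_mul_assoc Suc.prems)
  then show ?case using Suc by (simp add: matrix_mul_assoc)
qed simp

lemma mpow_Suc2: "mpow X (Suc n) = mpow X n ** X"
  using mpow_commute[of X X n] by simp

lemma map_matrix_mpow: "rhom h \<Longrightarrow> map_matrix h (mpow X n) = mpow (map_matrix h X) n"
  by (induction n) (simp_all add: map_matrix_rhom)

lemma map_matrix_derivation_mpow:
  assumes D: "derivation D" and c: "map_matrix D X ** X = X ** map_matrix D X"
  shows "map_matrix D (mpow X (Suc n)) = smult_mat (of_nat (Suc n)) (map_matrix D X ** mpow X n)"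
proof (induction n)
  case 0
  then show ?case by (simp add: map_matrix_derivation[OF D] smult_mat_simps del: map_matrix_def)
next
  case (Suc n)
  have "map_matrix D (mpow X (Suc (Suc n))) =
      map_matrix D X ** mpow X (Suc n) + X ** smult_mat (of_nat (Suc n)) (map_matrix D X ** mpow X n)"
    by (subst mpow_Suc) (simp only: map_matrix_derivation[OF D] Suc)
  also have "X ** smult_mat (of_nat (Suc n)) (map_matrix D X ** mpow X n) =
      smult_mat (of_nat (Suc n)) (map_matrix D X ** mpow X (Suc n))"
    by (simp add: matrix_mul_assoc c)
  finally show ?case
    by (simp only: of_nat_Suc[of "Suc n"] smult_mat_simps)
qed

section \<open>The matrix exponential\<close>

text \<open>The inverse of n! that \<open>mat_exp\<close> selects by description; it exists because
  nonzero integers are invertible in \<open>K\<close>.\<close>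

definition ifact :: "nat \<Rightarrow> ('q::finite, 's::finite, 'k::complete_valuation_domain) ser" where
  "ifact n = (THE u. of_nat (fact n) * u = 1)"

lemma ifact: "of_nat (fact n) * ifact n = (1 :: ('q::finite, 's::finite, 'k::complete_valuation_domain) ser)"
  and ifactI: "of_nat (fact n) * u = 1 \<Longrightarrow> ifact n = (u :: ('q::finite, 's::finite, 'k::complete_valuation_domain) ser)"
proof -
  have uniq: "u = v" if "of_nat (fact n) * u = 1" "of_nat (fact n) * v = 1" for u v :: "('q, 's, 'k) ser"
  proof -
    have "u = (of_nat (fact n) * v) * u" using that by simp
    also have "\<dots> = v * (of_nat (fact n) * u)" by (simp only: mult_ac)
    finally show ?thesis using that by simp
  qed
  obtain x where "of_nat (fact n) * sconst x = (1 :: ('q, 's, 'k) ser)"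
    using of_nat_inverse_ser[of "fact n"] by (metis fact_nonzero)
  then have ex1: "\<exists>!u. of_nat (fact n) * u = (1 :: ('q, 's, 'k) ser)" using uniq by blast
  show "of_nat (fact n) * ifact n = (1 :: ('q, 's, 'k) ser)"
    unfolding ifact_def by (rule theI'[OF ex1])
  show "of_nat (fact n) * u = 1 \<Longrightarrow> ifact n = (u :: ('q, 's, 'k) ser)"
    unfolding ifact_def by (rule the1_equality[OF ex1])
qed

lemma ifact_rhom: "rhom h \<Longrightarrow> h (ifact n) = ifact n"
proof (rule ifactI[symmetric])
  assume h: "rhom h"
  have "of_nat (fact n) * h (ifact n) = h (of_nat (fact n) * ifact n)"
    by (simp only: rhom_simps[OF h] rhom_of_nat[OF h])
  then show "of_nat (fact n) * h (ifact n) = 1"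
    by (simp only: ifact rhom_simps[OF h])
qed

lemma ifact_0 [simp]: "ifact 0 = 1"
  by (rule ifactI) simp

lemma ifact_Suc: "ifact (Suc n) * of_nat (Suc n) = ifact n"
proof (rule ifactI[symmetric])
  have "of_nat (fact n) * (ifact (Suc n) * of_nat (Suc n)) =
      of_nat (fact (Suc n)) * (ifact (Suc n) :: ('q::finite, 's::finite, 'k::complete_valuation_domain) ser)"
    by (simp only: fact_Suc of_nat_id of_nat_mult mult_ac)
  then show "of_nat (fact n) * (ifact (Suc n) * of_nat (Suc n)) =
      (1 :: ('q::finite, 's::finite, 'k::complete_valuation_domain) ser)"
    by (simp only: ifact)
qed

lemma derivation_ifact:
  assumes D: "derivation D" shows "D (ifact n) = 0"
proof -
  have "of_nat (fact n) * D (ifact n) = 0"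
    using arg_cong[OF ifact, of D n] by (simp only: derivation_simps[OF D] derivation_of_nat[OF D]) simp
  then have "(of_nat (fact n) * ifact n) * D (ifact n) = 0"
    by (simp only: mult.assoc mult.left_commute[of _ "ifact n"]) simp
  then show ?thesis by (simp add: ifact)
qed

text \<open>High powers become small inside the ideals \<open>nideal n\<close>, so multiplying them
  by \<open>ifact\<close> keeps them small and the exponential series converges.\<close>

definition mat_nil :: "('q::finite, 's::finite, 'k::complete_valuation_domain) ser^'n^'n \<Rightarrow> bool" where
  "mat_nil X \<longleftrightarrow> (\<forall>n. \<exists>K. \<forall>k\<ge>K. \<forall>i j. mpow X k $ i $ j \<in> nideal n)"

definition mat_sums :: "('j \<Rightarrow> ('q::finite, 's::finite, 'k::complete_valuation_domain) ser^'n^'m) \<Rightarrow> ('q, 's, 'k) ser^'n^'m \<Rightarrow> bool" where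
  "mat_sums A Y \<longleftrightarrow> (\<forall>i j. ser_sums (\<lambda>n. A n $ i $ j) (Y $ i $ j))"

lemma mat_sums_unique: "mat_sums A Y \<Longrightarrow> mat_sums A Z \<Longrightarrow> Y = Z"
  unfolding mat_sums_def vec_eq_iff by (meson ser_sums_unique)

lemma mat_sums_map: "ser_cont h \<Longrightarrow> mat_sums A Y \<Longrightarrow> mat_sums (\<lambda>n. map_matrix h (A n)) (map_matrix h Y)"
  unfolding mat_sums_def nth_map_matrix
proof (intro allI)
  fix i j assume "ser_cont h" "\<forall>i j. ser_sums (\<lambda>n. A n $ i $ j) (Y $ i $ j)"
  then show "ser_sums (\<lambda>n. h (A n $ i $ j)) (h (Y $ i $ j))"
    using ser_sums_cont[of h "\<lambda>n. A n $ i $ j" "Y $ i $ j"] by simp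
qed

lemma mat_sums_mult_left: "mat_sums A Y \<Longrightarrow> mat_sums (\<lambda>n. B ** A n) (B ** Y)"
  unfolding mat_sums_def matrix_matrix_mult_def by (auto intro!: ser_sums_sum ser_sums_mult)

lemma mat_sums_mult_right: "mat_sums A Y \<Longrightarrow> mat_sums (\<lambda>n. A n ** B) (Y ** B)"
  unfolding mat_sums_def matrix_matrix_mult_def
  by (auto intro!: ser_sums_sum) (simp add: mult.commute[of _ "B $ _ $ _"] ser_sums_mult)

lemma mat_exp_eqI: "mat_sums (\<lambda>n. smult_mat (ifact n) (mpow X n)) Y \<Longrightarrow> mat_exp X = Y"
  unfolding mat_exp_def ifact_def[symmetric] mpow_def[symmetric]
  using mat_sums_unique[of "\<lambda>n. smult_mat (ifact n) (mpow X n)"]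
  by (intro the_equality) (auto simp: mat_sums_def)

lemma mat_exp_sums:
  assumes "mat_nil X" shows "mat_sums (\<lambda>n. smult_mat (ifact n) (mpow X n)) (mat_exp X)"
proof -
  have "\<exists>y. ser_sums (\<lambda>k. smult_mat (ifact k) (mpow X k) $ i $ j) y" for i j
  proof -
    have "finite {k. smult_mat (ifact k) (mpow X k) $ i $ j \<notin> nbhd0 n}" for n
    proof -
      obtain K where "\<forall>k\<ge>K. \<forall>i j. mpow X k $ i $ j \<in> nideal n" using assms unfolding mat_nil_def by blast
      then have K: "\<And>k. k \<ge> K \<Longrightarrow> mpow X k $ i $ j \<in> nideal n" by blast
      have "{k. smult_mat (ifact k) (mpow X k) $ i $ j \<notin> nbhd0 n} \<subseteq> {..<K}"
      proof
        fix k assume k: "k \<in> {k. smult_mat (ifact k) (mpow X k) $ i $ j \<notin> nbhd0 n}"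
        show "k \<in> {..<K}"
        proof (rule ccontr)
          assume "k \<notin> {..<K}"
          then have "ifact k * mpow X k $ i $ j \<in> nbhd0 n" by (intro nideal_nbhd0 nideal_mult K) simp
          then show False using k by simp
        qed
      qed
      then show ?thesis by (rule finite_subset) simp
    qed
    then obtain y where "ser_sums (\<lambda>k. smult_mat (ifact k) (mpow X k) $ i $ j) y"
      by (rule ser_sums_exists)
    then show ?thesis ..
  qed
  note ex = this
  define Y where "Y i j = (SOME y. ser_sums (\<lambda>k. smult_mat (ifact k) (mpow X k) $ i $ j) y)" for i j
  have Y: "ser_sums (\<lambda>k. smult_mat (ifact k) (mpow X k) $ i $ j) (Y i j)" for i j
    unfolding Y_def by (rule someI_ex[OF ex])
  have "mat_sums (\<lambda>n. smult_mat (ifact n) (mpow X n)) (\<chi> i j. Y i j)"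
    unfolding mat_sums_def vec_lambda_beta by (intro allI Y)
  moreover from this have "mat_exp X = (\<chi> i j. Y i j)" by (rule mat_exp_eqI)
  ultimately show ?thesis by simp
qed

lemma mat_exp_map:
  assumes "rhom h" "ser_cont h" "mat_nil X"
  shows "mat_exp (map_matrix h X) = map_matrix h (mat_exp X)"
  using mat_sums_map[OF assms(2) mat_exp_sums[OF assms(3)]]
  by (intro mat_exp_eqI) (simp add: map_matrix_rhom[OF assms(1)] map_matrix_mpow[OF assms(1)] ifact_rhom[OF assms(1)])

lemma mat_exp_0: "mat_exp 0 = mat 1"
proof (rule mat_exp_eqI)
  have eq: "(\<lambda>n. smult_mat (ifact n) (mpow 0 n) $ i $ j) = (\<lambda>n. if n = 0 then mat 1 $ i $ j else 0)" for i j
  proof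
    fix n show "smult_mat (ifact n) (mpow 0 n) $ i $ j = (if n = 0 then mat 1 $ i $ j else 0)"
      by (cases n) simp_all
  qed
  show "mat_sums (\<lambda>n. smult_mat (ifact n) (mpow 0 n)) (mat 1)"
    unfolding mat_sums_def eq by (intro allI ser_sums_single)
qed

lemma mat_exp_commute:
  assumes "mat_nil X" "A ** X = X ** A" shows "A ** mat_exp X = mat_exp X ** A"
proof (rule mat_sums_unique)
  show "mat_sums (\<lambda>n. A ** smult_mat (ifact n) (mpow X n)) (A ** mat_exp X)"
    by (intro mat_sums_mult_left mat_exp_sums assms)
  have "(\<lambda>n. A ** smult_mat (ifact n) (mpow X n)) = (\<lambda>n. smult_mat (ifact n) (mpow X n) ** A)"
    using mpow_commute[OF assms(2)] by simp
  then show "mat_sums (\<lambda>n. A ** smult_mat (ifact n) (mpow X n)) (mat_exp X ** A)"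
    using mat_sums_mult_right[OF mat_exp_sums[OF assms(1)], of A] by simp
qed

text \<open>Termwise differentiation and an index shift. Since X commutes with its derivative X',
  the derivative of X^(n+1) is (n+1) X' X^n, and (n+1)/(n+1)! = 1/n!.\<close>

lemma mat_exp_derivation:
  assumes D: "derivation D" "ser_cont D" and X: "mat_nil X" and c: "map_matrix D X ** X = X ** map_matrix D X"
  shows "map_matrix D (mat_exp X) = map_matrix D X ** mat_exp X"
proof -
  let ?a = "\<lambda>n. map_matrix D (smult_mat (ifact n) (mpow X n))"
  have 0: "?a 0 = 0" by (simp add: map_matrix_derivation[OF D(1)] derivation_simps[OF D(1)] smult_mat_simps)
  have S: "?a (Suc n) = map_matrix D X ** smult_mat (ifact n) (mpow X n)" for n
  proof -
    have "?a (Suc n) = smult_mat (ifact (Suc n)) (map_matrix D (mpow X (Suc n)))"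
      by (simp only: map_matrix_derivation[OF D(1)] derivation_ifact[OF D(1)]) (simp add: vec_eq_iff)
    also have "\<dots> = smult_mat (ifact (Suc n) * of_nat (Suc n)) (map_matrix D X ** mpow X n)"
      by (simp only: map_matrix_derivation_mpow[OF D(1) c] smult_mat_simps)
    finally show ?thesis by (simp only: ifact_Suc smult_mat_mult)
  qed
  have z: "?a n $ i $ j = 0" if "n \<notin> range Suc" for n i j
    using that 0 by (cases n) (auto simp: zero_index)
  have "mat_sums (\<lambda>n. ?a (Suc n)) (map_matrix D X ** mat_exp X)"
    unfolding S by (intro mat_sums_mult_left mat_exp_sums X)
  then have "ser_sums (\<lambda>n. ?a (Suc n) $ i $ j) ((map_matrix D X ** mat_exp X) $ i $ j)" for i j
    by (simp add: mat_sums_def)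
  then have "mat_sums ?a (map_matrix D X ** mat_exp X)"
    unfolding mat_sums_def
    by (intro allI iffD1[OF ser_sums_inj[OF inj_Suc, of "\<lambda>n. ?a n $ _ $ _"]] z) simp_all
  with mat_sums_map[OF D(2) mat_exp_sums[OF X]] show ?thesis by (rule mat_sums_unique)
qed

text \<open>Each matrix factor contributes one of the x i, so the entries of the k-th power lie in
  the k-th power of the ideal generated by x, even if the matrices do not commute.\<close>

lemma mat_nil_sum:
  fixes x :: "'s::finite \<Rightarrow> ('q::finite, 's, 'k::complete_valuation_domain) ser"
  assumes "\<And>i. topnil (x i)"
  shows "mat_nil (\<Sum>i\<in>UNIV. smult_mat (x i) (M i))"
proof -
  let ?X = "\<Sum>i\<in>UNIV. smult_mat (x i) (M i)"
  have m: "mpow ?X k $ i $ j \<in> idpow x k" for k i j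
  proof (induction k arbitrary: i j)
    case 0
    then show ?case using idpow_1 idpow.zero by (auto simp: mat_def)
  next
    case (Suc k)
    have "mpow ?X (Suc k) $ i $ j = (\<Sum>l\<in>UNIV. (\<Sum>h\<in>UNIV. x h * M h $ i $ l) * mpow ?X k $ l $ j)"
      by (simp add: matrix_matrix_mult_def sum_component)
    also have "\<dots> = (\<Sum>l\<in>UNIV. \<Sum>h\<in>UNIV. x h * (M h $ i $ l * mpow ?X k $ l $ j))"
      by (simp add: sum_distrib_right mult.assoc)
    also have "\<dots> \<in> idpow x (Suc k)"
      by (intro idpow_sum idpow_Suc idpow_mult Suc.IH)
    finally show ?case .
  qed
  show ?thesis
    unfolding mat_nil_def
  proof
    fix n
    obtain K where "\<forall>k\<ge>K. idpow x k \<subseteq> nideal n" using idpow_nideal[of x n] assms by blast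
    then show "\<exists>K. \<forall>k\<ge>K. \<forall>i j. mpow ?X k $ i $ j \<in> nideal n" using m by blast
  qed
qed

section \<open>Co-ordinate systems\<close>

lemma mderiv_tuple_power:
  fixes T :: "'s::finite \<Rightarrow> ('q::finite, 's, 'k::complete_valuation_domain) ser"
  shows "mderiv v (tuple_power T m) = (\<Sum>i\<in>UNIV. of_nat (m i) * tuple_power T (m(i := m i - 1)) * mderiv v (T i))"
proof (induction m rule: exponent_induct)
  case zero
  then show ?case by simp
next
  case (Suc m k)
  let ?m = "m(k := Suc (m k))"
  have *: "of_nat (?m i) * tuple_power T (?m(i := ?m i - 1)) * mderiv v (T i) =
      T k * (of_nat (m i) * tuple_power T (m(i := m i - 1)) * mderiv v (T i)) +
      (if i = k then mderiv v (T k) * tuple_power T m else 0)" for i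
  proof (cases "i = k")
    case True
    show ?thesis
    proof (cases "m k = 0")
      case True
      then show ?thesis using \<open>i = k\<close> by (simp add: fun_upd_idem)
    next
      case False
      then have "T k * tuple_power T (m(k := m k - 1)) = tuple_power T m"
        using tuple_power_Suc[of T k "m(k := m k - 1)"] by (simp add: fun_upd_idem)
      moreover have "T k * (of_nat (m k) * tuple_power T (m(k := m k - 1)) * mderiv v (T k)) =
          of_nat (m k) * (T k * tuple_power T (m(k := m k - 1))) * mderiv v (T k)"
        by (simp only: mult_ac)
      ultimately have "T k * (of_nat (m k) * tuple_power T (m(k := m k - 1)) * mderiv v (T k)) =
          of_nat (m k) * tuple_power T m * mderiv v (T k)" by simp
      moreover have "?m(k := ?m k - 1) = m" by simp
      ultimately show ?thesis using \<open>i = k\<close> by (simp only: fun_upd_same of_nat_Suc if_True) (simp add: algebra_simps)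
    qed
  next
    case False
    then have "?m(i := ?m i - 1) = (m(i := m i - 1))(k := Suc ((m(i := m i - 1)) k))" by (simp add: fun_upd_twist)
    then have "tuple_power T (?m(i := ?m i - 1)) = T k * tuple_power T (m(i := m i - 1))"
      by (simp only: tuple_power_Suc)
    then show ?thesis using False by (simp add: mult_ac)
  qed
  have "mderiv v (tuple_power T ?m) = mderiv v (T k) * tuple_power T m +
      T k * (\<Sum>i\<in>UNIV. of_nat (m i) * tuple_power T (m(i := m i - 1)) * mderiv v (T i))"
    by (simp only: tuple_power_Suc[symmetric] mderiv_mult Suc)
  also have "\<dots> = (\<Sum>i\<in>UNIV. of_nat (?m i) * tuple_power T (?m(i := ?m i - 1)) * mderiv v (T i))"
    unfolding * by (simp add: sum.distrib sum_distrib_left)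
  finally show ?case .
qed

text \<open>Differentiating the expansions of the \<open>t\<^sup>j\<close> as series in \<open>T\<close> inverts the Jacobian matrix.\<close>
lemma jacobian_inverse:
  fixes T :: "'s::finite \<Rightarrow> ('q::finite, 's, 'k::complete_valuation_domain) ser"
  assumes T: "coord_system T"
  obtains J where "\<And>i j. J $ i $ j \<in> ringOB" "J ** (\<chi> i j. dt j (T i)) = mat 1" "(\<chi> i j. dt j (T i)) ** J = mat 1"
    "inv_jac T = J"
proof -
  have ex: "\<exists>f\<in>ringOB. ser_sums (\<lambda>m. a m * tuple_power T m) f" if "\<And>m. a m \<in> ringO" for a
    using T that unfolding coord_system_def by blast
  have row: "\<exists>h. (\<forall>i. h i \<in> ringOB) \<and> (\<forall>k. (\<Sum>i\<in>UNIV. h i * dt k (T i)) = (if k = j then 1 else 0))" for j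
  proof -
    have "\<exists>a. (\<forall>m. a m \<in> ringO) \<and> ser_sums (\<lambda>m. a m * tuple_power T m) (tvar j)"
      using T mvar_mem(1)[of "Inr j"] unfolding coord_system_def by blast
    then obtain a where a: "\<And>m. a m \<in> ringO" and aT: "ser_sums (\<lambda>m. a m * tuple_power T m) (tvar j)" by blast
    \<comment> \<open>The formal derivative of a_m T^m with respect to T^i. If
      \<open>m i = 0\<close>, the truncated subtraction is made harmless by the factor
      \<open>m i\<close>.\<close>
    let ?b = "\<lambda>i m. of_nat (m i) * (a m * tuple_power T (m(i := m i - 1)))"
    have "\<exists>h\<in>ringOB. ser_sums (?b i) h" for i
    proof -
      let ?r = "\<lambda>m :: 's \<Rightarrow> nat. m(i := Suc (m i))"
      have inj: "inj ?r"
        by (rule injI) (metis (mono_tags, lifting) fun_upd_idem_iff fun_upd_same fun_upd_upd nat.inject)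
      have z: "?b i m = 0" if "m \<notin> range ?r" for m
      proof -
        have "m i = 0"
        proof (rule ccontr)
          assume "m i \<noteq> 0"
          then have "m = ?r (m(i := m i - 1))" by auto
          then show False using that by blast
        qed
        then show ?thesis by simp
      qed
      have "of_nat (Suc n) * a m \<in> ringO" for n m
      proof -
        have "(of_nat (Suc n) :: ('q, 's, 'k) ser) \<in> ringO"
          using ringK_subset(1) ringK_sconst by (metis rangeI sconst_of_nat subsetD)
        then show ?thesis using a by (intro subring_of(6)[OF subring_ringO])
      qed
      \<comment> \<open>Shifting m by one in direction i turns the derivative into a family in
        \<open>ringO\<close> indexed by monomials, so \<open>coord_system\<close> itself provides
        its sum in \<open>ringOB\<close>.\<close>
      then obtain h where h: "h \<in> ringOB" "ser_sums (\<lambda>m. of_nat (Suc (m i)) * a (?r m) * tuple_power T m) h"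
        using ex[of "\<lambda>m. of_nat (Suc (m i)) * a (?r m)"] by blast
      have eq: "(\<lambda>m. of_nat (Suc (m i)) * a (?r m) * tuple_power T m) = (\<lambda>m. ?b i (?r m))"
        by (intro ext) (simp add: mult.assoc del: of_nat_Suc)
      have "ser_sums (?b i) h"
        by (rule iffD1[OF ser_sums_inj[OF inj, of "?b i"], OF z h(2)[unfolded eq]])
      then show ?thesis using h(1) by blast
    qed
    then have "\<forall>i. \<exists>h. h \<in> ringOB \<and> ser_sums (?b i) h" by blast
    then have "\<exists>h. \<forall>i. h i \<in> ringOB \<and> ser_sums (?b i) (h i)" by (rule choice)
    then obtain h where hP: "\<forall>i. h i \<in> ringOB \<and> ser_sums (?b i) (h i)" ..
    have h: "h i \<in> ringOB" "ser_sums (?b i) (h i)" for i using hP by blast+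
    have "(\<Sum>i\<in>UNIV. h i * dt k (T i)) = (if k = j then 1 else 0)" for k
    proof (rule ser_sums_unique)
      have eq: "dt k (a m * tuple_power T m) = (\<Sum>i\<in>UNIV. dt k (T i) * ?b i m)" for m
      proof -
        have "a m \<in> t_free" using a ringK_subset by blast
        then show ?thesis
          by (simp add: dt_t_free mderiv_tuple_power sum_distrib_left mult_ac)
      qed
      have "ser_sums (\<lambda>m. dt k (a m * tuple_power T m)) (dt k (tvar j))"
        by (rule ser_sums_cont[OF ser_cont_mderiv aT])
      then show "ser_sums (\<lambda>m. \<Sum>i\<in>UNIV. dt k (T i) * ?b i m) (if k = j then 1 else 0)"
        unfolding eq by (simp add: mderiv_mvar)
      have "ser_sums (\<lambda>m. \<Sum>i\<in>UNIV. dt k (T i) * ?b i m) (\<Sum>i\<in>UNIV. dt k (T i) * h i)"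
        by (intro ser_sums_sum ser_sums_mult h)
      then show "ser_sums (\<lambda>m. \<Sum>i\<in>UNIV. dt k (T i) * ?b i m) (\<Sum>i\<in>UNIV. h i * dt k (T i))"
        by (simp only: mult.commute[of "h _"])
    qed
    then show ?thesis using h(1) by blast
  qed
  let ?P = "\<lambda>j h. (\<forall>i. h i \<in> ringOB) \<and> (\<forall>k. (\<Sum>i\<in>UNIV. h i * dt k (T i)) = (if k = j then 1 else 0))"
  have "\<forall>j. \<exists>h. ?P j h" using row by blast
  then have "\<exists>h. \<forall>j. ?P j (h j)" by (rule choice)
  then obtain h where hP: "\<forall>j. ?P j (h j)" ..
  have h: "h j i \<in> ringOB" "(\<Sum>i\<in>UNIV. h j i * dt k (T i)) = (if k = j then 1 else 0)" for j i k
    using hP by blast+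
  define J where "J = (\<chi> j i. h j i)"
  have J1: "J ** (\<chi> i j. dt j (T i)) = mat 1"
    by (simp add: J_def vec_eq_iff matrix_matrix_mult_def h(2) mat_def)
  then have J2: "(\<chi> i j. dt j (T i)) ** J = mat 1" by (rule matrix_left_right_inverse_comm)
  show thesis
    by (rule that[OF _ J1 J2]) (simp add: J_def h, unfold inv_jac_def, rule matrix_inv_unique[OF J2])
qed

section \<open>The fundamental solution at \<open>Q = 0\<close>\<close>

lemma rhom_at_Q0: "rhom (at_Q0 :: ('q::finite, 's::finite, 'k::complete_valuation_domain) ser \<Rightarrow> _)"
  by (simp add: rhom_def)

lemma rhom_hflip: "rhom (hflip :: ('q::finite, 's::finite, 'k::complete_valuation_domain) ser \<Rightarrow> _)"
  by (simp add: rhom_def)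

lemma rhom_sconst: "rhom (sconst :: 'k::complete_valuation_domain \<Rightarrow> ('q::finite, 's::finite, 'k) ser)"
  by (simp add: rhom_def sconst_simps)

lemma (in point) rhom_ev0: "rhom ev0"
  by (simp add: rhom_def ev0_simps)

abbreviation kmat :: "'k::complete_valuation_domain^'n^'m \<Rightarrow> ('q, 's, 'k) ser^'n^'m" where
  "kmat M \<equiv> map_matrix sconst M"

abbreviation dM :: "'s \<Rightarrow> ('q::finite, 's::finite, 'k::complete_valuation_domain) ser^'n^'m \<Rightarrow> ('q, 's, 'k) ser^'n^'m" where
  "dM j M \<equiv> map_matrix (dt j) M"

abbreviation qM :: "'q \<Rightarrow> ('q::finite, 's::finite, 'k::complete_valuation_domain) ser^'n^'m \<Rightarrow> ('q, 's, 'k) ser^'n^'m" where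
  "qM a M \<equiv> map_matrix (QdQ a) M"

lemma sconst_mem: "sconst c \<in> ringK" "sconst c \<in> t_free" "sconst c \<in> Q_free" "sconst c \<in> ringOB" "sconst c \<in> ringOBh"
  using ringK_subset ringK_sconst by (metis rangeI subsetD)+

lemma sconst_inject: "sconst c = (sconst d :: ('q, 's, 'k::complete_valuation_domain) ser) \<Longrightarrow> c = d"
  using arg_cong[of "sconst c :: ('q, 's, 'k) ser" "sconst d" "\<lambda>f. coeff f (\<lambda>_. 0) 0", unfolded coeff_sconst]
  by simp

lemma coeff_mult_sconst:
  "coeff (f * sconst c) e k = coeff (f :: ('q::finite, 's::finite, 'k::complete_valuation_domain) ser) e k * c"
  by (simp only: mult.commute[of f] coeff_sconst_mult mult.commute[of c])

lemma kmat_fixed: "map_matrix at_Q0 (kmat M) = kmat M" "map_matrix hflip (kmat M) = kmat M"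
  "dM j (kmat M) = 0" "qM a (kmat M) = 0"
  by (simp_all add: vec_eq_iff at_Q0_Q_free hflip_ringOB dt_t_free mderiv_Q_free sconst_mem)

lemma (in point) ev0_kmat: "map_matrix ev0 (kmat M) = kmat M"
  by (simp add: vec_eq_iff ev0_ringK sconst_mem)

lemma smult_hbar_cancel: "smult_mat hbar A = smult_mat hbar B \<Longrightarrow> A = B"
  by (auto simp: vec_eq_iff intro: hbar_cancel)

text \<open>If the x i are the \<open>dt j\<close>-derivatives of the co-ordinates at Q = 0, this is
  the connection matrix in direction j at Q = 0; if they are these co-ordinates over \<hbar>, it is
  the exponent of its solution.\<close>

definition conn_sum :: "('s::finite \<Rightarrow> ('q::finite, 's, 'k::complete_valuation_domain) ser) \<Rightarrow> ('s \<Rightarrow> 'k^'s^'s) \<Rightarrow> ('q, 's, 'k) ser^'s^'s" where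
  "conn_sum x w = (\<Sum>i\<in>UNIV. smult_mat (x i) (kmat (w i)))"

lemma conn_sum_commute:
  assumes "\<And>i k. w i ** w k = w k ** w i"
  shows "conn_sum x w ** conn_sum y w = conn_sum y w ** conn_sum x w"
proof -
  have w: "kmat (w i) ** kmat (w k) = kmat (w k) ** kmat (w i)" for i k
    by (simp only: map_matrix_rhom(1)[OF rhom_sconst, symmetric] assms)
  show ?thesis
    unfolding conn_sum_def
    by (simp add: matrix_sum_left matrix_sum_right smult_mat_simps smult_mat_sum, subst sum.swap)
      (simp add: w mult.commute)
qed

lemma map_matrix_conn_sum_deriv: "derivation D \<Longrightarrow> (\<And>i. map_matrix D (kmat (w i)) = 0) \<Longrightarrow>
    map_matrix D (conn_sum x w) = conn_sum (\<lambda>i. D (x i)) w"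
  unfolding conn_sum_def
  by (simp add: map_matrix_derivation_sum map_matrix_derivation smult_mat_simps)

lemma map_matrix_conn_sum_rhom: "rhom h \<Longrightarrow> (\<And>i. map_matrix h (kmat (w i)) = kmat (w i)) \<Longrightarrow>
    map_matrix h (conn_sum x w) = conn_sum (\<lambda>i. h (x i)) w"
  unfolding conn_sum_def by (simp add: map_matrix_rhom_sum map_matrix_rhom)

lemma smult_conn_sum: "smult_mat c (conn_sum x w) = conn_sum (\<lambda>i. c * x i) w"
  by (simp add: conn_sum_def smult_mat_sum smult_mat_simps)

lemma uminus_conn_sum: "- conn_sum x w = conn_sum (\<lambda>i. - x i) w"
  by (simp add: conn_sum_def vec_eq_iff sum_component sum_negf)

lemma conn_sum_0: "conn_sum (\<lambda>_. 0) w = 0"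
  by (simp add: conn_sum_def vec_eq_iff sum_component)

lemma mat_nil_conn_sum: "(\<And>i. topnil (x i)) \<Longrightarrow> mat_nil (conn_sum x w)"
  unfolding conn_sum_def by (rule mat_nil_sum)

lemma dM_mat_exp:
  assumes x: "\<And>i. topnil (x i)" and w: "\<And>i k. w i ** w k = w k ** w i"
  shows "dM j (mat_exp (conn_sum (\<lambda>i. hpow (-1) * x i) w)) =
    conn_sum (\<lambda>i. hpow (-1) * dt j (x i)) w ** mat_exp (conn_sum (\<lambda>i. hpow (-1) * x i) w)"
proof -
  let ?X = "conn_sum (\<lambda>i. hpow (-1) * x i) w"
  have X': "dM j ?X = conn_sum (\<lambda>i. hpow (-1) * dt j (x i)) w"
    by (subst map_matrix_conn_sum_deriv[OF derivation_mderiv]) (simp_all only: kmat_fixed, simp)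
  have "mat_nil ?X" by (intro mat_nil_conn_sum topnil_mult x)
  then show ?thesis
    unfolding X'[symmetric]
    by (rule mat_exp_derivation[OF derivation_mderiv ser_cont_mderiv])
      (simp only: X' conn_sum_commute[OF w])
qed

lemma map_mat_exp_conn_sum:
  assumes "\<And>i. topnil (x i)" "rhom h" "ser_cont h" "\<And>i. map_matrix h (kmat (w i)) = kmat (w i)"
  shows "map_matrix h (mat_exp (conn_sum x w)) = mat_exp (conn_sum (\<lambda>i. h (x i)) w)"
  by (simp only: mat_exp_map[OF assms(2,3) mat_nil_conn_sum[OF assms(1)], symmetric]
      map_matrix_conn_sum_rhom[OF assms(2,4)])

text \<open>The derivatives of the product vanish, and its value at the point is \<open>1\<close>.\<close>
lemma (in point) exp_solution:
  fixes Z :: "('q, 's, 'k) ser^'s^'s"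
  assumes x: "\<And>i. topnil (x i)" "\<And>i. x i \<in> Q_free" "\<And>i. ev0 (x i) = 0"
    and w: "\<And>i k. w i ** w k = w k ** w i"
    and Z: "\<And>j. smult_mat hbar (dM j Z) = - (conn_sum (\<lambda>i. dt j (x i)) w ** Z)"
      "map_matrix at_Q0 Z = Z" "map_matrix ev0 Z = mat 1"
  shows "mat_exp (conn_sum (\<lambda>i. hpow (-1) * x i) w) ** Z = mat 1"
proof -
  let ?X = "conn_sum (\<lambda>i. hpow (-1) * x i) w"
  let ?E = "mat_exp ?X"
  have tx: "topnil (hpow (-1) * x i)" for i by (intro topnil_mult x)
  have nil: "mat_nil ?X" by (intro mat_nil_conn_sum tx)
  have "dM j (?E ** Z) = 0" for j
  proof -
    let ?X' = "conn_sum (\<lambda>i. hpow (-1) * dt j (x i)) w"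
    have c: "?X' ** ?X = ?X ** ?X'" by (rule conn_sum_commute[OF w])
    have E: "dM j ?E = ?X' ** ?E" by (rule dM_mat_exp[OF x(1) w])
    have "smult_mat hbar (dM j Z) = smult_mat hbar (- (?X' ** Z))"
      by (simp only: Z(1) smult_mat_simps smult_mat_mult(1)[symmetric] smult_conn_sum mult.assoc[symmetric] hpow_inverse mult_1)
    then have dZ: "dM j Z = - (?X' ** Z)" by (rule smult_hbar_cancel)
    have "dM j (?E ** Z) = (?X' ** ?E) ** Z - ?E ** (?X' ** Z)"
      by (simp only: map_matrix_derivation[OF derivation_mderiv] E dZ matrix_minus_right) simp
    also have "?E ** (?X' ** Z) = (?X' ** ?E) ** Z"
      by (simp only: matrix_mul_assoc mat_exp_commute[OF nil c])
    finally show ?thesis by simp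
  qed
  then have t: "(?E ** Z) $ i $ j \<in> t_free" for i j
    by (intro t_freeI) (metis nth_map_matrix zero_index)
  have "map_matrix at_Q0 ?E = ?E"
    using x(2) by (subst map_mat_exp_conn_sum[OF tx rhom_at_Q0 ser_cont_at_Q0 kmat_fixed(1)]) (simp add: at_Q0_Q_free)
  then have "map_matrix at_Q0 (?E ** Z) = ?E ** Z"
    by (simp only: map_matrix_rhom[OF rhom_at_Q0] Z(2))
  \<comment> \<open>The product is free of t and of Q, so evaluation at the point does not change
    it; there the exponent vanishes and Z is 1.\<close>
  then have "?E ** Z = map_matrix ev0 (?E ** Z)"
    using t by (simp add: vec_eq_iff ev0_t_free)
  also have "\<dots> = map_matrix ev0 ?E" by (simp only: map_matrix_rhom[OF rhom_ev0] Z(3) matrix_mul_rid)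
  also have "\<dots> = mat 1"
    by (subst map_mat_exp_conn_sum[OF tx rhom_ev0 ser_cont_ev0 ev0_kmat])
      (simp add: x(3) ev0_simps conn_sum_0 mat_exp_0)
  finally show ?thesis .
qed

text \<open>Compare the mixed derivatives of \<open>Z\<close>.\<close>
lemma (in point) flat_commute:
  fixes Z :: "('q, 's, 'k) ser^'s^'s"
  assumes J: "(\<chi> i j. dt j (x i)) ** J = mat 1"
    and Z: "\<And>j. smult_mat hbar (dM j Z) = - (conn_sum (\<lambda>i. dt j (x i)) w ** Z)" "map_matrix ev0 Z = mat 1"
  shows "w i ** w k = w k ** (w i :: 'k^'s^'s)"
proof -
  let ?M = "\<lambda>j. conn_sum (\<lambda>i. dt j (x i)) w"
  \<comment> \<open>The last term is symmetric in j and k, so equality of the mixed derivatives is a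
    statement about the products \<open>?M j ** (?M k ** Z)\<close> alone.\<close>
  have dd: "smult_mat (hbar * hbar) (dM k (dM j Z)) = ?M j ** (?M k ** Z) - smult_mat hbar (conn_sum (\<lambda>i. dt k (dt j (x i))) w ** Z)" for j k
  proof -
    have "smult_mat hbar (dM k (dM j Z)) = dM k (smult_mat hbar (dM j Z))"
      by (simp add: map_matrix_derivation[OF derivation_mderiv] vec_eq_iff)
    also have "\<dots> = - dM k (?M j ** Z)"
      unfolding Z(1) by (simp add: vec_eq_iff)
    also have "\<dots> = - (conn_sum (\<lambda>i. dt k (dt j (x i))) w ** Z) - ?M j ** dM k Z"
      by (simp only: map_matrix_derivation[OF derivation_mderiv] map_matrix_conn_sum_deriv[OF derivation_mderiv kmat_fixed(3)]) simp
    finally have "smult_mat hbar (smult_mat hbar (dM k (dM j Z))) =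
        - smult_mat hbar (conn_sum (\<lambda>i. dt k (dt j (x i))) w ** Z) - ?M j ** smult_mat hbar (dM k Z)"
      by (simp add: smult_mat_simps)
    then show ?thesis by (simp add: Z(1) smult_mat_simps matrix_minus_right)
  qed
  have comm: "?M j ** (?M k ** Z) = ?M k ** (?M j ** Z)" for j k
  proof -
    have "dM k (dM j Z) = dM j (dM k Z)" by (simp add: vec_eq_iff mderiv_commute)
    moreover have "(\<lambda>i. dt k (dt j (x i))) = (\<lambda>i. dt j (dt k (x i)))" by (simp add: mderiv_commute)
    ultimately show ?thesis using dd[of k j] dd[of j k] by simp
  qed
  \<comment> \<open>The inverse Jacobian recovers each single matrix \<open>w a\<close> from the
    connection matrices \<open>?M j\<close>.\<close>
  have lin: "(\<Sum>j\<in>UNIV. smult_mat (J $ j $ a) (?M j)) = kmat (w a)" for a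
  proof -
    have "(\<Sum>j\<in>UNIV. smult_mat (J $ j $ a) (?M j)) = (\<Sum>i\<in>UNIV. smult_mat (\<Sum>j\<in>UNIV. dt j (x i) * J $ j $ a) (kmat (w i)))"
      unfolding conn_sum_def
      by (simp add: smult_mat_sum smult_mat_simps sum_smult_mat mult.commute[of "J $ _ $ _"] del: smult_mat_nth) (rule sum.swap)
    also have "\<dots> = (\<Sum>i\<in>UNIV. smult_mat (mat 1 $ i $ a) (kmat (w i)))"
      unfolding J[symmetric] by (simp add: matrix_matrix_mult_def)
    also have "\<dots> = (\<Sum>i\<in>UNIV. if i = a then kmat (w i) else 0)"
      by (rule sum.cong) (auto simp: mat_def vec_eq_iff)
    finally show ?thesis by simp
  qed
  have prod: "kmat (w i) ** (kmat (w k) ** Z) = (\<Sum>j\<in>UNIV. \<Sum>l\<in>UNIV. smult_mat (J $ j $ i * J $ l $ k) (?M j ** (?M l ** Z)))" for i k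
    unfolding lin[symmetric]
    by (simp add: matrix_sum_left matrix_sum_right smult_mat_simps smult_mat_sum)
      (rule trans[OF sum.swap], simp add: mult.commute)
  have "kmat (w i) ** (kmat (w k) ** Z) = kmat (w k) ** (kmat (w i) ** Z)"
    unfolding prod
  proof (rule trans[OF sum.swap], intro sum.cong refl)
    fix l j
    show "smult_mat (J $ j $ i * J $ l $ k) (?M j ** (?M l ** Z)) = smult_mat (J $ l $ k * J $ j $ i) (?M l ** (?M j ** Z))"
      by (simp only: comm[of j l] mult.commute[of "J $ j $ i"])
  qed
  \<comment> \<open>Z is not assumed invertible, so it is removed by evaluating at the point, where
    it equals 1; the constant matrices are unaffected.\<close>
  then have "map_matrix ev0 (kmat (w i) ** (kmat (w k) ** Z)) = map_matrix ev0 (kmat (w k) ** (kmat (w i) ** Z))" by simp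
  then have "kmat (w i) ** kmat (w k) = (kmat (w k) ** kmat (w i) :: ('q, 's, 'k) ser^'s^'s)"
    by (simp only: map_matrix_rhom[OF rhom_ev0] ev0_kmat Z(2) matrix_mul_rid)
  then have eq: "kmat (w i ** w k) = (kmat (w k ** w i) :: ('q, 's, 'k) ser^'s^'s)"
    by (simp only: map_matrix_rhom[OF rhom_sconst])
  have "(w i ** w k) $ r $ s = (w k ** w i) $ r $ s" for r s
  proof -
    have "sconst ((w i ** w k) $ r $ s) = (sconst ((w k ** w i) $ r $ s) :: ('q, 's, 'k) ser)"
      using eq by (metis nth_map_matrix)
    then show ?thesis by (rule sconst_inject)
  qed
  then show ?thesis by (simp add: vec_eq_iff)
qed

section \<open>Uniqueness of fundamental solutions in the \<open>Q\<close>-direction\<close>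

text \<open>The coefficient of \<open>Q\<^sup>d\<close>, \<open>d \<noteq> 0\<close>, satisfies \<open>d \<hbar> N = [N, p]\<close>. Iterating expresses each \<open>\<hbar>\<close>-coefficient
  of \<open>N\<close> by arbitrarily high ones, which tend to zero, with bounded factors.\<close>
lemma bounded_uniqueness:
  fixes N :: "('q::finite, 's::finite, 'k::complete_valuation_domain) ser^'s^'s" and p :: "'q \<Rightarrow> 'k^'s^'s"
  assumes bound: "\<And>a n i j. absK (mpow (p a) n $ i $ j) \<le> B"
    and eq: "\<And>a. smult_mat hbar (qM a N) = N ** kmat (p a) - kmat (p a) ** N"
  shows "map_matrix at_Q0 N = N"
proof -
  have "mcoeff (N $ i $ j) e = 0" if e: "e (Inl a) \<noteq> 0" for e a i j
  proof -
    define d where "d = e (Inl a)"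
    define P where "P = p a"
    define n where "n k = (\<chi> i j. coeff (N $ i $ j) e k)" for k
    have B: "0 \<le> B" using bound[of a 0 undefined undefined] absK_nonneg order_trans by blast
    obtain u :: 'k where u: "of_nat d * u = 1" "absK u = 1"
      using of_nat_inverseK[of d] e by (auto simp: d_def)
    \<comment> \<open>Compare coefficients of \<hbar>^(k+1): on the left the factor \<hbar> lowers
      the index to k, and u inverts the degree d in Q^a.\<close>
    have rec: "n k = smult_mat u (n (k + 1) ** P - P ** n (k + 1))" for k
    proof -
      have "(n (k + 1) ** P - P ** n (k + 1)) $ i $ j = of_nat d * n k $ i $ j" for i j
      proof -
        have "coeff ((N ** kmat P - kmat P ** N) $ i $ j) e (k + 1) = (n (k + 1) ** P - P ** n (k + 1)) $ i $ j"
          by (simp add: n_def matrix_matrix_mult_def coeff_sum coeff_mult_sconst)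
        moreover have "coeff (smult_mat hbar (qM a N) $ i $ j) e (k + 1) = of_nat d * n k $ i $ j"
          by (simp add: n_def d_def) (simp add: coeff_def mcoeff_QdQ)
        ultimately show ?thesis unfolding P_def using eq[of a] by simp
      qed
      then have "smult_mat u (n (k + 1) ** P - P ** n (k + 1)) $ i $ j = (of_nat d * u) * n k $ i $ j" for i j
        by (simp add: mult_ac)
      then show ?thesis by (simp add: vec_eq_iff u)
    qed
    \<comment> \<open>Each use of \<open>rec\<close> puts one more P on the left or on the right, so
      the induction carries arbitrary powers on both sides. Each power costs a factor B whatever its
      exponent, and the ultrametric inequality makes the doubling of terms free.\<close>
    have bd: "absK ((mpow P r ** (n k ** mpow P s)) $ i $ j) \<le> B * B * \<epsilon>"
      if "\<And>i j. absK (n (k + int m) $ i $ j) \<le> \<epsilon>" "0 \<le> \<epsilon>" for m k r s i j \<epsilon>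
      using that
    proof (induction m arbitrary: k r s i j)
      case 0
      have "absK ((n k ** mpow P s) $ l $ j) \<le> B * \<epsilon>" for l
        unfolding matrix_matrix_mult_def using 0 B bound[of a s] mult_mono[OF 0(1) bound[of a s], simplified]
        by (auto simp: absK_mult mult.commute P_def intro!: absK_sum mult_mono)
      then show ?case
        unfolding matrix_matrix_mult_def[of "mpow P r"] using 0 B bound[of a r]
        by (auto simp: absK_mult mult.assoc P_def intro!: absK_sum mult_mono)
    next
      case (Suc m)
      have hyp: "absK (n ((k + 1) + int m) $ i $ j) \<le> \<epsilon>" for i j
        using Suc.prems(1)[of i j] by (simp add: ac_simps)
      have "mpow P r ** (n k ** mpow P s) = smult_mat u (mpow P r ** (n (k + 1) ** mpow P (Suc s)) -
          mpow P (Suc r) ** (n (k + 1) ** mpow P s))"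
        by (subst rec) (simp add: mpow_Suc2[of P r] matrix_diff_ldistrib matrix_diff_rdistrib matrix_mul_assoc smult_mat_simps del: mpow_Suc, simp add: matrix_mul_assoc)
      then have "absK ((mpow P r ** (n k ** mpow P s)) $ i $ j) =
          absK ((mpow P r ** (n (k + 1) ** mpow P (Suc s))) $ i $ j - (mpow P (Suc r) ** (n (k + 1) ** mpow P s)) $ i $ j)"
        by (simp add: absK_mult u)
      also have "\<dots> \<le> B * B * \<epsilon>"
        by (rule order_trans[OF absK_diff] max.boundedI)+ (intro Suc.IH hyp Suc.prems)+
      finally show ?case .
    qed
    have small: "absK (n k $ i $ j) \<le> B * B * \<epsilon>" if eps: "0 < \<epsilon>" for k i j \<epsilon>
    proof -
      have "\<forall>x. \<exists>M. \<forall>l\<ge>M. absK (n l $ fst x $ snd x) < \<epsilon>"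
      proof
        fix x
        obtain M where "\<And>l. l \<ge> M \<Longrightarrow> absK (hcoeff (mcoeff (N $ fst x $ snd x) e) l) < \<epsilon>"
          using hcoeff_small[OF eps, of "mcoeff (N $ fst x $ snd x) e"] by blast
        then show "\<exists>M. \<forall>l\<ge>M. absK (n l $ fst x $ snd x) < \<epsilon>"
          by (intro exI[of _ M]) (simp add: n_def coeff_def)
      qed
      then have "\<exists>M. \<forall>x. \<forall>l\<ge>M x. absK (n l $ fst x $ snd x) < \<epsilon>" by (rule choice)
      then obtain M where M: "\<forall>x. \<forall>l\<ge>M x. absK (n l $ fst x $ snd x) < \<epsilon>" ..
      define M' where "M' = Max (range M)"
      have le: "M x \<le> M'" for x unfolding M'_def by (intro Max_ge) auto
      \<comment> \<open>If k is already beyond M', then \<open>nat (M' - k)\<close> is 0; otherwise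
        the index is exactly M'.\<close>
      have "absK (n (k + int (nat (M' - k))) $ i $ j) \<le> \<epsilon>" for i j
      proof -
        have "M (i, j) \<le> k + int (nat (M' - k))" using le[of "(i, j)"] by simp
        then have "absK (n (k + int (nat (M' - k))) $ fst (i, j) $ snd (i, j)) < \<epsilon>" using M by blast
        then show ?thesis by simp
      qed
      from bd[OF this, of 0 0] show ?thesis using that by simp
    qed
    have "n k $ i $ j = 0" for k
    proof -
      have "absK (n k $ i $ j) \<le> \<epsilon>" if "0 < \<epsilon>" for \<epsilon>
      proof -
        \<comment> \<open>Dividing by B B + 1 and not by B B covers the case B = 0.\<close>
        have "absK (n k $ i $ j) \<le> B * B * (\<epsilon> / (B * B + 1))"
          using that B by (intro small divide_pos_pos) (simp_all add: add_nonneg_pos)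
        also have "\<dots> \<le> \<epsilon>"
        proof -
          have "0 < B * B + 1" using B by (simp add: add_nonneg_pos)
          then have "B * B * (\<epsilon> / (B * B + 1)) = \<epsilon> * (B * B) / (B * B + 1)" by simp
          also have "\<dots> \<le> \<epsilon>"
            using \<open>0 < B * B + 1\<close> that by (subst pos_divide_le_eq) (simp_all add: algebra_simps)
          finally show ?thesis .
        qed
        finally show ?thesis .
      qed
      then have "absK (n k $ i $ j) \<le> 0" by (rule field_le_epsilon[where y = 0, simplified])
      then show ?thesis using absK_nonneg[of "n k $ i $ j"] absK_eq_0[of "n k $ i $ j"] by simp
    qed
    then show ?thesis by (intro hcoeff_inject_ext) (simp add: n_def coeff_def)
  qed
  then show ?thesis by (auto simp: vec_eq_iff at_Q0_def intro!: mps_eqI)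
qed

lemma (in point) ev0_eval_at: "(\<lambda>f. at_Q0 (eval_at b f)) = ev0"
  by (simp add: fun_eq_iff ev0_def eval_at_ev)

lemma matrix_left_cancel:
  fixes L :: "'a::comm_ring_1^'n^'n"
  assumes "L ** K = mat 1" "L ** A = L ** B" shows "A = B"
proof -
  have "K ** L = mat 1" by (rule matrix_left_right_inverse_comm[OF assms(1)])
  then have "A = K ** (L ** A)" by (simp add: matrix_mul_assoc)
  also have "\<dots> = B" using \<open>K ** L = mat 1\<close> by (simp add: assms(2) matrix_mul_assoc)
  finally show ?thesis .
qed

text \<open>Invertibility lifts from Q = 0: \<open>det M * det L\<close> is 1 - y with y vanishing
  at Q = 0, so y has no constant term and the geometric series inverts 1 - y.\<close>

lemma invertible_at_Q0:
  fixes L :: "('q::finite, 's::finite, 'k::complete_valuation_domain) ser^'n^'n"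
  assumes "M ** map_matrix at_Q0 L = mat 1" "map_matrix at_Q0 M = M"
  obtains K where "L ** K = mat 1" "K ** L = mat 1"
proof -
  have 1: "det M * at_Q0 (det L) = 1"
    using arg_cong[OF assms(1), of det] by (simp add: det_mul rhom_det[OF rhom_at_Q0])
  have 2: "at_Q0 (det M) = det M"
    using assms(2) by (metis rhom_det[OF rhom_at_Q0])
  define y where "y = 1 - det M * det L"
  have "at_Q0 y = 0" by (simp add: y_def 1 2)
  then have "mcoeff (at_Q0 y) (\<lambda>_. 0) = 0" by simp
  then have "mcoeff y (\<lambda>_. 0) = 0" by (simp add: at_Q0_def)
  then obtain z where "(1 - y) * z = 1" using topnil_geometric[OF topnil_no_const] by blast
  then have "det L * (det M * z) = 1" by (simp add: y_def mult_ac)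
  then show thesis using det_unit_inverse that by blast
qed

text \<open>The analytic core, free of modules. L and Z share the connection matrices W and P; only
  the right factors p and p' and the normalisations, at b and at b', differ. The exponential is
  stated for the inverse D of C, and with \<hbar> flipped, because that is the form in which it
  enters the cone.\<close>

lemma solutions_related:
  fixes L Z G0 H0 :: "('q::finite, 's::finite, 'k::complete_valuation_domain) ser^'s^'s"
    and p :: "'q \<Rightarrow> 'k^'s^'s"
  assumes b: "O_point b" and T: "centered T b" and b': "O_point b'"
    and W0: "\<And>j. map_matrix at_Q0 (W j) = conn_sum (\<lambda>i. dt j (at_Q0 (T i))) w"
    and L: "\<And>j. smult_mat hbar (dM j L) = - (W j ** L)"
      "\<And>a. smult_mat hbar (qM a L) = L ** kmat (p a) - P a ** L"
      "map_matrix (\<lambda>f. at_Q0 (eval_at b f)) L = mat 1"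
    and Z: "\<And>j. smult_mat hbar (dM j Z) = - (W j ** Z)"
      "\<And>a. smult_mat hbar (qM a Z) = Z ** p' a - P a ** Z"
      "map_matrix (\<lambda>f. at_Q0 (eval_at b' f)) Z = G0"
    and G0: "G0 ** H0 = mat 1" "map_matrix at_Q0 H0 = H0" "\<And>a. kmat (p a) ** G0 = G0 ** p' a"
    and bound: "\<And>a n i j. absK (mpow (p a) n $ i $ j) \<le> B"
  obtains C D K where "Z = L ** (C ** G0)" "C ** D = mat 1" "L ** K = mat 1"
    "map_matrix hflip D = mat_exp (conn_sum (\<lambda>i. hpow (-1) * at_Q0 (b' (T i))) w)"
    "\<And>i j. C $ i $ j \<in> t_free"
proof -
  interpret B: point b by standard (rule b)
  interpret B': point b' by standard (rule b')
  have Tc: "coord_system T" "\<And>i. b (T i) = 0" using T by (simp_all add: centered_def)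
  have TB: "T i \<in> ringOB" "coeff (T i) (\<lambda>_. 0) 0 \<in> mK" for i
    using Tc(1) by (simp_all add: coord_system_def)
  define x where "x i = at_Q0 (T i)" for i
  have xB: "x i \<in> ringOB" for i by (simp add: x_def at_Q0_mem TB)
  have xt: "topnil (x i)" for i
  proof (rule topnil_ringOB[OF xB])
    have "coeff (x i) (\<lambda>_. 0) 0 = coeff (T i) (\<lambda>_. 0) 0" by (simp add: x_def at_Q0_def coeff_def)
    then show "coeff (x i) (\<lambda>_. 0) 0 \<in> mK" using TB by simp
  qed
  have xQ: "x i \<in> Q_free" for i by (simp add: x_def at_Q0_mem)
  have xb: "B.ev0 (x i) = 0" for i
    by (simp add: x_def B.ev0_simps B.ev0_ringOB TB Tc)
  have xb': "B'.ev0 (x i) = at_Q0 (b' (T i))" for i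
    by (simp add: x_def B'.ev0_simps B'.ev0_ringOB TB)
  define L0 where "L0 = map_matrix at_Q0 L"
  have L0: "smult_mat hbar (dM j L0) = - (conn_sum (\<lambda>i. dt j (x i)) w ** L0)" for j
  proof -
    have "smult_mat hbar (dM j L0) = map_matrix at_Q0 (smult_mat hbar (dM j L))"
      by (simp add: L0_def vec_eq_iff at_Q0_dt)
    also have "\<dots> = - (map_matrix at_Q0 (W j) ** L0)"
      by (simp only: L map_matrix_rhom[OF rhom_at_Q0] L0_def)
    finally show ?thesis by (simp add: W0 x_def)
  qed
  have L0Q: "map_matrix at_Q0 L0 = L0" by (simp add: L0_def vec_eq_iff)
  have L0b: "map_matrix B.ev0 L0 = mat 1"
    using L(3) by (simp add: B.ev0_eval_at L0_def map_matrix_map B.ev0_simps)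
  \<comment> \<open>\<open>flat_commute\<close> is applied at Q = 0, so the Jacobian matrix and its
    inverse are restricted there as well.\<close>
  obtain J where J: "(\<chi> i j. dt j (T i)) ** J = mat 1" using jacobian_inverse[OF Tc(1)] by blast
  have "map_matrix at_Q0 ((\<chi> i j. dt j (T i)) ** J) = (mat 1 :: ('q, 's, 'k) ser^'s^'s)"
    by (simp only: J map_matrix_rhom[OF rhom_at_Q0])
  moreover have "map_matrix at_Q0 (\<chi> i j. dt j (T i)) = (\<chi> i j. dt j (x i))"
    by (simp add: vec_eq_iff x_def at_Q0_dt)
  ultimately have J0: "(\<chi> i j. dt j (x i)) ** map_matrix at_Q0 J = mat 1"
    by (simp only: map_matrix_rhom[OF rhom_at_Q0])
  have w: "w i ** w k = w k ** w i" for i k by (rule B.flat_commute[OF J0 L0 L0b])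
  define E where "E y = mat_exp (conn_sum (\<lambda>i. hpow (-1) * y i) w)" for y :: "'s \<Rightarrow> ('q, 's, 'k) ser"
  have E1: "E x ** L0 = mat 1"
    unfolding E_def by (rule B.exp_solution[OF xt xQ xb w L0 L0Q L0b])
  have nxt: "topnil (- x i)" for i using topnil_mult[OF xt, of "- 1" i] by simp
  have hnt: "topnil (hpow (-1) * - x i)" for i by (rule topnil_mult[OF nxt])
  have Emap: "map_matrix h (E (\<lambda>i. - x i)) = mat_exp (conn_sum (\<lambda>i. h (hpow (-1)) * - h (x i)) w)"
    if "rhom h" "ser_cont h" "\<And>i. map_matrix h (kmat (w i)) = kmat (w i)" for h
    unfolding E_def by (subst map_mat_exp_conn_sum[OF hnt that]) (simp only: rhom_simps[OF that(1)])
  \<comment> \<open>This replaces an addition law for exponentials: the exponential of the opposite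
    exponent satisfies the same equations and normalisation as L0, so \<open>exp_solution\<close>
    applies to it too. Cancelling \<open>E x\<close> then identifies L0 with it.\<close>
  have E2: "E x ** E (\<lambda>i. - x i) = mat 1"
    unfolding E_def[of x]
  proof (rule B.exp_solution[OF xt xQ xb w])
    fix j
    have "smult_mat hbar (dM j (E (\<lambda>i. - x i))) = conn_sum (\<lambda>i. hbar * (hpow (-1) * dt j (- x i))) w ** E (\<lambda>i. - x i)"
      unfolding E_def by (subst dM_mat_exp[OF nxt w]) (simp only: smult_mat_mult(1)[symmetric] smult_conn_sum)
    also have "(\<lambda>i. hbar * (hpow (-1) * dt j (- x i))) = (\<lambda>i. - dt j (x i))"
      by (simp only: mult.assoc[symmetric] hpow_inverse mult_1 mderiv_minus)
    finally show "smult_mat hbar (dM j (E (\<lambda>i. - x i))) = - (conn_sum (\<lambda>i. dt j (x i)) w ** E (\<lambda>i. - x i))"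
      by (simp only: uminus_conn_sum[symmetric] matrix_minus_left)
    show "map_matrix at_Q0 (E (\<lambda>i. - x i)) = E (\<lambda>i. - x i)"
      by (subst Emap[OF rhom_at_Q0 ser_cont_at_Q0 kmat_fixed(1)]) (simp add: E_def at_Q0_Q_free xQ)
    show "map_matrix B.ev0 (E (\<lambda>i. - x i)) = mat 1"
      by (subst Emap[OF B.rhom_ev0 B.ser_cont_ev0 B.ev0_kmat]) (simp add: xb conn_sum_0 mat_exp_0)
  qed
  have L0E: "L0 = E (\<lambda>i. - x i)" by (rule matrix_left_cancel[OF E2]) (simp only: E1 E2)
  have hxt: "topnil (hpow (-1) * x i)" for i by (rule topnil_mult[OF xt])
  have EQ: "map_matrix at_Q0 (E x) = E x"
    unfolding E_def by (subst map_mat_exp_conn_sum[OF hxt rhom_at_Q0 ser_cont_at_Q0 kmat_fixed(1)])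
      (simp add: at_Q0_Q_free xQ)
  obtain K where K: "L ** K = mat 1" "K ** L = mat 1"
    using invertible_at_Q0[OF E1[unfolded L0_def] EQ] by blast
  \<comment> \<open>D below is the value of L at b' and Q = 0, and C is its inverse: the correction
    that normalises L at b' instead of b.\<close>
  define C where "C = map_matrix B'.ev0 (E x)"
  define D where "D = map_matrix B'.ev0 L"
  have DL0: "D = map_matrix B'.ev0 L0" by (simp add: D_def L0_def map_matrix_map B'.ev0_simps)
  have CD: "C ** D = mat 1"
    unfolding C_def DL0
    by (simp only: map_matrix_rhom(1)[OF B'.rhom_ev0, symmetric] E1 map_matrix_rhom(2)[OF B'.rhom_ev0])
  have "map_matrix hflip D = map_matrix (\<lambda>f. hflip (B'.ev0 f)) (E (\<lambda>i. - x i))"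
    unfolding DL0 L0E by (rule map_matrix_map)
  also have "\<dots> = mat_exp (conn_sum (\<lambda>i. hflip (B'.ev0 (hpow (-1))) * - hflip (B'.ev0 (x i))) w)"
  proof (rule Emap)
    show "rhom (\<lambda>f. hflip (B'.ev0 f))" by (simp add: rhom_def B'.ev0_simps)
    show "ser_cont (\<lambda>f. hflip (B'.ev0 f))" by (rule ser_cont_comp[OF ser_cont_hflip B'.ser_cont_ev0])
    show "map_matrix (\<lambda>f. hflip (B'.ev0 f)) (kmat (w i)) = kmat (w i)" for i
      by (simp only: map_matrix_map[symmetric] B'.ev0_kmat kmat_fixed)
  qed
  \<comment> \<open>The exponent of D is minus the sum of the c^i w_i over \<hbar>; the flip negates
    1/\<hbar> and fixes c^i, hence the plus sign.\<close>
  also have "(\<lambda>i. hflip (B'.ev0 (hpow (-1))) * - hflip (B'.ev0 (x i))) = (\<lambda>i. hpow (-1) * at_Q0 (b' (T i)))"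
  proof
    fix i
    have "at_Q0 (b' (T i)) \<in> ringOB" using B'.b_mem[OF TB(1)] ringK_subset by (intro at_Q0_mem) blast
    then show "hflip (B'.ev0 (hpow (-1))) * - hflip (B'.ev0 (x i)) = hpow (-1) * at_Q0 (b' (T i))"
      by (simp add: B'.ev0_t_free hpow_mem hflip_hpow_m1 xb' hflip_ringOB)
  qed
  finally have flipD: "map_matrix hflip D = mat_exp (conn_sum (\<lambda>i. hpow (-1) * at_Q0 (b' (T i))) w)" .
  define N where "N = K ** Z"
  have LN: "L ** N = Z" by (simp add: N_def matrix_mul_assoc K)
  have "dM j N = 0" for j
  proof -
    have "smult_mat hbar (dM j (L ** N)) = - (W j ** L) ** N + L ** smult_mat hbar (dM j N)"
      by (simp only: map_matrix_derivation[OF derivation_mderiv] smult_mat_simps smult_mat_mult(1)[symmetric] L)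
        (simp only: smult_mat_mult)
    then have "L ** smult_mat hbar (dM j N) = L ** 0"
      by (simp add: LN Z(1) matrix_minus_left matrix_mul_assoc[symmetric])
    then have "smult_mat hbar (dM j N) = 0" by (rule matrix_left_cancel[OF K(1)])
    then show ?thesis using smult_hbar_cancel[of "dM j N" 0] by (simp add: smult_mat_simps)
  qed
  then have Nt: "N $ i $ j \<in> t_free" for i j
    by (intro t_freeI) (metis nth_map_matrix zero_index)
  have qN: "smult_mat hbar (qM a N) = N ** p' a - kmat (p a) ** N" for a
  proof (rule matrix_left_cancel[OF K(1)])
    have "smult_mat hbar (qM a (L ** N)) = (L ** kmat (p a) - P a ** L) ** N + L ** smult_mat hbar (qM a N)"
      by (simp only: map_matrix_derivation[OF derivation_QdQ] smult_mat_simps smult_mat_mult(1)[symmetric] L)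
        (simp only: smult_mat_mult)
    then show "L ** smult_mat hbar (qM a N) = L ** (N ** p' a - kmat (p a) ** N)"
      by (simp add: LN Z(2) matrix_diff_rdistrib matrix_diff_ldistrib matrix_mul_assoc[symmetric])
        (simp add: matrix_mul_assoc LN algebra_simps)
  qed
  \<comment> \<open>N is free of t, so its restriction to Q = 0 equals its value at b'; evaluating L
    N = Z at b' and Q = 0 turns L into D and Z into G0.\<close>
  have NQ: "map_matrix at_Q0 N = C ** G0"
  proof (rule matrix_left_cancel)
    show "D ** C = mat 1" by (rule matrix_left_right_inverse_comm[OF CD])
    have "map_matrix at_Q0 N = map_matrix B'.ev0 N" using Nt by (simp add: vec_eq_iff B'.ev0_t_free)
    then have "D ** map_matrix at_Q0 N = map_matrix B'.ev0 (L ** N)"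
      by (simp only: D_def map_matrix_rhom[OF B'.rhom_ev0])
    also have "\<dots> = G0" using Z(3) by (simp add: LN B'.ev0_eval_at)
    finally show "D ** map_matrix at_Q0 N = D ** (C ** G0)"
      by (simp add: matrix_mul_assoc \<open>D ** C = mat 1\<close>)
  qed
  have HG: "H0 ** G0 = mat 1" by (rule matrix_left_right_inverse_comm[OF G0(1)])
  \<comment> \<open>The equation for N has p' on one side and p on the other, whereas
    \<open>bounded_uniqueness\<close> takes the same operator on both. Multiplying N on the right by
    H0 converts p' into p.\<close>
  have pH: "p' a ** H0 = H0 ** kmat (p a)" for a
  proof -
    have "H0 ** (kmat (p a) ** G0) ** H0 = H0 ** (G0 ** p' a) ** H0" by (simp only: G0(3))
    then show ?thesis by (simp add: matrix_mul_assoc HG) (simp add: matrix_mul_assoc[symmetric] G0(1))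
  qed
  have "map_matrix at_Q0 (N ** H0) = N ** H0"
  proof (rule bounded_uniqueness[OF bound])
    fix a
    have "mderiv (Inl a) (H0 $ i $ j) = 0" for i j
    proof -
      have "at_Q0 (H0 $ i $ j) = H0 $ i $ j" using G0(2) by (metis nth_map_matrix)
      then show ?thesis using at_Q0_mem(4) mderiv_Q_free by metis
    qed
    then have "qM a H0 = 0" by (simp add: vec_eq_iff)
    then have "smult_mat hbar (qM a (N ** H0)) = (N ** p' a - kmat (p a) ** N) ** H0"
      by (simp only: map_matrix_derivation[OF derivation_QdQ] matrix_zero add_0_right smult_mat_mult(1)[symmetric] qN)
    then show "smult_mat hbar (qM a (N ** H0)) = N ** H0 ** kmat (p a) - kmat (p a) ** (N ** H0)"
      by (simp add: matrix_diff_rdistrib matrix_mul_assoc[symmetric] pH)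
  qed
  then have "N ** H0 = (C ** G0) ** H0" by (simp only: map_matrix_rhom[OF rhom_at_Q0] NQ G0(2))
  then have "N ** H0 ** G0 = (C ** G0) ** H0 ** G0" by simp
  then have "N = C ** G0" by (simp only: matrix_mul_assoc[symmetric] HG matrix_mul_rid)
  then have ZC: "Z = L ** (C ** G0)" using LN by simp
  show thesis
    by (rule that[OF ZC CD K(1) flipD]) (simp add: C_def B'.ev0_mem)
qed

section \<open>Modules, fibers and frames\<close>

locale dmod =
  fixes E :: "('q::finite, 's::finite, 'k::complete_valuation_domain, 'e::ab_group_add) dmodule"
  assumes DB: "DB_module E"
begin

lemma smul_1: "smul E 1 x = x"
  and smul_add: "f \<in> ringOBh \<Longrightarrow> smul E f (x + y) = smul E f x + smul E f y"
  and smul_plus: "f \<in> ringOBh \<Longrightarrow> g \<in> ringOBh \<Longrightarrow> smul E (f + g) x = smul E f x + smul E g x"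
  and smul_mult: "f \<in> ringOBh \<Longrightarrow> g \<in> ringOBh \<Longrightarrow> smul E (f * g) x = smul E f (smul E g x)"
  and Pop_add: "Pop E a (x + y) = Pop E a x + Pop E a y"
  and Wop_add: "Wop E i (x + y) = Wop E i x + Wop E i y"
  and Pop_smul: "f \<in> ringOBh \<Longrightarrow> Pop E a (smul E f x) = smul E f (Pop E a x) + smul E (hbar * QdQ a f) x"
  and Wop_smul: "f \<in> ringOBh \<Longrightarrow> Wop E i (smul E f x) = smul E f (Wop E i x) + smul E (hbar * dt i f) x"
  using DB unfolding DB_module_def by simp_all

lemmas OBh = subring_of[OF subring_ringOBh]
lemmas OBh_sum = subring_of_sum[OF subring_ringOBh]

lemma smul_zero: "f \<in> ringOBh \<Longrightarrow> smul E f 0 = 0"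
  using smul_add[of f 0 0] by simp

lemma zero_smul: "smul E 0 x = 0"
  using smul_plus[of 0 0 x] OBh(2) by simp

lemma smul_sum: "f \<in> ringOBh \<Longrightarrow> smul E f (sum y A) = (\<Sum>i\<in>A. smul E f (y i))"
  by (induction A rule: infinite_finite_induct) (simp_all add: smul_zero smul_add)

lemma sum_smul: "(\<And>i. i \<in> A \<Longrightarrow> f i \<in> ringOBh) \<Longrightarrow> smul E (sum f A) x = (\<Sum>i\<in>A. smul E (f i) x)"
proof (induction A rule: infinite_finite_induct)
  case (insert i A)
  then show ?case by (simp add: smul_plus OBh_sum)
qed (simp_all add: zero_smul)

lemma smul_minus: "f \<in> ringOBh \<Longrightarrow> smul E f (- x) = - smul E f x"
  using smul_add[of f x "- x"] by (simp add: smul_zero eq_neg_iff_add_eq_0 add.commute)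

lemma smul_diff: "f \<in> ringOBh \<Longrightarrow> smul E f (x - y) = smul E f x - smul E f y"
  using smul_add[of f x "- y"] by (simp add: smul_minus)

lemma minus_smul: "f \<in> ringOBh \<Longrightarrow> smul E (- f) x = - smul E f x"
  using smul_plus[of f "- f" x] by (simp add: OBh zero_smul eq_neg_iff_add_eq_0 add.commute)

lemma diff_smul: "f \<in> ringOBh \<Longrightarrow> g \<in> ringOBh \<Longrightarrow> smul E (f - g) x = smul E f x - smul E g x"
  using smul_plus[of f "- g" x] by (simp add: OBh minus_smul)

definition comb :: "('s \<Rightarrow> 'e) \<Rightarrow> ('s \<Rightarrow> ('q, 's, 'k) ser) \<Rightarrow> 'e" where
  "comb g c = (\<Sum>i\<in>UNIV. smul E (c i) (g i))"

lemma comb_add: "(\<And>i. c i \<in> ringOBh) \<Longrightarrow> (\<And>i. d i \<in> ringOBh) \<Longrightarrow> comb g (\<lambda>i. c i + d i) = comb g c + comb g d"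
  by (simp add: comb_def smul_plus sum.distrib)

lemma comb_diff: "(\<And>i. c i \<in> ringOBh) \<Longrightarrow> (\<And>i. d i \<in> ringOBh) \<Longrightarrow> comb g (\<lambda>i. c i - d i) = comb g c - comb g d"
  by (simp add: comb_def diff_smul sum_subtractf)

lemma comb_smul: "f \<in> ringOBh \<Longrightarrow> (\<And>i. c i \<in> ringOBh) \<Longrightarrow> comb g (\<lambda>i. f * c i) = smul E f (comb g c)"
  by (simp add: comb_def smul_mult smul_sum)

lemma comb_delta: "comb g (\<lambda>i. if i = j then 1 else 0) = g j"
proof -
  have "comb g (\<lambda>i. if i = j then 1 else 0) = (\<Sum>i\<in>UNIV. if i = j then g i else 0)"
    unfolding comb_def by (rule sum.cong) (auto simp: smul_1 zero_smul)
  then show ?thesis by simp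
qed

lemma comb_comb:
  assumes y: "\<And>j. y j = comb g (\<lambda>i. A $ i $ j)" and A: "\<And>i j. A $ i $ j \<in> ringOBh" and c: "\<And>j. c j \<in> ringOBh"
  shows "comb y c = comb g (\<lambda>i. \<Sum>j\<in>UNIV. A $ i $ j * c j)"
proof -
  have "comb y c = (\<Sum>j\<in>UNIV. \<Sum>i\<in>UNIV. smul E (A $ i $ j * c j) (g i))"
    by (simp add: comb_def[of y] y) (simp add: comb_def smul_sum c smul_mult[symmetric] A mult.commute)
  also have "\<dots> = comb g (\<lambda>i. \<Sum>j\<in>UNIV. A $ i $ j * c j)"
    by (subst sum.swap) (simp add: comb_def sum_smul OBh A c)
  finally show ?thesis .
qed

definition co :: "('s \<Rightarrow> 'e) \<Rightarrow> 'e \<Rightarrow> 's \<Rightarrow> ('q, 's, 'k) ser" where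
  "co g x = (THE c. (\<forall>i. c i \<in> ringOBh) \<and> x = (\<Sum>i\<in>UNIV. smul E (c i) (g i)))"

lemma module_matrix_co: "module_matrix E g y $ i $ j = co g (y j) i"
  by (simp add: module_matrix_def co_def)

lemma
  assumes g: "module_basis E g"
  shows co_mem: "co g x i \<in> ringOBh" and co_eq: "comb g (co g x) = x"
    and coI: "(\<And>i. c i \<in> ringOBh) \<Longrightarrow> x = comb g c \<Longrightarrow> co g x = c"
proof -
  have ex1: "\<exists>!c. (\<forall>i. c i \<in> ringOBh) \<and> x = (\<Sum>i\<in>UNIV. smul E (c i) (g i))" for x
    using g by (simp add: module_basis_def)
  show "co g x i \<in> ringOBh" "comb g (co g x) = x"
    using theI'[OF ex1[of x]] by (auto simp: co_def[symmetric] comb_def)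
  show "co g x = c" if "\<And>i. c i \<in> ringOBh" "x = comb g c"
    unfolding co_def by (rule the1_equality[OF ex1]) (use that in \<open>simp add: comb_def\<close>)
qed

lemma module_matrix_mem: "module_basis E g \<Longrightarrow> module_matrix E g y $ i $ j \<in> ringOBh"
  by (simp add: module_matrix_co co_mem)

lemma module_matrix_eq: "module_basis E g \<Longrightarrow> y j = comb g (\<lambda>i. module_matrix E g y $ i $ j)"
  using co_eq[of g "y j"] by (simp add: module_matrix_co)

lemma co_add: "module_basis E g \<Longrightarrow> co g (x + y) i = co g x i + co g y i"
  by (rule fun_cong[of _ "\<lambda>i. co g x i + co g y i"], rule coI) (simp_all add: OBh co_mem comb_add co_eq)

lemma co_diff: "module_basis E g \<Longrightarrow> co g (x - y) i = co g x i - co g y i"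
  by (rule fun_cong[of _ "\<lambda>i. co g x i - co g y i"], rule coI) (simp_all add: OBh co_mem comb_diff co_eq)

lemma co_smul: "module_basis E g \<Longrightarrow> f \<in> ringOBh \<Longrightarrow> co g (smul E f x) i = f * co g x i"
  by (rule fun_cong[of _ "\<lambda>i. f * co g x i"], rule coI) (simp_all add: OBh co_mem comb_smul co_eq)

lemma co_0: "module_basis E g \<Longrightarrow> co g 0 i = 0"
  using co_diff[of g 0 0 i] by simp

lemma co_sum: "module_basis E g \<Longrightarrow> co g (sum y A) i = (\<Sum>j\<in>A. co g (y j) i)"
  by (induction A rule: infinite_finite_induct) (simp_all add: co_0 co_add)

lemma co_comb: "module_basis E g \<Longrightarrow> (\<And>i. c i \<in> ringOBh) \<Longrightarrow> co g (comb g c) = c"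
  by (rule coI) simp_all

lemma co_basis: "module_basis E g \<Longrightarrow> co g (g j) i = (if i = j then 1 else 0)"
  using co_comb[of g "\<lambda>i. if i = j then 1 else 0"] by (simp add: OBh comb_delta)

text \<open>Uniqueness of co-ordinates in g gives UV = 1; then VU = 1 holds as well, and this yields
  uniqueness of co-ordinates in g'.\<close>

lemma change_of_basis:
  assumes g: "module_basis E g" and g': "\<And>j. g' j = comb g (\<lambda>i. U $ i $ j)" "\<And>j. g j = comb g' (\<lambda>i. V $ i $ j)"
    and U: "\<And>i j. U $ i $ j \<in> ringOBh" and V: "\<And>i j. V $ i $ j \<in> ringOBh"
  shows "U ** V = mat 1" "module_basis E g'"
proof -
  have "(\<lambda>i. if i = j then 1 else 0) = (\<lambda>i. (U ** V) $ i $ j)" for j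
  proof -
    have 1: "comb g (\<lambda>i. if i = j then 1 else 0) = comb g (\<lambda>i. (U ** V) $ i $ j)"
      using comb_comb[of g' g U "\<lambda>k. V $ k $ j"] g' U V by (simp add: comb_delta matrix_matrix_mult_def)
    have 2: "(U ** V) $ i $ j \<in> ringOBh" for i
      by (simp add: matrix_matrix_mult_def OBh_sum OBh U V)
    have 3: "(if i = j then 1 else 0) \<in> (ringOBh :: ('q, 's, 'k) ser set)" for i by (simp add: OBh)
    have "(\<lambda>i. if i = j then 1 else 0) = co g (comb g (\<lambda>i. if i = j then 1 else 0))"
      by (rule co_comb[OF g 3, symmetric])
    also have "\<dots> = (\<lambda>i. (U ** V) $ i $ j)" unfolding 1 by (rule co_comb[OF g 2])
    finally show ?thesis .
  qed
  then show UV: "U ** V = mat 1" by (auto simp: vec_eq_iff mat_def fun_eq_iff)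
  then have VU: "V ** U = mat 1" by (rule matrix_left_right_inverse_comm)
  show "module_basis E g'"
    unfolding module_basis_def comb_def[symmetric]
  proof (intro allI ex1I conjI)
    fix x
    let ?c = "\<lambda>i. \<Sum>j\<in>UNIV. V $ i $ j * co g x j"
    show "?c i \<in> ringOBh" for i by (simp add: OBh_sum OBh V co_mem[OF g])
    show "x = comb g' ?c"
      using comb_comb[of g g' V "co g x"] g'(2) V co_mem[OF g] co_eq[OF g] by simp
    fix c assume c: "(\<forall>i. c i \<in> ringOBh) \<and> x = comb g' c"
    then have "x = comb g (\<lambda>i. \<Sum>j\<in>UNIV. U $ i $ j * c j)"
      using comb_comb[of g' g U c] g'(1) U by simp
    then have cx: "co g x = (\<lambda>i. \<Sum>j\<in>UNIV. U $ i $ j * c j)"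
      using c by (intro coI[OF g]) (auto simp: OBh_sum OBh U)
    have "V *v (U *v (\<chi> j. c j)) = (\<chi> j. c j)" by (simp add: matrix_vector_mul_assoc VU)
    then have "(V *v (U *v (\<chi> j. c j))) $ i = c i" for i by simp
    then show "c = ?c" unfolding cx by (simp add: matrix_vector_mult_def fun_eq_iff)
  qed
qed

text \<open>The Leibniz rule with a factor \<hbar> that \<open>Pop\<close>, \<open>Wop\<close> and
  the operators \<open>opP\<close>, \<open>opW\<close> of other co-ordinates have in common; d is
  the underlying derivation of scalars.\<close>

definition hder :: "('e \<Rightarrow> 'e) \<Rightarrow> (('q, 's, 'k) ser \<Rightarrow> ('q, 's, 'k) ser) \<Rightarrow> bool" where
  "hder D d \<longleftrightarrow> (\<forall>x y. D (x + y) = D x + D y) \<and>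
     (\<forall>f\<in>ringOBh. d f \<in> ringOBh \<and> (\<forall>x. D (smul E f x) = smul E f (D x) + smul E (hbar * d f) x))"

lemma hder_simps:
  assumes "hder D d"
  shows "D (x + y) = D x + D y" "D 0 = 0" "D (x - y) = D x - D y" "D (sum z A) = (\<Sum>i\<in>A. D (z i))"
    "f \<in> ringOBh \<Longrightarrow> d f \<in> ringOBh" "f \<in> ringOBh \<Longrightarrow> D (smul E f x) = smul E f (D x) + smul E (hbar * d f) x"
proof -
  show a: "D (x + y) = D x + D y" for x y using assms by (simp add: hder_def)
  show z: "D 0 = 0" using a[of 0 0] by simp
  have m: "D (- x) = - D x" for x using a[of x "- x"] z by (simp add: eq_neg_iff_add_eq_0 add.commute)
  show "D (x - y) = D x - D y" using a[of x "- y"] m by simp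
  show "D (sum z A) = (\<Sum>i\<in>A. D (z i))"
    by (induction A rule: infinite_finite_induct) (simp_all add: z a)
qed (use assms in \<open>simp_all add: hder_def\<close>)

lemma hder_Pop: "hder (Pop E a) (QdQ a)"
  by (simp add: hder_def Pop_add Pop_smul OBh mvar_mem mderiv_mem)

lemma hder_Wop: "hder (Wop E i) (dt i)"
  by (simp add: hder_def Wop_add Wop_smul mderiv_mem)

lemma hder_comb:
  assumes D: "hder D d" and g: "\<And>j. D (g j) = comb g (\<lambda>i. A $ i $ j)" and A: "\<And>i j. A $ i $ j \<in> ringOBh"
    and c: "\<And>i. c i \<in> ringOBh"
  shows "D (comb g c) = comb g (\<lambda>i. (\<Sum>j\<in>UNIV. A $ i $ j * c j) + hbar * d (c i))"
proof -
  have "D (comb g c) = comb (\<lambda>j. D (g j)) c + comb g (\<lambda>i. hbar * d (c i))"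
    by (simp add: comb_def hder_simps[OF D] c sum.distrib)
  also have "comb (\<lambda>j. D (g j)) c = comb g (\<lambda>i. \<Sum>j\<in>UNIV. A $ i $ j * c j)"
    by (rule comb_comb[OF g A c])
  finally show ?thesis
    by (subst comb_add) (simp_all add: OBh_sum OBh A c hpow_mem hder_simps[OF D])
qed

text \<open>Both sides collect the g-co-ordinates of \<open>D (g' j)\<close>: expand
  \<open>g' j\<close> in g and apply D, or expand \<open>D (g' j)\<close> in g' and pass to
  g.\<close>

lemma gauge_change:
  assumes D: "hder D d" and g: "module_basis E g" and g': "module_basis E g'"
  shows "module_matrix E g (\<lambda>j. D (g j)) ** module_matrix E g g' + smult_mat hbar (map_matrix d (module_matrix E g g')) =
    module_matrix E g g' ** module_matrix E g' (\<lambda>j. D (g' j))"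
proof -
  let ?A = "module_matrix E g (\<lambda>j. D (g j))" and ?G = "module_matrix E g g'"
    and ?A' = "module_matrix E g' (\<lambda>j. D (g' j))"
  have "(?A ** ?G + smult_mat hbar (map_matrix d ?G)) $ i $ j = (?G ** ?A') $ i $ j" for i j
  proof -
    have "D (g' j) = comb g (\<lambda>i. (\<Sum>k\<in>UNIV. ?A $ i $ k * ?G $ k $ j) + hbar * d (?G $ i $ j))"
      using hder_comb[OF D, of g ?A "\<lambda>i. ?G $ i $ j"] module_matrix_eq[OF g] module_matrix_mem[OF g] by metis
    moreover have "D (g' j) = comb g (\<lambda>i. \<Sum>k\<in>UNIV. ?G $ i $ k * ?A' $ k $ j)"
      using comb_comb[of g' g ?G "\<lambda>k. ?A' $ k $ j"] module_matrix_eq[OF g, of g'] module_matrix_mem[OF g, of g']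
        module_matrix_eq[OF g', of "\<lambda>j. D (g' j)" j] module_matrix_mem[OF g', of "\<lambda>j. D (g' j)"] by simp
    ultimately have "co g (D (g' j)) = (\<lambda>i. (\<Sum>k\<in>UNIV. ?A $ i $ k * ?G $ k $ j) + hbar * d (?G $ i $ j))"
      "co g (D (g' j)) = (\<lambda>i. \<Sum>k\<in>UNIV. ?G $ i $ k * ?A' $ k $ j)"
      by (intro coI[OF g]; simp add: OBh_sum OBh hpow_mem module_matrix_mem g g' hder_simps[OF D])+
    then show ?thesis by (simp add: matrix_matrix_mult_def fun_eq_iff)
  qed
  then show ?thesis by (simp add: vec_eq_iff)
qed

definition PA :: "('s \<Rightarrow> 'e) \<Rightarrow> 'q \<Rightarrow> ('q, 's, 'k) ser^'s^'s" where
  "PA g a = module_matrix E g (\<lambda>j. Pop E a (g j))"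

definition WA :: "('s \<Rightarrow> 'e) \<Rightarrow> 's \<Rightarrow> ('q, 's, 'k) ser^'s^'s" where
  "WA g i = module_matrix E g (\<lambda>j. Wop E i (g j))"

lemma co_opW:
  assumes g: "module_basis E g" and J: "\<And>i j. inv_jac T $ i $ j \<in> ringOBh"
  shows "co g (opW E T i x) k = (\<Sum>j\<in>UNIV. inv_jac T $ j $ i * co g (Wop E j x) k)"
  by (simp add: opW_def co_sum[OF g] co_smul[OF g] J)

lemma co_opP:
  assumes g: "module_basis E g" and T: "\<And>i. T i \<in> ringOBh"
  shows "co g (opP E T a x) k = co g (Pop E a x) k - (\<Sum>i\<in>UNIV. QdQ a (T i) * co g (opW E T i x) k)"
  by (simp add: opP_def co_diff[OF g] co_sum[OF g] co_smul[OF g] T OBh mvar_mem mderiv_mem)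

lemma hder_opW:
  assumes J: "\<And>i j. inv_jac T $ i $ j \<in> ringOBh"
  shows "hder (opW E T i) (dT T i)"
  unfolding hder_def
proof (intro conjI allI ballI)
  fix x y show "opW E T i (x + y) = opW E T i x + opW E T i y"
    by (simp add: opW_def Wop_add smul_add J sum.distrib)
next
  fix f :: "('q, 's, 'k) ser" assume f: "f \<in> ringOBh"
  show "dT T i f \<in> ringOBh" by (simp add: dT_def OBh_sum OBh J mderiv_mem f)
  fix x
  have "opW E T i (smul E f x) = (\<Sum>j\<in>UNIV. smul E (inv_jac T $ j $ i) (smul E f (Wop E j x)) +
      smul E (inv_jac T $ j $ i) (smul E (hbar * dt j f) x))"
    by (simp add: opW_def Wop_smul f smul_add J)
  also have "\<dots> = (\<Sum>j\<in>UNIV. smul E f (smul E (inv_jac T $ j $ i) (Wop E j x)) +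
      smul E (hbar * (inv_jac T $ j $ i * dt j f)) x)"
    by (simp add: smul_mult[symmetric] J f OBh hpow_mem mderiv_mem mult.commute mult.left_commute)
  also have "\<dots> = smul E f (opW E T i x) + smul E (hbar * dT T i f) x"
    by (simp add: sum.distrib opW_def smul_sum f dT_def sum_distrib_left sum_smul OBh hpow_mem J mderiv_mem)
  finally show "opW E T i (smul E f x) = smul E f (opW E T i x) + smul E (hbar * dT T i f) x" .
qed

lemma hder_opP:
  assumes J: "\<And>i j. inv_jac T $ i $ j \<in> ringOBh" and T: "\<And>i. T i \<in> ringOBh"
  shows "hder (opP E T a) (QdQ_in T a)"
  unfolding hder_def
proof (intro conjI allI ballI)
  note W = hder_simps[OF hder_opW[OF J]]
  have q: "QdQ a (T i) \<in> ringOBh" for i by (simp add: OBh mvar_mem mderiv_mem T)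
  fix x y show "opP E T a (x + y) = opP E T a x + opP E T a y"
    by (simp add: opP_def Pop_add W(1) smul_add q sum.distrib)
next
  note W = hder_simps[OF hder_opW[OF J]]
  have q: "QdQ a (T i) \<in> ringOBh" for i by (simp add: OBh mvar_mem mderiv_mem T)
  fix f :: "('q, 's, 'k) ser" assume f: "f \<in> ringOBh"
  have qf: "QdQ a f \<in> ringOBh" by (simp add: OBh mvar_mem mderiv_mem f)
  show "QdQ_in T a f \<in> ringOBh"
    unfolding QdQ_in_def by (intro OBh(5) OBh_sum OBh(6) qf q W(5) f)
  fix x
  have "opP E T a (smul E f x) = smul E f (Pop E a x) + smul E (hbar * QdQ a f) x -
      (\<Sum>i\<in>UNIV. smul E (QdQ a (T i)) (smul E f (opW E T i x)) + smul E (QdQ a (T i)) (smul E (hbar * dT T i f) x))"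
    by (simp add: opP_def Pop_smul f W(6) smul_add q)
  also have "\<dots> = smul E f (Pop E a x) + smul E (hbar * QdQ a f) x -
      (\<Sum>i\<in>UNIV. smul E f (smul E (QdQ a (T i)) (opW E T i x)) + smul E (hbar * (QdQ a (T i) * dT T i f)) x)"
    by (simp only: smul_mult[symmetric] q f OBh hpow_mem W(5) order_refl zero_le_one mult.commute mult.left_commute)
  also have "\<dots> = smul E f (opP E T a x) + smul E (hbar * QdQ_in T a f) x"
    by (simp only: sum.distrib opP_def smul_diff smul_sum f QdQ_in_def right_diff_distrib sum_distrib_left)
      (simp add: diff_smul sum_smul OBh OBh_sum hpow_mem q qf W(5) f)
  finally show "opP E T a (smul E f x) = smul E f (opP E T a x) + smul E (hbar * QdQ_in T a f) x" .
qed

section \<open>Submodules, fibers as quotients, and operators on them\<close>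

definition submod :: "'e set \<Rightarrow> bool" where
  "submod N \<longleftrightarrow> 0 \<in> N \<and> (\<forall>x\<in>N. \<forall>y\<in>N. x + y \<in> N) \<and> (\<forall>f\<in>ringOBh. \<forall>x\<in>N. smul E f x \<in> N)"

lemma submod:
  assumes "submod N"
  shows "0 \<in> N" "x \<in> N \<Longrightarrow> y \<in> N \<Longrightarrow> x + y \<in> N" "f \<in> ringOBh \<Longrightarrow> x \<in> N \<Longrightarrow> smul E f x \<in> N"
    "x \<in> N \<Longrightarrow> - x \<in> N" "x \<in> N \<Longrightarrow> y \<in> N \<Longrightarrow> x - y \<in> N" "(\<And>i. i \<in> A \<Longrightarrow> z i \<in> N) \<Longrightarrow> sum z A \<in> N"
proof -
  show 1: "0 \<in> N" "x \<in> N \<Longrightarrow> y \<in> N \<Longrightarrow> x + y \<in> N" "f \<in> ringOBh \<Longrightarrow> x \<in> N \<Longrightarrow> smul E f x \<in> N" for x y f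
    using assms by (auto simp: submod_def)
  show 2: "- x \<in> N" if "x \<in> N" for x
    using 1(3)[of "- 1" x] that by (simp add: OBh minus_smul smul_1)
  show "x \<in> N \<Longrightarrow> y \<in> N \<Longrightarrow> x - y \<in> N" using 1(2)[of x "- y"] 2 by simp
  show "sum z A \<in> N" if "\<And>i. i \<in> A \<Longrightarrow> z i \<in> N"
    using that by (induction A rule: infinite_finite_induct) (auto intro: 1)
qed

lemma submod_trans: "submod N \<Longrightarrow> x - y \<in> N \<Longrightarrow> y - z \<in> N \<Longrightarrow> x - z \<in> N"
  using submod(2)[of N "x - y" "y - z"] by simp

lemma submod_comm: "submod N \<Longrightarrow> x - y \<in> N \<Longrightarrow> y - x \<in> N"
  using submod(4)[of N "x - y"] by simp

lemma sub_hI: "(\<Sum>i\<in>UNIV. smul E (T i) (x i)) + (\<Sum>a\<in>UNIV. smul E (Qvar a) (y a)) \<in> sub_h E T"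
  by (auto simp: sub_h_def)

lemma sub_0I: "x \<in> sub_h E T \<Longrightarrow> x + smul E hbar z \<in> sub_0 E T"
  by (auto simp: sub_0_def)

lemma submod_sub_h:
  assumes T: "\<And>i. T i \<in> ringOBh" shows "submod (sub_h E T)"
  unfolding submod_def
proof (intro conjI ballI)
  have "(\<Sum>i\<in>UNIV. smul E (T i) 0) + (\<Sum>a\<in>UNIV. smul E (Qvar a) 0) = 0"
    by (simp add: smul_zero T mvar_mem)
  then show "0 \<in> sub_h E T" using sub_hI[of T "\<lambda>_. 0" "\<lambda>_. 0"] by simp
next
  fix u v assume "u \<in> sub_h E T" "v \<in> sub_h E T"
  then obtain x y x' y' where "u = (\<Sum>i\<in>UNIV. smul E (T i) (x i)) + (\<Sum>a\<in>UNIV. smul E (Qvar a) (y a))"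
    "v = (\<Sum>i\<in>UNIV. smul E (T i) (x' i)) + (\<Sum>a\<in>UNIV. smul E (Qvar a) (y' a))"
    unfolding sub_h_def by blast
  then have "u + v = (\<Sum>i\<in>UNIV. smul E (T i) (x i + x' i)) + (\<Sum>a\<in>UNIV. smul E (Qvar a) (y a + y' a))"
    by (simp add: smul_add T mvar_mem sum.distrib ac_simps)
  then show "u + v \<in> sub_h E T" by (simp only: sub_hI)
next
  fix f :: "('q, 's, 'k) ser" and u assume f: "f \<in> ringOBh" and "u \<in> sub_h E T"
  then obtain x y where u: "u = (\<Sum>i\<in>UNIV. smul E (T i) (x i)) + (\<Sum>a\<in>UNIV. smul E (Qvar a) (y a))"
    unfolding sub_h_def by blast
  have c: "smul E f (smul E h z) = smul E h (smul E f z)" if "h \<in> ringOBh" for h z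
    using f that by (simp add: smul_mult[symmetric] mult.commute)
  have "smul E f u = (\<Sum>i\<in>UNIV. smul E (T i) (smul E f (x i))) + (\<Sum>a\<in>UNIV. smul E (Qvar a) (smul E f (y a)))"
    using f unfolding u by (simp add: smul_add smul_sum c T mvar_mem)
  then show "smul E f u \<in> sub_h E T" by (simp only: sub_hI)
qed

lemma sub_h_subset: "sub_h E T \<subseteq> sub_0 E T"
proof
  fix x assume "x \<in> sub_h E T"
  then have "x + smul E hbar 0 \<in> sub_0 E T" by (rule sub_0I)
  then show "x \<in> sub_0 E T" by (simp add: smul_zero hpow_mem)
qed

lemma submod_sub_0:
  assumes T: "\<And>i. T i \<in> ringOBh" shows "submod (sub_0 E T)"
  unfolding submod_def
proof (intro conjI ballI)
  note h = submod[OF submod_sub_h[of T, OF T]]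
  show "0 \<in> sub_0 E T" using sub_h_subset h(1) by blast
  have hb: "hbar \<in> ringOBh" by (simp add: hpow_mem)
  fix u v assume "u \<in> sub_0 E T" "v \<in> sub_0 E T"
  then obtain x y z z' where "u = x + smul E hbar z" "v = y + smul E hbar z'" "x \<in> sub_h E T" "y \<in> sub_h E T"
    unfolding sub_0_def by blast
  then have "u + v = (x + y) + smul E hbar (z + z')" "x + y \<in> sub_h E T"
    by (simp_all add: smul_add hb h)
  then show "u + v \<in> sub_0 E T" by (simp only: sub_0I)
next
  note h = submod[OF submod_sub_h[of T, OF T]]
  have hb: "hbar \<in> ringOBh" by (simp add: hpow_mem)
  fix f :: "('q, 's, 'k) ser" and u assume f: "f \<in> ringOBh" and "u \<in> sub_0 E T"
  then obtain x z where "u = x + smul E hbar z" "x \<in> sub_h E T"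
    unfolding sub_0_def by blast
  then have "smul E f u = smul E f x + smul E hbar (smul E f z)" "smul E f x \<in> sub_h E T"
    using f by (simp_all add: smul_add hb h smul_mult[symmetric] mult.commute)
  then show "smul E f u \<in> sub_0 E T" by (simp only: sub_0I)
qed

lemma hbar_sub_0:
  assumes "\<And>i. T i \<in> ringOBh" "f \<in> ringOBh" shows "smul E (hbar * f) x \<in> sub_0 E T"
proof -
  have "smul E (hbar * f) x = 0 + smul E hbar (smul E f x)" using assms(2) by (simp add: smul_mult hpow_mem)
  moreover have "0 \<in> sub_h E T" using submod(1)[OF submod_sub_h[of T]] assms by blast
  ultimately show ?thesis using sub_0I[of 0 T "smul E f x"] by simp
qed

text \<open>Moving D past T^i, Q^a or \<hbar> leaves a multiple of \<hbar>, which
  \<open>sub_0\<close> absorbs. \<open>sub_h\<close> does not absorb it in general: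
  \<open>opW E T i\<close> applied to T^i x produces the term \<hbar> x.\<close>

lemma hder_sub_0:
  assumes D: "hder D d" and T: "\<And>i. T i \<in> ringOBh" and x: "x \<in> sub_0 E T"
  shows "D x \<in> sub_0 E T"
proof -
  note s = submod[OF submod_sub_0[of T, OF T]]
  have gen: "smul E (T i) y \<in> sub_0 E T" "smul E (Qvar a) y \<in> sub_0 E T" for i a y
  proof -
    have "smul E (T i) y = (\<Sum>j\<in>UNIV. smul E (T j) (if j = i then y else 0)) + (\<Sum>a\<in>UNIV. smul E (Qvar a) 0)"
      by (simp add: smul_zero T mvar_mem if_distrib[of "smul E _"] cong: if_cong)
    then have "smul E (T i) y \<in> sub_h E T" by (simp only: sub_hI)
    then show "smul E (T i) y \<in> sub_0 E T" using sub_h_subset by blast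
    have "smul E (Qvar a) y = (\<Sum>j\<in>UNIV. smul E (T j) 0) + (\<Sum>c\<in>UNIV. smul E (Qvar c) (if c = a then y else 0))"
      by (simp add: smul_zero T mvar_mem if_distrib[of "smul E _"] cong: if_cong)
    then have "smul E (Qvar a) y \<in> sub_h E T" by (simp only: sub_hI)
    then show "smul E (Qvar a) y \<in> sub_0 E T" using sub_h_subset by blast
  qed
  obtain u z y v where x: "x = ((\<Sum>i\<in>UNIV. smul E (T i) (u i)) + (\<Sum>a\<in>UNIV. smul E (Qvar a) (v a))) + smul E hbar z"
    using x unfolding sub_0_def sub_h_def by blast
  have hb: "hbar \<in> ringOBh" by (simp add: hpow_mem)
  have "smul E hbar w \<in> sub_0 E T" for w
    using hbar_sub_0[of T 1 w] T OBh(1) by simp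
  then show ?thesis
    unfolding x by (simp add: hder_simps[OF D] T mvar_mem hb)
      (intro s(2) s(6) gen hbar_sub_0 T hder_simps(5)[OF D] mvar_mem hb)
qed

abbreviation cls :: "'e set \<Rightarrow> 'e \<Rightarrow> 'e set" where
  "cls N x \<equiv> cong_mod N `` {x}"

lemma mem_cls: "y \<in> cls N x \<longleftrightarrow> x - y \<in> N"
  by (simp add: cong_mod_def)

lemma cls_eq: "submod N \<Longrightarrow> cls N x = cls N y \<longleftrightarrow> x - y \<in> N"
proof
  assume N: "submod N" and "cls N x = cls N y"
  moreover have "y \<in> cls N y" using submod(1)[OF N] by (simp only: mem_cls diff_self)
  ultimately have "y \<in> cls N x" by (simp only:)
  then show "x - y \<in> N" by (simp only: mem_cls)
next
  assume N: "submod N" and xy: "x - y \<in> N"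
  have "x - z \<in> N \<longleftrightarrow> y - z \<in> N" for z
    using submod_trans[OF N xy, of z] submod_trans[OF N submod_comm[OF N xy], of z] by blast
  then show "cls N x = cls N y" by (intro set_eqI) (simp only: mem_cls)
qed

lemma qspace_cls: "cls N x \<in> qspace N"
  by (auto simp: qspace_def quotient_def)

lemma qspaceE: "submod N \<Longrightarrow> X \<in> qspace N \<Longrightarrow> x \<in> X \<Longrightarrow> X = cls N x"
proof -
  assume N: "submod N" and X: "X \<in> qspace N" and x: "x \<in> X"
  obtain y where y: "X = cls N y" using X by (auto simp: qspace_def quotient_def)
  then show "X = cls N x" using x N by (simp add: cls_eq mem_cls[symmetric] del: Image_singleton_iff)
qed

lemma qspace_nonempty: "submod N \<Longrightarrow> X \<in> qspace N \<Longrightarrow> \<exists>x. X = cls N x"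
  by (auto simp: qspace_def quotient_def)

lemma qmap_cls:
  assumes N: "submod N" and f: "\<And>x y. x - y \<in> N \<Longrightarrow> f x - f y \<in> N"
  shows "qmap N f (cls N x) = cls N (f x)"
proof -
  have "cls N (f y) = cls N (f x)" if "y \<in> cls N x" for y
    using that f submod_comm[OF N] by (simp add: cls_eq[OF N] mem_cls del: Image_singleton_iff)
  moreover have "x \<in> cls N x" using submod(1)[OF N] by (simp add: mem_cls del: Image_singleton_iff)
  ultimately show ?thesis unfolding qmap_def by blast
qed

lemma qadd_cls:
  assumes N: "submod N" shows "qadd N (cls N x) (cls N y) = cls N (x + y)"
proof -
  have "cls N (u + v) = cls N (x + y)" if "u \<in> cls N x" "v \<in> cls N y" for u v
  proof -
    have "(x - u) + (y - v) \<in> N" using that submod(2)[OF N] by (simp add: mem_cls del: Image_singleton_iff)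
    then have "(x + y) - (u + v) \<in> N" by (simp add: algebra_simps)
    then show ?thesis using cls_eq[OF N] submod_comm[OF N] by blast
  qed
  moreover have "z \<in> cls N z" for z using submod(1)[OF N] by (simp add: mem_cls del: Image_singleton_iff)
  ultimately show ?thesis unfolding qadd_def by blast
qed

lemma comb_cong:
  assumes N: "submod N" and c: "\<And>i. c i \<in> ringOBh" and xy: "\<And>i. x i - y i \<in> N"
  shows "comb x c - comb y c \<in> N"
proof -
  have "comb x c - comb y c = (\<Sum>i\<in>UNIV. smul E (c i) (x i - y i))"
    by (simp add: comb_def sum_subtractf smul_diff c)
  also have "\<dots> \<in> N" by (intro submod(6)[OF N] submod(3)[OF N] c xy)
  finally show ?thesis .
qed

lemma qcomb_cls:
  assumes N: "submod N" and c: "\<And>i. c i \<in> ringOBh" and \<beta>: "\<And>i. \<beta> i = cls N (x i)"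
  shows "qcomb E N c \<beta> = cls N (comb x c)"
proof -
  have "cls N (comb y c) = cls N (comb x c)" if "\<forall>i. y i \<in> \<beta> i" for y
  proof -
    have "x i - y i \<in> N" for i using that by (simp add: \<beta> mem_cls del: Image_singleton_iff)
    then have "comb x c - comb y c \<in> N" by (rule comb_cong[OF N c])
    then show ?thesis using cls_eq[OF N] submod_comm[OF N] by blast
  qed
  moreover have "\<forall>i. x i \<in> \<beta> i" using submod(1)[OF N] by (simp add: \<beta> mem_cls del: Image_singleton_iff)
  ultimately show ?thesis unfolding qcomb_def comb_def by blast
qed

lemma ringK_OBh: "c \<in> ringK \<Longrightarrow> c \<in> ringOBh" for c :: "('q, 's, 'k) ser"
  using ringK_subset by blast

text \<open>\<open>qbasis\<close> transferred from classes to representatives, so that later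
  computations can take place in E itself.\<close>

lemma fiber_coords:
  assumes T: "\<And>i. T i \<in> ringOBh" and fb: "fiber_basis E T \<beta>" and \<beta>: "\<And>i. \<beta> i = cls (sub_0 E T) (x i)"
  shows "\<exists>!c. (\<forall>i. c i \<in> ringK) \<and> y - comb x c \<in> sub_0 E T"
proof -
  note N = submod_sub_0[of T, OF T]
  have "\<forall>X\<in>qspace (sub_0 E T). \<exists>!c. (\<forall>i. c i \<in> ringK) \<and> X = qcomb E (sub_0 E T) c \<beta>"
    using fb unfolding fiber_basis_def qbasis_def by (rule conjunct2)
  then have ex: "\<exists>!c. (\<forall>i. c i \<in> ringK) \<and> cls (sub_0 E T) y = qcomb E (sub_0 E T) c \<beta>"
    by (rule bspec[OF _ qspace_cls])
  have q: "qcomb E (sub_0 E T) c \<beta> = cls (sub_0 E T) (comb x c)" if "\<forall>i. c i \<in> ringK" for c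
    by (rule qcomb_cls[OF N]) (use that \<beta> in \<open>simp_all add: ringK_OBh del: Image_singleton_iff\<close>)
  have "(\<forall>i. c i \<in> ringK) \<and> cls (sub_0 E T) y = qcomb E (sub_0 E T) c \<beta> \<longleftrightarrow>
      (\<forall>i. c i \<in> ringK) \<and> y - comb x c \<in> sub_0 E T" for c
    by (cases "\<forall>i. c i \<in> ringK") (simp_all only: q cls_eq[OF N] simp_thms)
  with ex show ?thesis by simp
qed

lemma fiber_matrix_props:
  assumes T: "\<And>i. T i \<in> ringOBh" and fb: "fiber_basis E T \<beta>" and \<beta>: "\<And>i. \<beta> i = cls (sub_0 E T) (x i)"
    and F: "\<And>j. F (\<beta> j) = cls (sub_0 E T) (y j)"
  shows "fiber_matrix E T \<beta> F $ i $ j \<in> ringK"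
    "y j - comb x (\<lambda>i. fiber_matrix E T \<beta> F $ i $ j) \<in> sub_0 E T"
proof -
  note N = submod_sub_0[of T, OF T]
  have q: "qcomb E (sub_0 E T) c \<beta> = cls (sub_0 E T) (comb x c)" if "\<forall>i. c i \<in> ringK" for c
    by (rule qcomb_cls[OF N]) (use that \<beta> in \<open>simp_all add: ringK_OBh del: Image_singleton_iff\<close>)
  have eq: "(\<forall>i. c i \<in> ringK) \<and> F (\<beta> j) = qcomb E (sub_0 E T) c \<beta> \<longleftrightarrow>
      (\<forall>i. c i \<in> ringK) \<and> y j - comb x c \<in> sub_0 E T" for c
    unfolding F
    by (cases "\<forall>i. c i \<in> ringK") (simp_all only: q cls_eq[OF N] simp_thms)
  have fm: "(\<lambda>i. fiber_matrix E T \<beta> F $ i $ j) = (THE c. (\<forall>i. c i \<in> ringK) \<and> y j - comb x c \<in> sub_0 E T)"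
    by (simp add: fiber_matrix_def eq)
  have "(\<forall>i. fiber_matrix E T \<beta> F $ i $ j \<in> ringK) \<and> y j - comb x (\<lambda>i. fiber_matrix E T \<beta> F $ i $ j) \<in> sub_0 E T"
    using theI'[OF fiber_coords[OF T fb \<beta>, of "y j"]] unfolding fm[symmetric] .
  then show "fiber_matrix E T \<beta> F $ i $ j \<in> ringK"
    "y j - comb x (\<lambda>i. fiber_matrix E T \<beta> F $ i $ j) \<in> sub_0 E T" by blast+
qed

lemma qmap_hder:
  assumes D: "hder D d" and T: "\<And>i. T i \<in> ringOBh"
  shows "qmap (sub_0 E T) D (cls (sub_0 E T) x) = cls (sub_0 E T) (D x)"
  using hder_sub_0[OF D T] by (intro qmap_cls submod_sub_0 T) (simp add: hder_simps(3)[OF D, symmetric])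

end

context dmod
begin

section \<open>Frames and their connection matrices\<close>

lemma fiber_basis_rep:
  assumes T: "\<And>i. T i \<in> ringOBh" and fr: "frame E T \<Phi>" and fb: "fiber_basis E T \<beta>"
  shows "\<beta> i = cls (sub_0 E T) (\<Phi> (\<beta> i))"
proof (rule qspaceE[OF submod_sub_0[OF T]])
  show q: "\<beta> i \<in> qspace (sub_0 E T)" using fb unfolding fiber_basis_def qbasis_def by simp
  show "\<Phi> (\<beta> i) \<in> \<beta> i" using fr q unfolding frame_def by simp
qed

lemma frame_lin:
  assumes T: "\<And>i. T i \<in> ringOBh" and fr: "frame E T \<Phi>" and fb: "fiber_basis E T \<beta>"
    and c: "\<And>i. c i \<in> ringK" and y: "y - comb (\<Phi> \<circ> \<beta>) c \<in> sub_0 E T"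
  shows "\<Phi> (cls (sub_0 E T) y) = comb (\<Phi> \<circ> \<beta>) c"
proof -
  let ?N = "sub_0 E T"
  note N = submod_sub_0[of T, OF T]
  define \<phi> where "\<phi> x = \<Phi> (cls ?N x)" for x
  have F: "\<forall>X\<in>qspace ?N. \<forall>Y\<in>qspace ?N. \<Phi> (qadd ?N X Y) = \<Phi> X + \<Phi> Y"
    "\<forall>c\<in>ringK. \<forall>X\<in>qspace ?N. \<Phi> (qmap ?N (smul E c) X) = smul E c (\<Phi> X)"
    using fr unfolding frame_def by simp_all
  have add: "\<phi> (u + v) = \<phi> u + \<phi> v" for u v
    using F(1) qspace_cls[of ?N u] qspace_cls[of ?N v] unfolding \<phi>_def qadd_cls[OF N, symmetric] by blast
  have "\<phi> 0 = 0" using add[of 0 0] by simp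
  then have sum: "\<phi> (sum z A) = (\<Sum>i\<in>A. \<phi> (z i))" for z and A :: "'s set"
    by (induction A rule: infinite_finite_induct) (simp_all add: add)
  have sm: "\<phi> (smul E a u) = smul E a (\<phi> u)" if a: "a \<in> ringK" for a u
  proof -
    have "qmap ?N (smul E a) (cls ?N u) = cls ?N (smul E a u)"
      using submod(3)[OF N ringK_OBh[OF a]] by (intro qmap_cls N) (simp add: smul_diff[symmetric] ringK_OBh a)
    then show ?thesis using F(2) a qspace_cls[of ?N u] unfolding \<phi>_def by metis
  qed
  have g: "\<phi> ((\<Phi> \<circ> \<beta>) i) = (\<Phi> \<circ> \<beta>) i" for i
    using fiber_basis_rep[OF T fr fb, of i] by (simp add: \<phi>_def)
  have "\<phi> y = \<phi> (comb (\<Phi> \<circ> \<beta>) c)"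
    unfolding \<phi>_def using y cls_eq[OF N] by metis
  also have "\<dots> = comb (\<Phi> \<circ> \<beta>) c"
    by (simp only: comb_def sum sm c g)
  finally show ?thesis by (simp only: \<phi>_def)
qed

lemma frame_coords:
  assumes T: "\<And>i. T i \<in> ringOBh" and fr: "frame E T \<Phi>" and fb: "fiber_basis E T \<beta>" and fb': "fiber_basis E T \<beta>'"
  obtains U where "\<And>i j. U $ i $ j \<in> ringOBh" "\<And>j. (\<Phi> \<circ> \<beta>') j = comb (\<Phi> \<circ> \<beta>) (\<lambda>i. U $ i $ j)"
proof -
  have "\<exists>c. (\<forall>i. c i \<in> ringOBh) \<and> (\<Phi> \<circ> \<beta>') j = comb (\<Phi> \<circ> \<beta>) c" for j
  proof -
    have \<beta>: "\<beta> i = cls (sub_0 E T) ((\<Phi> \<circ> \<beta>) i)" for i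
      using fiber_basis_rep[OF T fr fb] by simp
    obtain c where c: "\<forall>i. c i \<in> ringK" "(\<Phi> \<circ> \<beta>') j - comb (\<Phi> \<circ> \<beta>) c \<in> sub_0 E T"
      using ex1_implies_ex[OF fiber_coords[OF T fb \<beta>, of "(\<Phi> \<circ> \<beta>') j"]] by blast
    have "\<Phi> (cls (sub_0 E T) ((\<Phi> \<circ> \<beta>') j)) = comb (\<Phi> \<circ> \<beta>) c"
      by (rule frame_lin[OF T fr fb]) (use c in blast)+
    moreover have "cls (sub_0 E T) ((\<Phi> \<circ> \<beta>') j) = \<beta>' j"
      using fiber_basis_rep[OF T fr fb', of j] by simp
    ultimately have "(\<Phi> \<circ> \<beta>') j = comb (\<Phi> \<circ> \<beta>) c" by simp
    then show ?thesis using c(1) ringK_OBh by blast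
  qed
  then have "\<forall>j. \<exists>c. (\<forall>i. c i \<in> ringOBh) \<and> (\<Phi> \<circ> \<beta>') j = comb (\<Phi> \<circ> \<beta>) c" by blast
  then have "\<exists>c. \<forall>j. (\<forall>i. c j i \<in> ringOBh) \<and> (\<Phi> \<circ> \<beta>') j = comb (\<Phi> \<circ> \<beta>) (c j)" by (rule choice)
  then obtain c where "\<forall>j. (\<forall>i. c j i \<in> ringOBh) \<and> (\<Phi> \<circ> \<beta>') j = comb (\<Phi> \<circ> \<beta>) (c j)" ..
  then show thesis using that[of "\<chi> i j. c j i"] by simp
qed

text \<open>\<open>frame\<close> provides one fiber basis whose image is a module basis. By
  K-linearity of the frame, the images of any two fiber bases are combinations of each other, so
  \<open>change_of_basis\<close> transfers the property to the given one.\<close>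

lemma frame_basis:
  assumes T: "\<And>i. T i \<in> ringOBh" and fr: "frame E T \<Phi>" and fb: "fiber_basis E T \<beta>"
  shows "module_basis E (\<Phi> \<circ> \<beta>)"
proof -
  obtain \<gamma> where \<gamma>: "fiber_basis E T \<gamma>" "module_basis E (\<Phi> \<circ> \<gamma>)"
    using fr unfolding frame_def by blast
  obtain U where U: "\<And>i j. U $ i $ j \<in> ringOBh" "\<And>j. (\<Phi> \<circ> \<beta>) j = comb (\<Phi> \<circ> \<gamma>) (\<lambda>i. U $ i $ j)"
    by (rule frame_coords[OF T fr \<gamma>(1) fb]) blast
  obtain V where V: "\<And>i j. V $ i $ j \<in> ringOBh" "\<And>j. (\<Phi> \<circ> \<gamma>) j = comb (\<Phi> \<circ> \<beta>) (\<lambda>i. V $ i $ j)"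
    by (rule frame_coords[OF T fr fb \<gamma>(1)]) blast
  show ?thesis by (rule change_of_basis(2)[OF \<gamma>(2) U(2) V(2) U(1) V(1)])
qed

lemma centered_props:
  assumes "centered T b"
  shows "T i \<in> ringOBh" "inv_jac T $ i $ j \<in> ringOBh" "inv_jac T ** (\<chi> i j. dt j (T i)) = mat 1"
proof -
  have T: "coord_system T" using assms by (simp add: centered_def)
  then show "T i \<in> ringOBh" using ringOB_subset unfolding coord_system_def by blast
  obtain J where J: "\<And>i j. J $ i $ j \<in> ringOB" "J ** (\<chi> i j. dt j (T i)) = mat 1" "inv_jac T = J"
    using jacobian_inverse[OF T] by metis
  then show "inv_jac T $ i $ j \<in> ringOBh" "inv_jac T ** (\<chi> i j. dt j (T i)) = mat 1"
    using ringOB_subset by auto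
qed

text \<open>The elements are combinations of multiples of T^i and Q^a, all of which vanish at b and
  Q = 0.\<close>

lemma sub_h_coords:
  assumes b: "O_point b" and T: "centered T b" and g: "module_basis E g" and x: "x \<in> sub_h E T"
  shows "at_Q0 (eval_at b (co g x i)) = 0"
proof -
  interpret B: point b by standard (rule b)
  have ev: "at_Q0 (eval_at b f) = B.ev0 f" for f using fun_cong[OF B.ev0_eval_at] by simp
  note TO = centered_props(1)[OF T]
  have TB: "T i \<in> ringOB" "b (T i) = 0" for i using T by (simp_all add: centered_def coord_system_def)
  have z: "B.ev0 (T i) = 0" "B.ev0 (Qvar a) = 0" for i a
    using B.ev0_ringOB[OF TB(1)] B.ev0_t_free[OF mvar_mem(3)] by (simp_all add: TB)
  obtain u v where "x = (\<Sum>i\<in>UNIV. smul E (T i) (u i)) + (\<Sum>a\<in>UNIV. smul E (Qvar a) (v a))"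
    using x unfolding sub_h_def by blast
  then show ?thesis
    by (simp add: ev co_add[OF g] co_sum[OF g] co_smul[OF g] TO mvar_mem rhom_sum[OF B.rhom_ev0] B.ev0_simps z)
qed

text \<open>The induced splitting commutes with p_a over \<open>K{\<hbar>}\<close> and not only
  modulo \<hbar>. Hence the connection matrix at the point has no terms of positive degree in
  \<hbar>.\<close>

lemma frame_conn:
  assumes b: "O_point b" and T: "centered T b" and fr: "frame E T \<Phi>" and fb: "fiber_basis E T \<beta>"
  shows "map_matrix (\<lambda>f. at_Q0 (eval_at b f)) (conn_A E T \<Phi> \<beta> a) = fiber_matrix E T \<beta> (p_fib E T a)"
proof -
  interpret B: point b by standard (rule b)
  have ev: "at_Q0 (eval_at b f) = B.ev0 f" for f using fun_cong[OF B.ev0_eval_at] by simp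
  let ?g = "\<Phi> \<circ> \<beta>" and ?M = "fiber_matrix E T \<beta> (p_fib E T a)" and ?D = "opP E T a"
  note TO = centered_props(1)[OF T]
  have D: "hder ?D (QdQ_in T a)" by (rule hder_opP[OF centered_props(2)[OF T] TO])
  have g: "module_basis E ?g" by (rule frame_basis[OF TO fr fb])
  have \<beta>: "\<beta> j = cls (sub_0 E T) (?g j)" for j using fiber_basis_rep[OF TO fr fb] by simp
  have F: "p_fib E T a (\<beta> j) = cls (sub_0 E T) (?D (?g j))" for j
    unfolding p_fib_def by (subst \<beta>) (rule qmap_hder[OF D TO])
  note M = fiber_matrix_props[where x = ?g and F = "p_fib E T a" and y = "\<lambda>j. ?D (?g j)", OF TO fb \<beta> F]
  have "map_matrix B.ev0 (conn_A E T \<Phi> \<beta> a) $ i $ j = ?M $ i $ j" for i j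
  proof -
    have "\<beta> j \<in> qspace (sub_0 E T)" using fb unfolding fiber_basis_def qbasis_def by simp
    then have "cls (sub_h E T) (\<Phi> (p_fib E T a (\<beta> j))) = qmap (sub_h E T) ?D (cls (sub_h E T) (\<Phi> (\<beta> j)))"
      using fr unfolding frame_def splitting_0_def by simp
    moreover have "?D (?g j) \<in> qmap (sub_h E T) ?D (cls (sub_h E T) (\<Phi> (\<beta> j)))"
    proof -
      note h = submod(1)[OF submod_sub_h[of T, OF TO]]
      have "?g j \<in> cls (sub_h E T) (\<Phi> (\<beta> j))" "?D (?g j) \<in> cls (sub_h E T) (?D (?g j))"
        by (simp_all only: mem_cls o_apply diff_self h)
      then show ?thesis unfolding qmap_def by blast
    qed
    ultimately have "\<Phi> (p_fib E T a (\<beta> j)) - ?D (?g j) \<in> sub_h E T" by (simp only: mem_cls[symmetric])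
    moreover have "\<Phi> (p_fib E T a (\<beta> j)) = comb ?g (\<lambda>i. ?M $ i $ j)"
      unfolding F by (rule frame_lin[OF TO fr fb M])
    ultimately have "comb ?g (\<lambda>i. ?M $ i $ j) - ?D (?g j) \<in> sub_h E T" by simp
    then have "B.ev0 (co ?g (comb ?g (\<lambda>i. ?M $ i $ j) - ?D (?g j)) i) = 0"
      using sub_h_coords[OF b T g] ev by metis
    then have "B.ev0 (?M $ i $ j) - B.ev0 (co ?g (?D (?g j)) i) = 0"
      by (simp only: co_diff[OF g] co_comb[OF g ringK_OBh[OF M(1)]] B.ev0_simps)
    moreover have "B.ev0 (?M $ i $ j) = ?M $ i $ j" by (rule B.ev0_ringK[OF M(1)])
    ultimately show ?thesis by (simp add: conn_A_def module_matrix_co)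
  qed
  then show ?thesis by (simp add: vec_eq_iff ev)
qed

lemma fiber_matrix_mem:
  assumes T: "centered T b" and fr: "frame E T \<Phi>" and fb: "fiber_basis E T \<beta>"
  shows "fiber_matrix E T \<beta> (p_fib E T a) $ i $ j \<in> ringK" "fiber_matrix E T \<beta> (w_fib E T k) $ i $ j \<in> ringK"
proof -
  note TO = centered_props(1)[OF T] and JO = centered_props(2)[OF T]
  have \<beta>: "\<beta> j = cls (sub_0 E T) (\<Phi> (\<beta> j))" for j by (rule fiber_basis_rep[OF TO fr fb])
  have "p_fib E T a (\<beta> j) = cls (sub_0 E T) (opP E T a (\<Phi> (\<beta> j)))" for j
    unfolding p_fib_def by (subst \<beta>) (rule qmap_hder[OF hder_opP[OF JO TO] TO])
  then show "fiber_matrix E T \<beta> (p_fib E T a) $ i $ j \<in> ringK"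
    by (rule fiber_matrix_props(1)[OF TO fb \<beta>])
  have "w_fib E T k (\<beta> j) = cls (sub_0 E T) (opW E T k (\<Phi> (\<beta> j)))" for j
    unfolding w_fib_def by (subst \<beta>) (rule qmap_hder[OF hder_opW[OF JO] TO])
  then show "fiber_matrix E T \<beta> (w_fib E T k) $ i $ j \<in> ringK"
    by (rule fiber_matrix_props(1)[OF TO fb \<beta>])
qed

lemma conn_Omega_WA:
  assumes T: "centered T b" and g: "module_basis E (\<Phi> \<circ> \<beta>)"
  shows "conn_Omega E T \<Phi> \<beta> i = (\<Sum>j\<in>UNIV. smult_mat (inv_jac T $ j $ i) (WA (\<Phi> \<circ> \<beta>) j))"
  by (simp add: conn_Omega_def vec_eq_iff sum_component WA_def module_matrix_co
      co_opW[OF g centered_props(2)[OF T]])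

lemma conn_A_PA:
  assumes T: "centered T b" and g: "module_basis E (\<Phi> \<circ> \<beta>)"
  shows "conn_A E T \<Phi> \<beta> a = PA (\<Phi> \<circ> \<beta>) a - (\<Sum>i\<in>UNIV. smult_mat (QdQ a (T i)) (conn_Omega E T \<Phi> \<beta> i))"
  by (simp add: conn_Omega_def conn_A_def vec_eq_iff sum_component PA_def module_matrix_co
      co_opP[OF g centered_props(1)[OF T]])

text \<open>Contraction of the Jacobian with its inverse: it recovers the matrices in the directions
  of t from those in the directions of T.\<close>

lemma jac_sum:
  assumes T: "centered T b"
  shows "(\<Sum>i\<in>UNIV. smult_mat (dt k (T i)) (\<Sum>j\<in>UNIV. smult_mat (inv_jac T $ j $ i) (R j))) = R k"
proof -
  have "(\<Sum>i\<in>UNIV. smult_mat (dt k (T i)) (\<Sum>j\<in>UNIV. smult_mat (inv_jac T $ j $ i) (R j))) =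
      (\<Sum>j\<in>UNIV. smult_mat (\<Sum>i\<in>UNIV. inv_jac T $ j $ i * dt k (T i)) (R j))"
    by (simp add: smult_mat_sum smult_mat_simps sum_smult_mat mult.commute[of "dt k _"] del: smult_mat_nth)
      (rule sum.swap)
  also have "\<dots> = (\<Sum>j\<in>UNIV. smult_mat ((inv_jac T ** (\<chi> i j. dt j (T i))) $ j $ k) (R j))"
    by (simp add: matrix_matrix_mult_def)
  also have "\<dots> = (\<Sum>j\<in>UNIV. if j = k then R j else 0)"
    unfolding centered_props(3)[OF T] by (rule sum.cong) (auto simp: mat_def vec_eq_iff)
  finally show ?thesis by simp
qed

text \<open>In the original co-ordinates \<open>t\<close> the differential equations no longer depend on the base point, so that
  those for different points can be compared.\<close>
lemma fundamental_solution_raw: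
  assumes T: "centered T b" and g: "module_basis E (\<Phi> \<circ> \<beta>)" and L: "fundamental_solution E b T \<Phi> \<beta> L"
  shows "smult_mat hbar (dM j L) = - (WA (\<Phi> \<circ> \<beta>) j ** L)"
    "smult_mat hbar (qM a L) = L ** fiber_matrix E T \<beta> (p_fib E T a) - PA (\<Phi> \<circ> \<beta>) a ** L"
    "map_matrix (\<lambda>f. at_Q0 (eval_at b f)) L = mat 1"
proof -
  let ?O = "conn_Omega E T \<Phi> \<beta>" and ?W = "WA (\<Phi> \<circ> \<beta>)"
  have L1: "map_matrix (\<lambda>f. hbar * dT T i f) L + ?O i ** L = 0" for i
    using L by (simp add: fundamental_solution_def)
  have L2: "map_matrix (\<lambda>f. hbar * QdQ_in T a f) L + conn_A E T \<Phi> \<beta> a ** L - L ** fiber_matrix E T \<beta> (p_fib E T a) = 0"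
    using L by (simp add: fundamental_solution_def)
  show "map_matrix (\<lambda>f. at_Q0 (eval_at b f)) L = mat 1"
    using L by (simp add: fundamental_solution_def)
  \<comment> \<open>The defect of the equation in direction j of t. The equations in the
    co-ordinates T say that its combinations with the inverse Jacobian vanish.\<close>
  let ?R = "\<lambda>j. smult_mat hbar (dM j L) + ?W j ** L"
  have "(\<Sum>j\<in>UNIV. smult_mat (inv_jac T $ j $ i) (?R j)) = 0" for i
  proof -
    have "map_matrix (\<lambda>f. hbar * dT T i f) L = (\<Sum>j\<in>UNIV. smult_mat (inv_jac T $ j $ i) (smult_mat hbar (dM j L)))"
      by (simp add: vec_eq_iff sum_component dT_def sum_distrib_left mult_ac)
    then show ?thesis
      using L1[of i] by (simp add: conn_Omega_WA[OF T g] matrix_sum_left smult_mat_simps sum.distrib)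
  qed
  then have "?R j = 0" for j
    using jac_sum[OF T, of j ?R] by (simp add: smult_mat_simps)
  then show "smult_mat hbar (dM j L) = - (?W j ** L)" by (simp add: eq_neg_iff_add_eq_0)
  have group: "h = r - p" if "m = h + s" "c = p - s" "m + c - r = 0" for h r p m s c :: "('q, 's, 'k) ser^'s^'s"
  proof -
    have "r = m + c" using that(3) by simp
    then show ?thesis unfolding that(1,2) by simp
  qed
  \<comment> \<open>\<open>QdQ_in T a\<close> differs from \<open>QdQ a\<close> by T-derivatives of
    L, which the first family of equations turns into connection terms; these cancel against the
    corresponding terms of \<open>conn_A\<close>.\<close>
  have "map_matrix (\<lambda>f. hbar * QdQ_in T a f) L =
      smult_mat hbar (qM a L) - (\<Sum>i\<in>UNIV. smult_mat (QdQ a (T i)) (map_matrix (\<lambda>f. hbar * dT T i f) L))"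
    by (simp add: vec_eq_iff sum_component QdQ_in_def right_diff_distrib sum_distrib_left mult_ac)
  moreover have "map_matrix (\<lambda>f. hbar * dT T i f) L = - (?O i ** L)" for i
    using L1[of i] by (simp add: eq_neg_iff_add_eq_0)
  ultimately have "map_matrix (\<lambda>f. hbar * QdQ_in T a f) L =
      smult_mat hbar (qM a L) + (\<Sum>i\<in>UNIV. smult_mat (QdQ a (T i)) (?O i ** L))"
    by (simp only: smult_mat_simps sum_negf diff_minus_eq_add)
  moreover have "conn_A E T \<Phi> \<beta> a ** L = PA (\<Phi> \<circ> \<beta>) a ** L - (\<Sum>i\<in>UNIV. smult_mat (QdQ a (T i)) (?O i ** L))"
    by (simp add: conn_A_PA[OF T g] matrix_diff_rdistrib matrix_sum_left)
  ultimately show "smult_mat hbar (qM a L) = L ** fiber_matrix E T \<beta> (p_fib E T a) - PA (\<Phi> \<circ> \<beta>) a ** L"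
    using L2 by (rule group)
qed

text \<open>The uniform bound on the powers of \<open>p\<^sub>a\<close> is given at one point only. The classes of the frame elements
  form a basis of the fiber at that point as well, in which \<open>P\<^sub>a\<close> still has the matrix \<open>p\<^sub>a\<close>.\<close>
lemma powers_bounded:
  fixes p :: "'q \<Rightarrow> 'k^'s^'s"
  assumes b: "O_point b" and T: "centered T b" and fb: "fiber_basis E T \<beta>"
    and bound: "\<And>a n i j. ereal C \<le> vK (coeff (fiber_matrix E T \<beta> (p_fib E T a ^^ n) $ i $ j) (\<lambda>_. 0) 0)"
    and g: "module_basis E g" and P: "\<And>a. map_matrix at_Q0 (PA g a) = kmat (p a)"
  shows "\<exists>B. \<forall>a n i j. absK (mpow (p a) n $ i $ j) \<le> B"
proof -
  interpret B: point b by standard (rule b)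
  let ?N = "sub_0 E T"
  note TO = centered_props(1)[OF T] and JO = centered_props(2)[OF T]
  note N = submod_sub_0[of T, OF TO]
  have TB: "T i \<in> ringOB" "b (T i) = 0" for i using T by (simp_all add: centered_def coord_system_def)
  \<comment> \<open>Reduction to \<open>K\<close> at the point, Q = 0 and \<hbar> = 0. It is
    multiplicative on \<open>ringOBh\<close>, where no negative power of \<hbar> can cancel a
    positive one.\<close>
  define ct where "ct f = coeff (B.ev0 f) (\<lambda>_. 0) 0" for f
  have ct: "ct (f + h) = ct f + ct h" "ct (f - h) = ct f - ct h" for f h
    by (simp_all add: ct_def B.ev0_simps)
  have ct_mult: "ct (f * h) = ct f * ct h" if "f \<in> ringOBh" "h \<in> ringOBh" for f h
    using that by (simp add: ct_def B.ev0_simps coeff_0_mult B.ev0_mem)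
  have ct0: "ct 0 = 0" by (simp add: ct_def B.ev0_simps)
  have ct1: "ct 1 = 1" by (simp add: ct_def B.ev0_simps coeff_def mcoeff_1)
  have ct_sum: "ct (sum f A) = (\<Sum>i\<in>A. ct (f i))" for f and A :: "'s set"
    by (simp add: ct_def rhom_sum[OF B.rhom_ev0] coeff_sum)
  have ctQ: "ct (f * h) = 0" if "B.ev0 f = 0" for f h
    using that by (simp add: ct_def B.ev0_simps)
  have ct_hbar: "ct (hbar * h) = 0" if "h \<in> ringOBh" for h
    using B.ev0_mem(3)[OF that] by (simp add: ct_def B.ev0_simps B.ev0_t_free hpow_mem ringOBh_def)
  have ctK: "ct c = coeff c (\<lambda>_. 0) 0" if "c \<in> ringK" for c
    using that by (simp add: ct_def B.ev0_ringK)
  \<comment> \<open>Co-ordinates in g, reduced to \<open>K\<close>. They vanish on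
    \<open>sub_0\<close>, hence descend to the fiber, and send the classes of the \<open>g j\<close>
    to the standard basis.\<close>
  define pr where "pr x = (\<chi> i. ct (co g x i))" for x
  have pr: "pr (x - y) = pr x - pr y" "pr (sum z A) = (\<Sum>i\<in>A. pr (z i))" for x y z and A :: "'s set"
    by (simp_all add: pr_def vec_eq_iff co_diff[OF g] co_sum[OF g] ct ct_sum sum_component)
  have pr_smul: "pr (smul E f x) = ct f *s pr x" if "f \<in> ringOBh" for f x
    using that by (simp add: pr_def vec_eq_iff co_smul[OF g] ct_mult co_mem[OF g])
  have pr_N: "pr x = 0" if x: "x \<in> ?N" for x
  proof -
    obtain u z where uz: "x = u + smul E hbar z" "u \<in> sub_h E T" using x unfolding sub_0_def by blast
    have "B.ev0 (co g u i) = 0" for i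
      using sub_h_coords[OF b T g uz(2)] fun_cong[OF B.ev0_eval_at] by metis
    then have "ct (co g u i) = 0" for i by (simp add: ct_def)
    then show ?thesis
      by (simp add: pr_def vec_eq_iff uz(1) co_add[OF g] co_smul[OF g] hpow_mem ct ct_hbar co_mem[OF g])
  qed
  have pr_eq: "pr x = pr y" if "x - y \<in> ?N" for x y
    using pr_N[OF that] by (simp add: pr)
  have pr_comb: "pr (comb y c) = (\<Sum>i\<in>UNIV. ct (c i) *s pr (y i))" if "\<And>i. c i \<in> ringOBh" for y c
    using that by (simp add: comb_def pr pr_smul)
  have pr_g: "pr (g j) $ i = (if i = j then 1 else 0)" for i j
    by (simp add: pr_def co_basis[OF g] ct0 ct1)
  have "\<exists>x. \<beta> i = cls ?N x" for i
    using fb qspace_nonempty[OF N] unfolding fiber_basis_def qbasis_def by blast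
  then have "\<exists>x. \<forall>i. \<beta> i = cls ?N (x i)" by (intro choice) blast
  then obtain x where x: "\<And>i. \<beta> i = cls ?N (x i)" by blast
  have "\<exists>c. (\<forall>i. c i \<in> ringK) \<and> g j - comb x c \<in> ?N" for j
    using ex1_implies_ex[OF fiber_coords[OF TO fb x]] .
  then have "\<exists>r. \<forall>j. (\<forall>i. r j i \<in> ringK) \<and> g j - comb x (r j) \<in> ?N" by (intro choice) blast
  then obtain r where r: "\<And>j i. r j i \<in> ringK" "\<And>j. g j - comb x (r j) \<in> ?N" by blast
  \<comment> \<open>R expresses the classes of the \<open>g j\<close> in \<beta>, and S expresses
    \<beta> in the classes of the \<open>g j\<close>.\<close>
  define R where "R = (\<chi> i j. ct (r j i))"
  define S where "S = (\<chi> i j. pr (x j) $ i)"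
  have comp: "pr (comb x c) $ i = (\<Sum>k\<in>UNIV. S $ i $ k * ct (c k))" if "\<And>k. c k \<in> ringOBh" for c i
    using that by (simp add: pr_comb sum_component S_def mult.commute)
  have "(S ** R) $ i $ j = (if i = j then 1 else 0)" for i j
    using comp[of "r j" i] pr_eq[OF r(2)[of j]] pr_g[of j i]
    by (simp add: ringK_OBh r(1) matrix_matrix_mult_def R_def)
  then have SR: "S ** R = mat 1" by (simp add: vec_eq_iff mat_def)
  then have RS: "R ** S = mat 1" by (rule matrix_left_right_inverse_comm)
  \<comment> \<open>p_a^n equals S m_n R, where m_n is the matrix of the n-th power in the basis
    \<beta>, bounded by e^(-C); S and R depend neither on n nor on a.\<close>
  have pow: "absK ((mpow (p a) n) $ i $ j) \<le> (MAX ij. absK (S $ fst ij $ snd ij)) * exp (- C) * (MAX ij. absK (R $ fst ij $ snd ij))" for a n i j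
  proof -
    let ?D = "opP E T a"
    have D: "hder ?D (QdQ_in T a)" by (rule hder_opP[OF JO TO])
    have Dn: "(?D ^^ n) x - (?D ^^ n) y \<in> ?N" if "x - y \<in> ?N" for n x y
      using that
    proof (induction n)
      case (Suc n)
      then show ?case using hder_sub_0[OF D TO] by (simp add: hder_simps(3)[OF D, symmetric])
    qed simp
    have pf: "(p_fib E T a ^^ n) (cls ?N y) = cls ?N ((?D ^^ n) y)" for n y
      by (induction n) (simp_all add: p_fib_def qmap_hder[OF D TO] del: Image_singleton_iff)
    have F: "(p_fib E T a ^^ n) (\<beta> j) = cls ?N ((?D ^^ n) (x j))" for n j
      unfolding x by (rule pf)
    define M where "M n = fiber_matrix E T \<beta> (p_fib E T a ^^ n)" for n
    have MK: "M n $ i $ j \<in> ringK" for n i j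
      unfolding M_def by (rule fiber_matrix_props(1)[where F = "p_fib E T a ^^ n", OF TO fb x F])
    have MN: "(?D ^^ n) (x j) - comb x (\<lambda>i. M n $ i $ j) \<in> ?N" for n j
      unfolding M_def
      by (rule fiber_matrix_props(2)[where F = "p_fib E T a ^^ n" and y = "\<lambda>j. (?D ^^ n) (x j)", OF TO fb x F])
    have Dcomb: "?D (comb y c) - comb (\<lambda>i. ?D (y i)) c \<in> ?N" if "\<And>i. c i \<in> ringOBh" for y c
    proof -
      have "?D (comb y c) - comb (\<lambda>i. ?D (y i)) c = (\<Sum>i\<in>UNIV. smul E (hbar * QdQ_in T a (c i)) (y i))"
        using that by (simp add: comb_def hder_simps[OF D] sum.distrib)
      also have "\<dots> \<in> ?N" using that by (intro submod(6)[OF N] hbar_sub_0 TO hder_simps(5)[OF D])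
      finally show ?thesis .
    qed
    define m where "m n = (\<chi> i j. ct (M n $ i $ j))" for n
    have Spr: "pr ((?D ^^ n) (x j)) $ i = (S ** m n) $ i $ j" for n i j
      using comp[of "\<lambda>k. M n $ k $ j" i] pr_eq[OF MN[of n j]]
      by (simp add: ringK_OBh MK matrix_matrix_mult_def m_def)
    \<comment> \<open>On the fiber the operator is linear with matrix \<open>p a\<close>: the
      corrections in \<open>opP\<close> contain \<open>QdQ a (T k)\<close>, which vanishes at Q = 0,
      so that only \<open>Pop\<close> contributes.\<close>
    have Dpr: "pr (?D y) = p a *v pr y" for y
    proof -
      have "pr (?D (g j)) $ i = p a $ i $ j" for i j
      proof -
        have "B.ev0 (QdQ a (T k)) = 0" for k
          using B.ev0_t_free[OF mvar_mem(3), of a] by (simp add: B.ev0_simps)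
        moreover have "ct (co g (Pop E a (g j)) i) = p a $ i $ j"
        proof -
          have "B.ev0 (PA g a $ i $ j) = B.ev0 (at_Q0 (PA g a $ i $ j))" by (simp only: B.ev0_simps)
          also have "at_Q0 (PA g a $ i $ j) = sconst (p a $ i $ j)" using P[of a] by (metis nth_map_matrix)
          finally show ?thesis
            by (simp add: PA_def module_matrix_co ct_def B.ev0_ringK sconst_mem coeff_sconst)
        qed
        ultimately show ?thesis
          by (simp add: pr_def co_opP[OF g TO] ct ct_sum ctQ)
      qed
      moreover have "pr (?D y) = (\<Sum>j\<in>UNIV. ct (co g y j) *s pr (?D (g j)))"
        using pr_eq[OF Dcomb[of "co g y" g]] pr_comb[of "co g y"] by (simp add: co_mem[OF g] co_eq[OF g])
      ultimately show ?thesis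
        by (simp add: vec_eq_iff sum_component matrix_vector_mult_def pr_def mult.commute)
    qed
    have Sm: "S ** m n = mpow (p a) n ** S" for n
    proof (induction n)
      case 0
      have "(S ** m 0) $ i $ j = S $ i $ j" for i j using Spr[of 0 j i] by (simp add: S_def)
      then show ?case by (simp add: vec_eq_iff)
    next
      case (Suc n)
      have "(S ** m (Suc n)) $ i $ j = (p a ** (S ** m n)) $ i $ j" for i j
      proof -
        have "pr ((?D ^^ Suc n) (x j)) $ i = (\<Sum>k\<in>UNIV. p a $ i $ k * pr ((?D ^^ n) (x j)) $ k)"
          by (simp add: Dpr matrix_vector_mult_def)
        then show ?thesis unfolding Spr by (simp add: matrix_matrix_mult_def[of "p a"])
      qed
      then have "S ** m (Suc n) = p a ** (S ** m n)" by (simp add: vec_eq_iff)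
      then show ?case by (simp add: Suc matrix_mul_assoc)
    qed
    have "mpow (p a) n = S ** m n ** R"
      by (simp add: Sm matrix_mul_assoc[symmetric] SR)
    then have eq: "mpow (p a) n $ i $ j = (\<Sum>l\<in>UNIV. (\<Sum>k\<in>UNIV. S $ i $ k * m n $ k $ l) * R $ l $ j)"
      by (simp add: matrix_matrix_mult_def)
    have mC: "absK (m n $ k $ l) \<le> exp (- C)" for k l
      using bound[where a = a and n = n and i = k and j = l] by (simp add: m_def ctK MK absK_le_vK) (simp add: M_def)
    let ?s = "MAX ij. absK (S $ fst ij $ snd ij)" and ?r = "MAX ij. absK (R $ fst ij $ snd ij)"
    have s: "absK (S $ i $ k) \<le> ?s" for i k
      by (rule Max_ge) (simp, rule range_eqI[of _ _ "(i, k)"], simp)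
    have r: "absK (R $ i $ k) \<le> ?r" for i k
      by (rule Max_ge) (simp, rule range_eqI[of _ _ "(i, k)"], simp)
    have pos: "0 \<le> ?s" "0 \<le> ?r" using s r absK_nonneg order_trans by blast+
    show ?thesis
      unfolding eq
      by (intro absK_sum) (auto simp: absK_mult pos intro!: mult_mono s r mC absK_sum mult_nonneg_nonneg)
  qed
  then show ?thesis by blast
qed

end

section \<open>Comparison of the cones\<close>

lemma kmat_coeff:
  assumes "\<And>i j. M $ i $ j \<in> (ringK :: ('q::finite, 's::finite, 'k::complete_valuation_domain) ser set)"
  shows "kmat (\<chi> i j. coeff (M $ i $ j) (\<lambda>_. 0) 0) = M"
  by (simp add: vec_eq_iff ringK_coeff assms)
lemma map_matrix_vector_mult:
  assumes "\<And>i j. A $ i $ j \<in> (ringOh :: ('q::finite, 's::finite, 'k::complete_valuation_domain) ser set)" "\<And>i. h $ i \<in> ringOh"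
  shows "(A *v h) $ i \<in> ringOh"
  unfolding matrix_vector_mult_def
  using assms by (simp add: subring_of_sum[OF subring_ringOh] subring_of[OF subring_ringOh])

text \<open>\<open>G\<close> and \<open>H\<close> preserve the lattice \<open>K{\<hbar>}[[Q]]\<^sup>s\<close> at every point.\<close>
lemma quantum_cone_gauge:
  fixes L L' G H K A B :: "('q::finite, 's::finite, 'k::complete_valuation_domain) ser^'s^'s"
  assumes L': "L' = H ** (L ** A)" and LK: "L ** K = mat 1" and AB: "A ** B = mat 1" and GH: "G ** H = mat 1"
    and G: "\<And>i j. G $ i $ j \<in> ringOBh" and H: "\<And>i j. H $ i $ j \<in> ringOBh"
    and A: "\<And>i j. A $ i $ j \<in> t_free"
  shows "quantum_cone L' = (\<lambda>h. map_matrix hflip B *v h) ` quantum_cone L"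
proof -
  let ?V = "{h :: ('q, 's, 'k) ser^'s. \<forall>i. h $ i \<in> ringOh}"
  have "(\<lambda>h. hbar *s (matrix_inv (map_matrix (\<lambda>f. hflip (eval_at b f)) L') *v h)) ` ?V =
      (\<lambda>h. map_matrix hflip B *v h) ` ((\<lambda>h. hbar *s (matrix_inv (map_matrix (\<lambda>f. hflip (eval_at b f)) L) *v h)) ` ?V)"
    if b: "O_point b" for b
  proof -
    interpret B: point b by standard (rule b)
    define e where "e f = hflip (eval_at b f)" for f
    have e: "rhom e" by (simp add: e_def rhom_def B.eval_at_ev B.ev_1 B.ev_add B.ev_mult)
    have eO: "e f \<in> ringOh" if "f \<in> ringOBh" for f
      using that by (simp add: e_def B.eval_at_ev B.ev_ringOh hflip_mem)
    \<comment> \<open>A is free of t, so evaluation at any point merely flips \<hbar>; its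
      contribution is the same at all points and can be taken out of the union.\<close>
    have eA: "map_matrix e A = map_matrix hflip A"
      using A by (simp add: vec_eq_iff e_def B.eval_at_ev B.ev_t_free)
    note em = map_matrix_rhom(1,2)[OF e]
    have smult_vec: "M *v (c *s v) = c *s (M *v v)" for M c and v :: "('q, 's, 'k) ser^'s"
      by (simp add: vec_eq_iff matrix_vector_mult_def sum_distrib_left mult_ac)
    have inv: "map_matrix e X ** map_matrix e Y = mat 1" if "X ** Y = mat 1" for X Y :: "('q, 's, 'k) ser^'s^'s"
      by (simp only: em(1)[symmetric] that em(2))
    have "map_matrix hflip A ** map_matrix hflip B = mat 1"
      by (simp only: map_matrix_rhom(1)[OF rhom_hflip, symmetric] AB map_matrix_rhom(2)[OF rhom_hflip])
    then have AB': "X ** map_matrix hflip A ** map_matrix hflip B = X" for X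
      by (simp add: matrix_mul_assoc[symmetric])
    have LK': "X ** map_matrix e L ** map_matrix e K = X" for X
      using inv[OF LK] by (simp add: matrix_mul_assoc[symmetric])
    have HG': "map_matrix e H ** map_matrix e G = mat 1"
      by (rule inv) (rule matrix_left_right_inverse_comm[OF GH])
    have invL: "matrix_inv (map_matrix e L) = map_matrix e K" by (rule matrix_inv_unique[OF inv[OF LK]])
    have "map_matrix e L' ** (map_matrix hflip B ** (map_matrix e K ** map_matrix e G)) = mat 1"
      by (simp only: L' em eA matrix_mul_assoc AB' LK' HG')
    then have invL': "matrix_inv (map_matrix e L') = map_matrix hflip B ** (map_matrix e K ** map_matrix e G)"
      by (rule matrix_inv_unique)
    have "(\<lambda>h. map_matrix e G *v h) ` ?V = ?V"
    proof
      show "(\<lambda>h. map_matrix e G *v h) ` ?V \<subseteq> ?V"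
        by (auto intro!: map_matrix_vector_mult eO G)
      show "?V \<subseteq> (\<lambda>h. map_matrix e G *v h) ` ?V"
      proof
        fix h assume h: "h \<in> ?V"
        have "map_matrix e H *v h \<in> ?V" using h by (auto intro!: map_matrix_vector_mult eO H)
        moreover have "h = map_matrix e G *v (map_matrix e H *v h)"
          using inv[OF GH] by (simp add: matrix_vector_mul_assoc)
        ultimately show "h \<in> (\<lambda>h. map_matrix e G *v h) ` ?V" by (rule rev_image_eqI)
      qed
    qed
    then have "(\<lambda>h. map_matrix hflip B *v (hbar *s (map_matrix e K *v h))) ` ?V =
        (\<lambda>h. map_matrix hflip B *v (hbar *s (map_matrix e K *v h))) ` ((\<lambda>h. map_matrix e G *v h) ` ?V)" by simp
    also have "\<dots> = (\<lambda>h. hbar *s (matrix_inv (map_matrix e L') *v h)) ` ?V"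
      by (simp add: image_image invL' matrix_vector_mul_assoc smult_vec matrix_mul_assoc)
    finally show ?thesis by (simp only: image_image invL e_def[abs_def] invL[unfolded e_def[abs_def]])
  qed
  then show ?thesis unfolding quantum_cone_def image_UN by (intro SUP_cong) auto
qed

text \<open>The bases \<beta> and \<beta>' identify elements of the cones with vectors. The exponent
  carries the plus sign, unlike the informal formula: recentering multiplies L on the right by the
  exponential of the sum of the c^i w_i over \<hbar>, and inversion and the flip of \<hbar> in the
  cone each reverse that sign.\<close>

theorem proposition5p5:
  fixes E :: "('q::finite, 's::finite, 'k::complete_valuation_domain, 'e::ab_group_add) dmodule"
    and b b' :: "('q, 's, 'k) ser \<Rightarrow> ('q, 's, 'k) ser"
    and T T' :: "'s \<Rightarrow> ('q, 's, 'k) ser"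
    and \<Phi> \<Phi>' :: "'e set \<Rightarrow> 'e"
    and \<beta> \<beta>' :: "'s \<Rightarrow> 'e set"
    and L L' G G0 :: "(('q, 's, 'k) ser)^'s^'s"
  assumes "big_AQDM E"
    and "O_point b" and "centered T b" and "frame E T \<Phi>" and "fiber_basis E T \<beta>"
    and "\<And>a. map_matrix at_Q0 (conn_A E T \<Phi> \<beta> a) = fiber_matrix E T \<beta> (p_fib E T a)"
    and "\<And>i. map_matrix at_Q0 (conn_Omega E T \<Phi> \<beta> i) = fiber_matrix E T \<beta> (w_fib E T i)"
    and "O_point b'" and "centered T' b'" and "frame E T' \<Phi>'" and "fiber_basis E T' \<beta>'"
    and "G = module_matrix E (\<Phi> \<circ> \<beta>) (\<Phi>' \<circ> \<beta>')"
    and "G0 = map_matrix at_Q0 G"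
    and "\<And>i j. G0 $ i $ j \<in> t_free"
    and "fundamental_solution E b T \<Phi> \<beta> L"
    and "fundamental_solution E b' T' \<Phi>' \<beta>' L'"
  shows "quantum_cone L' =
    (\<lambda>h. matrix_inv (map_matrix hflip G0) *v
          (mat_exp (\<Sum>i\<in>UNIV. map_matrix (\<lambda>f. hpow (- 1) * at_Q0 (b' (T i)) * f)
                                  (fiber_matrix E T \<beta> (w_fib E T i))) *v h)) ` quantum_cone L"
proof -
  note aqdm = assms(1) and b = assms(2) and T = assms(3) and fr = assms(4) and fb = assms(5)
    and A0 = assms(6) and Om0 = assms(7) and b' = assms(8) and T' = assms(9) and fr' = assms(10)
    and fb' = assms(11) and G_def = assms(12) and G0_def = assms(13) and G0t = assms(14)
    and FL = assms(15) and FL' = assms(16)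
  interpret dmod E by standard (use aqdm in \<open>simp add: big_AQDM_def\<close>)
  interpret B': point b' by standard (rule b')
  let ?g = "\<Phi> \<circ> \<beta>" and ?g' = "\<Phi>' \<circ> \<beta>'"
  have g: "module_basis E ?g" by (rule frame_basis[OF centered_props(1)[OF T] fr fb])
  have g': "module_basis E ?g'" by (rule frame_basis[OF centered_props(1)[OF T'] fr' fb'])
  define p where "p a = (\<chi> i j. coeff (fiber_matrix E T \<beta> (p_fib E T a) $ i $ j) (\<lambda>_. 0) 0)" for a
  define w where "w k = (\<chi> i j. coeff (fiber_matrix E T \<beta> (w_fib E T k) $ i $ j) (\<lambda>_. 0) 0)" for k
  have p: "kmat (p a) = fiber_matrix E T \<beta> (p_fib E T a)" for a
    unfolding p_def by (rule kmat_coeff) (rule fiber_matrix_mem[OF T fr fb])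
  have w: "kmat (w k) = fiber_matrix E T \<beta> (w_fib E T k)" for k
    unfolding w_def by (rule kmat_coeff) (rule fiber_matrix_mem[OF T fr fb])
  have qT: "at_Q0 (QdQ a f) = 0" for a and f :: "('q, 's, 'k) ser" by simp
  \<comment> \<open>The two matrices differ by multiples of \<open>QdQ a\<close> applied to the
    co-ordinates, which contain a factor Q^a.\<close>
  have PQ: "map_matrix at_Q0 (conn_A E U \<Psi> \<gamma> a) = map_matrix at_Q0 (PA (\<Psi> \<circ> \<gamma>) a)"
    if "centered U c" "module_basis E (\<Psi> \<circ> \<gamma>)" for U c \<Psi> \<gamma> a
    by (simp only: conn_A_PA[OF that] map_matrix_rhom[OF rhom_at_Q0] map_matrix_rhom_sum[OF rhom_at_Q0] qT)
      (simp add: vec_eq_iff sum_component)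
  have P0: "map_matrix at_Q0 (PA ?g a) = kmat (p a)" for a
    using A0 p by (simp only: PQ[OF T g, symmetric])
  have W0: "map_matrix at_Q0 (WA ?g j) = conn_sum (\<lambda>i. dt j (at_Q0 (T i))) w" for j
  proof -
    have "WA ?g j = (\<Sum>i\<in>UNIV. smult_mat (dt j (T i)) (conn_Omega E T \<Phi> \<beta> i))"
      by (simp only: conn_Omega_WA[OF T g] jac_sum[OF T])
    then show ?thesis
      by (simp only: map_matrix_rhom[OF rhom_at_Q0] map_matrix_rhom_sum[OF rhom_at_Q0] Om0 conn_sum_def w at_Q0_dt)
  qed
  note L = fundamental_solution_raw[OF T g FL] and L' = fundamental_solution_raw[OF T' g' FL']
  define H where "H = module_matrix E ?g' ?g"
  have Gm: "G $ i $ j \<in> ringOBh" and Hm: "H $ i $ j \<in> ringOBh" for i j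
    unfolding G_def H_def by (rule module_matrix_mem[OF g], rule module_matrix_mem[OF g'])
  have GH: "G ** H = mat 1"
    by (rule change_of_basis(1)[OF g module_matrix_eq[where y = ?g', OF g, folded G_def] module_matrix_eq[where y = ?g, OF g', folded H_def] Gm Hm])
  have PG: "PA ?g a ** G + smult_mat hbar (qM a G) = G ** PA ?g' a" for a
    using gauge_change[OF hder_Pop g g'] by (simp add: PA_def G_def)
  have WG: "WA ?g j ** G + smult_mat hbar (dM j G) = G ** WA ?g' j" for j
    using gauge_change[OF hder_Wop g g'] by (simp add: WA_def G_def)
  define p' where "p' a = fiber_matrix E T' \<beta>' (p_fib E T' a)" for a
  \<comment> \<open>L' read in the frame of b; by \<open>gauge_change\<close> it obeys the equations
    with the connection matrices of \<Phi>.\<close>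
  define Z where "Z = G ** L'"
  have Z1: "smult_mat hbar (dM j Z) = - (WA ?g j ** Z)" for j
  proof -
    have "smult_mat hbar (dM j Z) = smult_mat hbar (dM j G) ** L' + G ** smult_mat hbar (dM j L')"
      by (simp only: Z_def map_matrix_derivation[OF derivation_mderiv] smult_mat_simps smult_mat_mult)
    also have "smult_mat hbar (dM j G) = G ** WA ?g' j - WA ?g j ** G"
      by (simp only: WG[symmetric] add_diff_cancel_left')
    finally show ?thesis
      by (simp add: L' Z_def matrix_diff_rdistrib matrix_minus_right matrix_mul_assoc)
  qed
  have Z2: "smult_mat hbar (qM a Z) = Z ** p' a - PA ?g a ** Z" for a
  proof -
    have "smult_mat hbar (qM a Z) = smult_mat hbar (qM a G) ** L' + G ** smult_mat hbar (qM a L')"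
      by (simp only: Z_def map_matrix_derivation[OF derivation_QdQ] smult_mat_simps smult_mat_mult)
    also have "smult_mat hbar (qM a G) = G ** PA ?g' a - PA ?g a ** G"
      by (simp only: PG[symmetric] add_diff_cancel_left')
    finally show ?thesis
      by (simp add: L' Z_def p'_def matrix_diff_rdistrib matrix_diff_ldistrib matrix_mul_assoc)
  qed
  have G0Q: "map_matrix at_Q0 G0 = G0" by (simp add: G0_def vec_eq_iff)
  have evG0: "map_matrix B'.ev0 G0 = G0"
    using G0t G0Q by (simp add: vec_eq_iff B'.ev0_t_free)
  have Z3: "map_matrix (\<lambda>f. at_Q0 (eval_at b' f)) Z = G0"
  proof -
    have "map_matrix B'.ev0 Z = map_matrix B'.ev0 G ** map_matrix B'.ev0 L'"
      by (simp only: Z_def map_matrix_rhom[OF B'.rhom_ev0])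
    also have "map_matrix B'.ev0 L' = mat 1" using L'(3) by (simp only: B'.ev0_eval_at)
    also have "map_matrix B'.ev0 G = map_matrix B'.ev0 G0"
      by (simp add: G0_def vec_eq_iff B'.ev0_simps)
    finally show ?thesis by (simp add: B'.ev0_eval_at evG0)
  qed
  define H0 where "H0 = map_matrix at_Q0 H"
  have GH0: "G0 ** H0 = mat 1"
    by (simp only: G0_def H0_def map_matrix_rhom(1)[OF rhom_at_Q0, symmetric] GH map_matrix_rhom(2)[OF rhom_at_Q0])
  have H0Q: "map_matrix at_Q0 H0 = H0" by (simp add: H0_def vec_eq_iff)
  \<comment> \<open>At Q = 0 the gauge rule loses its derivative term and becomes an intertwining
    relation with \<open>PA ?g' a\<close> at Q = 0, a matrix that might still depend on t. Its value
    at b' is known from \<open>frame_conn\<close>, while G0 and \<open>p a\<close> are unchanged by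
    evaluation there.\<close>
  have pG: "kmat (p a) ** G0 = G0 ** p' a" for a
  proof -
    have "map_matrix at_Q0 (smult_mat hbar (qM a G)) = 0" by (simp add: vec_eq_iff)
    then have "kmat (p a) ** G0 = G0 ** map_matrix at_Q0 (PA ?g' a)"
      using arg_cong[OF PG, of "map_matrix at_Q0" a]
      by (simp only: map_matrix_rhom(1,3)[OF rhom_at_Q0] P0 G0_def) simp
    then have "map_matrix B'.ev0 (kmat (p a) ** G0) = map_matrix B'.ev0 (G0 ** map_matrix at_Q0 (PA ?g' a))" by simp
    then have "kmat (p a) ** G0 = G0 ** map_matrix B'.ev0 (map_matrix at_Q0 (PA ?g' a))"
      by (simp only: map_matrix_rhom[OF B'.rhom_ev0] B'.ev0_kmat evG0)
    also have "map_matrix B'.ev0 (map_matrix at_Q0 (PA ?g' a)) = map_matrix B'.ev0 (conn_A E T' \<Phi>' \<beta>' a)"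
      by (simp only: PQ[OF T' g', symmetric] map_matrix_map B'.ev0_simps)
    also have "\<dots> = p' a"
      using frame_conn[OF b' T' fr' fb', of a] by (simp only: B'.ev0_eval_at p'_def)
    finally show ?thesis .
  qed
  \<comment> \<open>The point provided by \<open>big_AQDM\<close>, which may differ from both b and
    b'.\<close>
  obtain c S \<gamma> C where c: "O_point c" "centered S c" "fiber_basis E S \<gamma>"
    "\<forall>a n i j. ereal C \<le> vK (coeff (fiber_matrix E S \<gamma> (p_fib E S a ^^ n) $ i $ j) (\<lambda>_. 0) 0)"
    using aqdm unfolding big_AQDM_def by blast
  have "\<exists>B. \<forall>a n i j. absK (mpow (p a) n $ i $ j) \<le> B"
    by (rule powers_bounded[OF c(1,2,3) _ g P0]) (use c(4) in blast)
  then obtain B where B: "\<And>a n i j. absK (mpow (p a) n $ i $ j) \<le> B" by blast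
  obtain X D K where X: "Z = L ** (X ** G0)" "X ** D = mat 1" "L ** K = mat 1"
    "map_matrix hflip D = mat_exp (conn_sum (\<lambda>i. hpow (-1) * at_Q0 (b' (T i))) w)"
    "\<And>i j. X $ i $ j \<in> t_free"
    using solutions_related[where P = "PA ?g" and W = "WA ?g" and p = p, OF b T b' W0 L(1) L(2)[folded p] L(3)
        Z1 Z2 Z3 GH0 H0Q pG B] by blast
  have HG: "H ** G = mat 1" by (rule matrix_left_right_inverse_comm[OF GH])
  \<comment> \<open>The right factor X G0 has inverse H0 D; after the flip, H0 becomes the inverse
    of G0(-\<hbar>) and D the exponential.\<close>
  have "quantum_cone L' = (\<lambda>h. map_matrix hflip (H0 ** D) *v h) ` quantum_cone L"
  proof (rule quantum_cone_gauge[OF _ X(3) _ GH Gm Hm])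
    have "L' = H ** Z" by (simp add: Z_def matrix_mul_assoc HG)
    then show "L' = H ** (L ** (X ** G0))" by (simp only: X(1))
    have "X ** G0 ** (H0 ** D) = X ** (G0 ** H0) ** D" by (simp only: matrix_mul_assoc)
    then show "X ** G0 ** (H0 ** D) = mat 1" by (simp add: GH0 X(2))
    show "(X ** G0) $ i $ j \<in> t_free" for i j
      by (simp add: matrix_matrix_mult_def subring_of_sum[OF subring_t_free] t_free_mult X(5) G0t)
  qed
  moreover have "matrix_inv (map_matrix hflip G0) = map_matrix hflip H0"
    by (rule matrix_inv_unique) (simp only: map_matrix_rhom(1)[OF rhom_hflip, symmetric] GH0 map_matrix_rhom(2)[OF rhom_hflip])
  moreover have "(\<Sum>i\<in>UNIV. map_matrix (\<lambda>f. hpow (- 1) * at_Q0 (b' (T i)) * f) (fiber_matrix E T \<beta> (w_fib E T i))) =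
      conn_sum (\<lambda>i. hpow (-1) * at_Q0 (b' (T i))) w"
    by (simp only: conn_sum_def smult_mat_def w)
  ultimately show ?thesis
    by (simp only: map_matrix_rhom(1)[OF rhom_hflip] X(4) matrix_vector_mul_assoc)
qed

end
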